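(* Let $L$ be a smooth operator field on a smooth manifold of dimension four such that at every point $L$ has only one eigenvalue, and this eigenvalue has geometric multiplicity one (i.e. at every point $p$ the operator $L_p$ is similar to a single $4\times 4$ Jordan block with some real eigenvalue $\lambda(p)$). Let $\mathcal H^i_{jk}$ denote the components of the Haantjes torsion of $L$, put $\widehat L:=L-\tfrac14\operatorname{trace}(L)\cdot\mathbf 1$, where $\mathbf 1$ is the identity operator field, and consider the tensor field $T$ of type $(1,2)$ with components (summation over repeated indices) $$T^i_{jk}=\widehat L^i_s\,\mathcal H^s_{rk}\,\widehat L^r_j-\widehat L^i_s\,\mathcal H^s_{jr}\,\widehat L^r_k+\mathcal H^i_{sk}\,\widehat L^s_r\,\widehat L^r_j .$$ Then in a neighbourhood of each point there exists a coordinate system in which the matrix of $L$ is upper triangular if and only if $T$ vanishes identically.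
   Context: An operator field $L$ on a manifold is a (real) tensor field of type $(1,1)$, i.e. a field of endomorphisms of the tangent spaces. In local coordinates $x_1,\dots,x_n$ its matrix $(L^i_j)$ is given by $L\,\partial_{x_j}=\sum_i L^i_j\,\partial_{x_i}$. The matrix is upper triangular if $L^i_j=0$ for all $i>j$ at all points of the coordinate neighbourhood. The Nijenhuis torsion of $L$ is the tensor field of type $(1,2)$ defined, for vector fields $\xi,\eta$, by $$\mathcal T_L(\xi,\eta)=L^2[\xi,\eta]+[L\xi,L\eta]-L[L\xi,\eta]-L[\xi,L\eta],$$ where $[\cdot,\cdot]$ is the Lie bracket of vector fields. The Haantjes torsion of $L$ is the tensor field of type $(1,2)$ defined by $$\mathcal H(\xi,\eta)=L^2\mathcal T_L(\xi,\eta)+\mathcal T_L(L\xi,L\eta)-L\,\mathcal T_L(L\xi,\eta)-L\,\mathcal T_L(\xi,L\eta),$$ and its components are given by $\mathcal H(\partial_{x_j},\partial_{x_k})=\sum_i\mathcal H^i_{jk}\,\partial_{x_i}$ (and likewise for $T$). In coordinate-free form, $T(\xi,\eta)=\widehat L\,\mathcal H(\widehat L\xi,\eta)-\widehat L\,\mathcal H(\xi,\widehat L\eta)+\mathcal H(\widehat L^2\xi,\eta)$. *)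

theory Defs
  imports "HOL-Analysis.Analysis" "HOL-Library.Function_Algebras"
begin

section \<open>Smooth maps and smooth manifolds\<close>

fun Ck_on :: "nat \<Rightarrow> 'a::real_normed_vector set \<Rightarrow> ('a \<Rightarrow> 'b::real_normed_vector) \<Rightarrow> bool" where
  "Ck_on 0 U f \<longleftrightarrow> continuous_on U f"
| "Ck_on (Suc k) U f \<longleftrightarrow> (\<forall>x\<in>U. f differentiable (at x)) \<and>
     (\<forall>v. Ck_on k U (\<lambda>x. frechet_derivative f (at x) v))"

text \<open>Only meaningful for open \<open>U\<close>, since derivatives are taken with respect to full neighbourhoods.\<close>

definition smooth_on :: "'a::real_normed_vector set \<Rightarrow> ('a \<Rightarrow> 'b::real_normed_vector) \<Rightarrow> bool" where
  "smooth_on U f \<longleftrightarrow> (\<forall>k. Ck_on k U f)"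

text \<open>A chart is a pair of its domain and its coordinate map; the values of the coordinate map
  outside the domain are irrelevant.\<close>

type_synonym ('a, 'n) chart = "'a set \<times> ('a \<Rightarrow> real^'n)"

definition chart_inv :: "('a, 'n::finite) chart \<Rightarrow> real^'n \<Rightarrow> 'a" where
  "chart_inv c = inv_into (fst c) (snd c)"

definition chart_on :: "'a topology \<Rightarrow> ('a, 'n::finite) chart \<Rightarrow> bool" where
  "chart_on M c \<longleftrightarrow> openin M (fst c) \<and> open (snd c ` fst c) \<and>
     homeomorphic_map (subtopology M (fst c)) (top_of_set (snd c ` fst c)) (snd c)"

definition transition :: "('a, 'n::finite) chart \<Rightarrow> ('a, 'n) chart \<Rightarrow> real^'n \<Rightarrow> real^'n" where
  "transition c d = snd d \<circ> chart_inv c"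

definition compatible :: "('a, 'n::finite) chart \<Rightarrow> ('a, 'n) chart \<Rightarrow> bool" where
  "compatible c d \<longleftrightarrow>
     smooth_on (snd c ` (fst c \<inter> fst d)) (transition c d) \<and>
     smooth_on (snd d ` (fst c \<inter> fst d)) (transition d c)"

text \<open>\<open>S\<close> is a maximal smooth atlas, so its elements are exactly the local coordinate systems of
  the manifold; the dimension is \<open>CARD('n)\<close>.\<close>

definition smooth_manifold :: "'a topology \<Rightarrow> ('a, 'n::finite) chart set \<Rightarrow> bool" where
  "smooth_manifold M S \<longleftrightarrow>
     Hausdorff_space M \<and> second_countable M \<and>
     (\<forall>c\<in>S. chart_on M c) \<and>
     (\<Union>c\<in>S. fst c) = topspace M \<and>
     (\<forall>c\<in>S. \<forall>d\<in>S. compatible c d) \<and>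
     (\<forall>c. chart_on M c \<and> (\<forall>d\<in>S. compatible c d) \<longrightarrow> c \<in> S)"


section \<open>Tangent spaces, vector fields and operator fields\<close>

text \<open>A tangent vector at \<open>p\<close> is a family of component vectors, one for each coordinate system
  around \<open>p\<close>, related by the Jacobi matrices of the coordinate changes. The value 0 is
  prescribed at the irrelevant indices, so that equality of tangent vectors is equality of
  functions. Sums and differences of tangent vectors (and of vector fields) are the pointwise ones
  of Function_Algebras.\<close>

type_synonym ('a, 'n) tvec = "('a, 'n) chart \<Rightarrow> real^'n"

definition tangent_space :: "('a, 'n::finite) chart set \<Rightarrow> 'a \<Rightarrow> ('a, 'n) tvec set" where
  "tangent_space S p = {v.
     (\<forall>c. \<not> (c \<in> S \<and> p \<in> fst c) \<longrightarrow> v c = 0) \<and>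
     (\<forall>c\<in>S. \<forall>d\<in>S. p \<in> fst c \<inter> fst d \<longrightarrow>
        v d = frechet_derivative (transition c d) (at (snd c p)) (v c))}"

text \<open>A (possibly only locally defined) vector field assigns to a point a tangent vector there.\<close>

type_synonym ('a, 'n) vfield = "'a \<Rightarrow> ('a, 'n) tvec"

text \<open>The coordinate vector field \<open>\<partial>/\<partial>x\<^sub>j\<close> of the coordinate system \<open>c\<close>. Since its components
  with respect to \<open>c\<close> itself form the \<open>j\<close>-th unit vector, any tangent vector \<open>v\<close> at a point of
  \<open>fst c\<close> has \<open>v c $ i\<close> as its \<open>i\<close>-th coefficient in the basis of coordinate vectors of \<open>c\<close>.\<close>

definition coord_field :: "('a, 'n::finite) chart set \<Rightarrow> ('a, 'n) chart \<Rightarrow> 'n \<Rightarrow> ('a, 'n) vfield" where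
  "coord_field S c j = (\<lambda>p d.
     if d \<in> S \<and> p \<in> fst c \<inter> fst d
     then frechet_derivative (transition c d) (at (snd c p)) (axis j 1) else 0)"

text \<open>In coordinates, \<open>[\<xi>, \<eta>]\<^sup>i = \<Sum>s. \<xi>\<^sup>s \<partial>\<^sub>s \<eta>\<^sup>i - \<eta>\<^sup>s \<partial>\<^sub>s \<xi>\<^sup>i\<close>.\<close>

definition lie_bracket ::
  "('a, 'n::finite) chart set \<Rightarrow> ('a, 'n) vfield \<Rightarrow> ('a, 'n) vfield \<Rightarrow> ('a, 'n) vfield" where
  "lie_bracket S \<xi> \<eta> = (\<lambda>p c.
     if c \<in> S \<and> p \<in> fst c
     then frechet_derivative (\<lambda>x. \<eta> (chart_inv c x) c) (at (snd c p)) (\<xi> p c)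
        - frechet_derivative (\<lambda>x. \<xi> (chart_inv c x) c) (at (snd c p)) (\<eta> p c)
     else 0)"

type_synonym ('a, 'n) opfield = "'a \<Rightarrow> ('a, 'n) tvec \<Rightarrow> ('a, 'n) tvec"

definition op_apply :: "('a, 'n::finite) opfield \<Rightarrow> ('a, 'n) vfield \<Rightarrow> ('a, 'n) vfield" where
  "op_apply L \<xi> = (\<lambda>p. L p (\<xi> p))"

text \<open>The entry in row \<open>i\<close> and column \<open>j\<close> is the coefficient \<open>L\<^sup>i\<^sub>j\<close> of
  \<open>L \<partial>\<^sub>j = \<Sum>i. L\<^sup>i\<^sub>j \<partial>\<^sub>i\<close>.\<close>

definition op_matrix ::
  "('a, 'n::finite) chart set \<Rightarrow> ('a, 'n) opfield \<Rightarrow> ('a, 'n) chart \<Rightarrow> 'a \<Rightarrow> real^'n^'n" where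
  "op_matrix S L c p = (\<chi> i j. op_apply L (coord_field S c j) p c $ i)"

definition smooth_operator_field ::
  "'a topology \<Rightarrow> ('a, 'n::finite) chart set \<Rightarrow> ('a, 'n) opfield \<Rightarrow> bool" where
  "smooth_operator_field M S L \<longleftrightarrow>
     (\<forall>p\<in>topspace M.
        (\<forall>v\<in>tangent_space S p. L p v \<in> tangent_space S p) \<and>
        (\<forall>v\<in>tangent_space S p. \<forall>w\<in>tangent_space S p. \<forall>a b.
           L p (\<lambda>c. a *\<^sub>R v c + b *\<^sub>R w c) = (\<lambda>c. a *\<^sub>R L p v c + b *\<^sub>R L p w c))) \<and>
     (\<forall>c\<in>S. smooth_on (snd c ` fst c) (\<lambda>x. op_matrix S L c (chart_inv c x)))"

definition upper_triangular_in ::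
  "('a, 'n::{finite,linorder}) chart set \<Rightarrow> ('a, 'n) opfield \<Rightarrow> ('a, 'n) chart \<Rightarrow> bool" where
  "upper_triangular_in S L c \<longleftrightarrow> (\<forall>p\<in>fst c. \<forall>i j. j < i \<longrightarrow> op_matrix S L c p $ i $ j = 0)"

section \<open>Nijenhuis and Haantjes torsion\<close>

definition nijenhuis ::
  "('a, 'n::finite) chart set \<Rightarrow> ('a, 'n) opfield \<Rightarrow> ('a, 'n) vfield \<Rightarrow> ('a, 'n) vfield \<Rightarrow> ('a, 'n) vfield"
  where
  "nijenhuis S L \<xi> \<eta> =
     op_apply L (op_apply L (lie_bracket S \<xi> \<eta>))
     + lie_bracket S (op_apply L \<xi>) (op_apply L \<eta>)
     - op_apply L (lie_bracket S (op_apply L \<xi>) \<eta>)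
     - op_apply L (lie_bracket S \<xi> (op_apply L \<eta>))"

definition haantjes ::
  "('a, 'n::finite) chart set \<Rightarrow> ('a, 'n) opfield \<Rightarrow> ('a, 'n) vfield \<Rightarrow> ('a, 'n) vfield \<Rightarrow> ('a, 'n) vfield"
  where
  "haantjes S L \<xi> \<eta> =
     op_apply L (op_apply L (nijenhuis S L \<xi> \<eta>))
     + nijenhuis S L (op_apply L \<xi>) (op_apply L \<eta>)
     - op_apply L (nijenhuis S L (op_apply L \<xi>) \<eta>)
     - op_apply L (nijenhuis S L \<xi> (op_apply L \<eta>))"

text \<open>\<open>haantjes_comp S L c p i j k\<close> is the component \<open>H\<^sup>i\<^sub>j\<^sub>k\<close> at \<open>p\<close> in the coordinate system \<open>c\<close>.\<close>

definition haantjes_comp ::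
  "('a, 'n::finite) chart set \<Rightarrow> ('a, 'n) opfield \<Rightarrow> ('a, 'n) chart \<Rightarrow> 'a \<Rightarrow> 'n \<Rightarrow> 'n \<Rightarrow> 'n \<Rightarrow> real" where
  "haantjes_comp S L c p i j k = haantjes S L (coord_field S c j) (coord_field S c k) p c $ i"


section \<open>Dimension four\<close>

text \<open>The elements of the type \<open>4\<close> are \<open>0 < 1 < 2 < 3\<close>, so the coordinates are numbered from 0
  to 3. Addition in this type is cyclic; the condition \<open>i < j\<close> below excludes the corner entry
  with \<open>i = 3\<close>, \<open>j = 0\<close>.\<close>

definition jordan_block4 :: "real \<Rightarrow> real^4^4" where
  "jordan_block4 \<mu> = (\<chi> i j. if i = j then \<mu> else if i < j \<and> j = i + 1 then 1 else 0)"

text \<open>The operator \<open>L p\<close> is similar to a single Jordan block, by means of a linear isomorphism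
  \<open>P\<close> from \<open>real^4\<close> to the tangent space.\<close>

definition single_jordan_block :: "('a, 4) chart set \<Rightarrow> ('a, 4) opfield \<Rightarrow> 'a \<Rightarrow> bool" where
  "single_jordan_block S L p \<longleftrightarrow>
     (\<exists>\<mu> P. bij_betw P UNIV (tangent_space S p) \<and> (\<forall>c. linear (\<lambda>a. P a c)) \<and>
        (\<forall>a. L p (P a) = P (jordan_block4 \<mu> *v a)))"

definition tracefree_matrix ::
  "('a, 4) chart set \<Rightarrow> ('a, 4) opfield \<Rightarrow> ('a, 4) chart \<Rightarrow> 'a \<Rightarrow> real^4^4" where
  "tracefree_matrix S L c p = op_matrix S L c p - (1/4 * trace (op_matrix S L c p)) *\<^sub>R mat 1"

definition T_comp ::
  "('a, 4) chart set \<Rightarrow> ('a, 4) opfield \<Rightarrow> ('a, 4) chart \<Rightarrow> 'a \<Rightarrow> 4 \<Rightarrow> 4 \<Rightarrow> 4 \<Rightarrow> real" where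
  "T_comp S L c p i j k =
     (let B = tracefree_matrix S L c p; H = haantjes_comp S L c p in
        (\<Sum>s\<in>UNIV. \<Sum>r\<in>UNIV. B $ i $ s * H s r k * B $ r $ j)
      - (\<Sum>s\<in>UNIV. \<Sum>r\<in>UNIV. B $ i $ s * H s j r * B $ r $ k)
      + (\<Sum>s\<in>UNIV. \<Sum>r\<in>UNIV. H i s k * B $ s $ r * B $ r $ j))"

end

theory Submission
  imports Defs
begin

text \<open>Put \<open>B = L - 1/4 trace(L) 1\<close>, a nilpotent field with a single Jordan block at every point. As the
  flag \<open>ker B \<subset> ker B\<^sup>2 \<subset> ker B\<^sup>3\<close> is the only \<open>B\<close>-invariant one, \<open>L\<close> is upper triangular in some
  coordinates iff these kernels are spanned by the first coordinate fields, which is possible iff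
  \<open>ker B\<^sup>2\<close> and \<open>ker B\<^sup>3\<close> are integrable. The Haantjes torsions of \<open>L\<close> and \<open>B\<close> agree. For a constant
  vector \<open>v\<close> in coordinates, the fields \<open>e\<^sub>i = B\<^sup>i v\<close> satisfy \<open>T(e\<^sub>0, e\<^sub>0) = - 4 B\<^sup>3[e\<^sub>1, e\<^sub>2]\<close>,
  \<open>T(e\<^sub>1, e\<^sub>0) = - 2 B\<^sup>3[e\<^sub>1, e\<^sub>3] + B\<^sup>2[e\<^sub>2, e\<^sub>3]\<close> and \<open>T(e\<^sub>0, e\<^sub>1) = - 2 B\<^sup>3[e\<^sub>1, e\<^sub>3] - B\<^sup>2[e\<^sub>2, e\<^sub>3]\<close>,
  while all other components reduce to these three brackets; so \<open>T = 0\<close> is exactly integrability.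

  Triangular coordinates are found in three straightening steps. If \<open>ker B\<^sup>k\<close> is spanned by
  \<open>\<partial>\<^sub>0, \<dots>, \<partial>\<^sub>k\<^sub>-\<^sub>1\<close>, normalise a field \<open>X\<close> in \<open>ker B\<^sup>k\<^sup>+\<^sup>1\<close> such that its components \<open>0, \<dots>, k-1\<close> vanish
  and another one is 1; integrability then gives \<open>\<partial>\<^sub>i X = 0\<close> for \<open>i < k\<close>, so that the flow of \<open>X\<close> keeps
  these coordinate fields and straightens \<open>X\<close>. The flow is a fixed point in the Banach space of
  continuous curves, and its smoothness follows by differentiating the fixed point equation.\<close>

section \<open>Calculus of smooth maps\<close>

text \<open>\<open>Ck_on\<close> tests derivatives one direction at a time, and its chain rule below
  works by expanding directions over a finite basis.

  The three brackets suffice because \<open>ker B^2\<close> is spanned by \<open>e_2, e_3\<close>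
  and \<open>ker B^3\<close> by \<open>e_1, e_2, e_3\<close>, while \<open>B^2[e_2, e_3] = 0\<close>
  already gives \<open>B^3[e_2, e_3] = 0\<close>; \<open>ker B\<close> is a line field and
  integrable for free.

  The derivative of \<open>X\<close> along an earlier coordinate direction vanishes for the
  following reason. Integrability puts it into \<open>ker B^(k+1)\<close>. As \<open>B^k\<close>
  maps this kernel to the line \<open>ker B\<close>, it is a multiple of \<open>X\<close> modulo
  \<open>ker B^k\<close>, the span of the first \<open>k\<close> coordinate fields. The component of
  \<open>X\<close> normalised to 1 has derivative 0 and forces the multiple to be 0; the components
  normalised to 0 remove the rest. Three straightening steps are enough because the fourth kernel is
  the whole tangent space.\<close>

text \<open>Openness of \<open>U\<close> matters: \<open>frechet_derivative\<close> at a point sees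
  a full neighbourhood, so agreement on \<open>U\<close> carries over to derivatives.\<close>

lemma Ck_on_cong:
  assumes "open U" "\<And>x. x \<in> U \<Longrightarrow> f x = g x" "Ck_on k U f"
  shows "Ck_on k U g"
  using assms(2,3)
proof (induction k arbitrary: f g)
  case 0
  then show ?case by (auto cong: continuous_on_cong)
next
  case (Suc k)
  have d: "f differentiable (at x)" if "x \<in> U" for x
    using Suc that by auto
  have g: "(g has_derivative frechet_derivative f (at x)) (at x)" if "x \<in> U" for x
    using d[OF that] unfolding frechet_derivative_works
    by (rule has_derivative_transform_within_open[OF _ assms(1) that]) (use Suc in auto)
  have e: "frechet_derivative g (at x) = frechet_derivative f (at x)" if "x \<in> U" for x
    using frechet_derivative_at[OF g[OF that]] by simp
  show ?case
  proof (simp, intro conjI ballI allI)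
    show "g differentiable (at x)" if "x \<in> U" for x
      using g[OF that] unfolding differentiable_def by blast
    show "Ck_on k U (\<lambda>x. frechet_derivative g (at x) v)" for v
      by (rule Suc.IH[of "\<lambda>x. frechet_derivative f (at x) v"]) (use e Suc.prems in auto)
  qed
qed

lemma Ck_on_subset:
  assumes "Ck_on k U f" "V \<subseteq> U"
  shows "Ck_on k V f"
  using assms(1)
proof (induction k arbitrary: f)
  case 0
  then show ?case using assms(2) continuous_on_subset by auto
next
  case (Suc k)
  then show ?case using assms(2) by auto
qed

text \<open>Any formula for the derivative may stand in for \<open>frechet_derivative\<close>. This
  permits bootstrapping: if the formula involves \<open>f\<close> itself, order \<open>k\<close> of
  \<open>f\<close> yields order \<open>Suc k\<close>.\<close>

lemma Ck_on_SucI: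
  assumes "open U" "\<And>x. x \<in> U \<Longrightarrow> (f has_derivative f' x) (at x)"
    and "\<And>v. Ck_on k U (\<lambda>x. f' x v)"
  shows "Ck_on (Suc k) U f"
proof (simp, intro conjI ballI allI)
  show "f differentiable (at x)" if "x \<in> U" for x
    using assms(2)[OF that] unfolding differentiable_def by blast
  show "Ck_on k U (\<lambda>x. frechet_derivative f (at x) v)" for v
  proof (rule Ck_on_cong[OF assms(1) _ assms(3)])
    show "f' x v = frechet_derivative f (at x) v" if "x \<in> U" for x
      using frechet_derivative_at[OF assms(2)[OF that]] by simp
  qed
qed

lemma Ck_on_has_derivative:
  "Ck_on (Suc k) U f \<Longrightarrow> x \<in> U \<Longrightarrow> (f has_derivative frechet_derivative f (at x)) (at x)"
  by (simp add: frechet_derivative_works)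

lemma Ck_on_imp_continuous_on: "Ck_on k U f \<Longrightarrow> continuous_on U f"
proof (cases k)
  case (Suc k')
  assume "Ck_on k U f"
  then have "\<And>x. x \<in> U \<Longrightarrow> isCont f x"
    using Suc by (auto intro: differentiable_imp_continuous_within)
  then show ?thesis by (simp add: continuous_at_imp_continuous_on)
qed simp

lemma Ck_on_Suc_imp: "Ck_on (Suc k) U f \<Longrightarrow> Ck_on k U f"
proof (induction k arbitrary: f)
  case 0
  then show ?case using Ck_on_imp_continuous_on[of "Suc 0" U f] by simp
next
  case (Suc k)
  then show ?case by simp
qed

lemma Ck_on_const: "open U \<Longrightarrow> Ck_on k U (\<lambda>x. c)"
  by (induction k arbitrary: c) (auto intro!: Ck_on_SucI[where f' = "\<lambda>x v. 0"])

lemma Ck_on_bounded_linear: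
  assumes "open U" "bounded_linear L" "Ck_on k U f"
  shows "Ck_on k U (\<lambda>x. L (f x))"
  using assms(3)
proof (induction k arbitrary: f)
  case 0
  then show ?case
    using linear_continuous_on[OF assms(2)] continuous_on_compose2[of UNIV L U f] by auto
next
  case (Suc k)
  show ?case
  proof (rule Ck_on_SucI[OF assms(1)])
    show "((\<lambda>x. L (f x)) has_derivative (\<lambda>v. L (frechet_derivative f (at x) v))) (at x)"
      if "x \<in> U" for x
      by (rule bounded_linear.has_derivative[OF assms(2) Ck_on_has_derivative[OF Suc.prems that]])
    show "Ck_on k U (\<lambda>x. L (frechet_derivative f (at x) v))" for v
      by (rule Suc.IH) (use Suc.prems in simp)
  qed
qed

lemma Ck_on_ident: "open U \<Longrightarrow> Ck_on k U (\<lambda>x. x)"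
proof (cases k)
  case (Suc k')
  assume "open U"
  then show ?thesis unfolding Suc
    by (intro Ck_on_SucI[where f' = "\<lambda>x v. v"] Ck_on_const) (auto intro: has_derivative_ident)
qed simp

lemma Ck_on_add:
  assumes "open U" "Ck_on k U f" "Ck_on k U g"
  shows "Ck_on k U (\<lambda>x. f x + g x)"
  using assms(2,3)
proof (induction k arbitrary: f g)
  case 0
  then show ?case by (auto intro: continuous_on_add)
next
  case (Suc k)
  show ?case
    by (rule Ck_on_SucI[OF assms(1) has_derivative_add])
      (use Suc in \<open>auto intro!: Suc.IH simp: frechet_derivative_works\<close>)
qed

lemma Ck_on_sum:
  assumes "open U" "\<And>i. i \<in> I \<Longrightarrow> Ck_on k U (f i)"
  shows "Ck_on k U (\<lambda>x. \<Sum>i\<in>I. f i x)"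
  using assms(2)
  by (induction I rule: infinite_finite_induct) (auto intro!: Ck_on_const Ck_on_add assms(1))

lemma Ck_on_bounded_bilinear:
  assumes "open U" "bounded_bilinear P" "Ck_on k U f" "Ck_on k U g"
  shows "Ck_on k U (\<lambda>x. P (f x) (g x))"
  using assms(3,4)
proof (induction k arbitrary: f g)
  case 0
  then show ?case by (auto intro: bounded_bilinear.continuous_on[OF assms(2)])
next
  case (Suc k)
  show ?case
  proof (rule Ck_on_SucI[OF assms(1)])
    show "((\<lambda>x. P (f x) (g x)) has_derivative
        (\<lambda>v. P (f x) (frechet_derivative g (at x) v) + P (frechet_derivative f (at x) v) (g x))) (at x)"
      if "x \<in> U" for x
      by (rule bounded_bilinear.FDERIV[OF assms(2)])
        (use Ck_on_has_derivative[OF _ that] Suc.prems in auto)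
    show "Ck_on k U (\<lambda>x. P (f x) (frechet_derivative g (at x) v)
        + P (frechet_derivative f (at x) v) (g x))" for v
      using Suc.prems Ck_on_Suc_imp[of k U f] Ck_on_Suc_imp[of k U g]
      by (intro Ck_on_add Suc.IH assms(1)) auto
  qed
qed

lemmas Ck_on_scaleR = Ck_on_bounded_bilinear[OF _ bounded_bilinear_scaleR]
lemmas Ck_on_mult = Ck_on_bounded_bilinear[OF _ bounded_bilinear_mult]

lemma Ck_on_uminus: "open U \<Longrightarrow> Ck_on k U f \<Longrightarrow> Ck_on k U (\<lambda>x. - f x)"
  by (rule Ck_on_bounded_linear[OF _ bounded_linear_minus[OF bounded_linear_ident]])

lemma Ck_on_diff:
  assumes "open U" "Ck_on k U f" "Ck_on k U g"
  shows "Ck_on k U (\<lambda>x. f x - g x)"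
  using Ck_on_add[OF assms(1,2) Ck_on_uminus[OF assms(1,3)]] by simp

lemma linear_euclidean_expand:
  fixes f :: "'a::euclidean_space \<Rightarrow> 'b::real_vector"
  assumes "linear f"
  shows "f v = (\<Sum>i\<in>Basis. (v \<bullet> i) *\<^sub>R f i)"
  by (subst euclidean_representation[of v, symmetric])
    (simp add: linear_sum[OF assms] linear_scale[OF assms])

text \<open>In the derivative of the composite, the direction fed to the derivative of
  \<open>g\<close> varies with \<open>x\<close>, whereas \<open>Ck_on\<close> controls fixed
  directions only. Expanding it over the basis of the intermediate Euclidean space leaves products
  of functions covered by the hypotheses and the induction.\<close>

lemma Ck_on_compose:
  fixes g :: "'b::euclidean_space \<Rightarrow> 'c::real_normed_vector"
  assumes "open U" "open V" "Ck_on k U f" "Ck_on k V g" "f ` U \<subseteq> V"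
  shows "Ck_on k U (\<lambda>x. g (f x))"
  using assms(3,4)
proof (induction k arbitrary: g)
  case 0
  then show ?case using assms(5) continuous_on_compose2 by auto
next
  case (Suc k)
  let ?f' = "\<lambda>x. frechet_derivative f (at x)" and ?g' = "\<lambda>y. frechet_derivative g (at y)"
  show ?case
  proof (rule Ck_on_SucI[OF assms(1)])
    fix x assume x: "x \<in> U"
    have f: "(f has_derivative ?f' x) (at x)"
      by (rule Ck_on_has_derivative[OF Suc.prems(1) x])
    have g: "(g has_derivative ?g' (f x)) (at (f x))"
      by (rule Ck_on_has_derivative[OF Suc.prems(2)]) (use x assms(5) in auto)
    have eq: "?g' (f x) (?f' x v) = (\<Sum>i\<in>Basis. (?f' x v \<bullet> i) *\<^sub>R ?g' (f x) i)" for v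
      by (rule linear_euclidean_expand[OF has_derivative_linear[OF g]])
    show "((\<lambda>x. g (f x)) has_derivative (\<lambda>v. \<Sum>i\<in>Basis. (?f' x v \<bullet> i) *\<^sub>R ?g' (f x) i)) (at x)"
      using has_derivative_compose[OF f g] unfolding eq .
  next
    show "Ck_on k U (\<lambda>x. \<Sum>i\<in>Basis. (?f' x v \<bullet> i) *\<^sub>R ?g' (f x) i)" for v
    proof (intro Ck_on_sum Ck_on_scaleR assms(1))
      show "Ck_on k U (\<lambda>x. ?f' x v \<bullet> i)" for i
        using Suc.prems(1)
        by (intro Ck_on_bounded_linear[OF assms(1) bounded_linear_inner_left]) auto
      show "Ck_on k U (\<lambda>x. ?g' (f x) i)" for i
        by (rule Suc.IH) (use Suc.prems Ck_on_Suc_imp in auto)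
    qed
  qed
qed

lemma Ck_on_inverse:
  fixes f :: "'a::real_normed_vector \<Rightarrow> real"
  assumes "open U" "Ck_on k U f" "\<And>x. x \<in> U \<Longrightarrow> f x \<noteq> 0"
  shows "Ck_on k U (\<lambda>x. inverse (f x))"
  using assms(2)
proof (induction k)
  case 0
  then show ?case using assms(3) by (auto intro: continuous_on_inverse)
next
  case (Suc k)
  let ?f' = "\<lambda>x. frechet_derivative f (at x)"
  show ?case
  proof (rule Ck_on_SucI[OF assms(1)])
    show "((\<lambda>x. inverse (f x)) has_derivative (\<lambda>v. - (inverse (f x) * ?f' x v * inverse (f x)))) (at x)"
      if "x \<in> U" for x
      by (rule Deriv.has_derivative_inverse[OF assms(3)[OF that] Ck_on_has_derivative[OF Suc.prems that]])
    show "Ck_on k U (\<lambda>x. - (inverse (f x) * ?f' x v * inverse (f x)))" for v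
      by (intro Ck_on_uminus Ck_on_mult assms(1))
        (use Suc Ck_on_Suc_imp[OF Suc.prems] in auto)
  qed
qed

lemma smooth_onD: "smooth_on U f \<Longrightarrow> Ck_on k U f"
  by (simp add: smooth_on_def)

lemma smooth_on_subset: "smooth_on U f \<Longrightarrow> V \<subseteq> U \<Longrightarrow> smooth_on V f"
  by (auto simp: smooth_on_def intro: Ck_on_subset)

lemma smooth_on_cong:
  "open U \<Longrightarrow> (\<And>x. x \<in> U \<Longrightarrow> f x = g x) \<Longrightarrow> smooth_on U f \<Longrightarrow> smooth_on U g"
  unfolding smooth_on_def using Ck_on_cong by blast

lemma smooth_on_compose:
  fixes g :: "'b::euclidean_space \<Rightarrow> 'c::real_normed_vector"
  assumes "open U" "open V" "smooth_on U f" "smooth_on V g" "f ` U \<subseteq> V"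
  shows "smooth_on U (\<lambda>x. g (f x))"
  using assms Ck_on_compose unfolding smooth_on_def by blast

lemma smooth_on_has_derivative:
  "smooth_on U f \<Longrightarrow> x \<in> U \<Longrightarrow> (f has_derivative frechet_derivative f (at x)) (at x)"
  using Ck_on_has_derivative smooth_onD by blast

lemma smooth_on_derivative:
  "smooth_on U f \<Longrightarrow> smooth_on U (\<lambda>x. frechet_derivative f (at x) v)"
  unfolding smooth_on_def by (metis Ck_on.simps(2))

lemma smooth_on_imp_continuous_on: "smooth_on U f \<Longrightarrow> continuous_on U f"
  using Ck_on_imp_continuous_on smooth_onD by blast

lemma smooth_on_bounded_linear:
  "open U \<Longrightarrow> bounded_linear L \<Longrightarrow> smooth_on U f \<Longrightarrow> smooth_on U (\<lambda>x. L (f x))"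
  unfolding smooth_on_def using Ck_on_bounded_linear by blast

lemma smooth_on_bounded_bilinear:
  "open U \<Longrightarrow> bounded_bilinear P \<Longrightarrow> smooth_on U f \<Longrightarrow> smooth_on U g \<Longrightarrow>
    smooth_on U (\<lambda>x. P (f x) (g x))"
  unfolding smooth_on_def using Ck_on_bounded_bilinear by blast

section \<open>Inverses of smooth operator families\<close>

text \<open>The resolvent identity: inserting the two units gives
  \<open>s - r = s a r - s b r\<close>.\<close>

lemma blinfun_inverse_diff:
  fixes a b r s :: "'b::real_normed_vector \<Rightarrow>\<^sub>L 'b"
  assumes "s o\<^sub>L b = id_blinfun" "a o\<^sub>L r = id_blinfun"
  shows "s - r = - (s o\<^sub>L ((b - a) o\<^sub>L r))"
proof (rule blinfun_eqI)
  fix x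
  have "s (b (r x)) = r x" "a (r x) = x"
    using arg_cong[OF assms(1), of "\<lambda>f. f (r x)"] arg_cong[OF assms(2), of "\<lambda>f. f x"] by simp_all
  then show "(s - r) x = (- (s o\<^sub>L ((b - a) o\<^sub>L r))) x"
    by (simp add: blinfun.bilinear_simps)
qed

text \<open>No bound on \<open>R p\<close> is given in advance. Near \<open>q\<close> the resolvent
  identity yields \<open>norm (R p) \<le> norm (R q) + norm (R p) / 2\<close>, hence the bound
  \<open>2 * norm (R q)\<close>; inserted into the identity again, it makes \<open>R p - R q\<close>
  small.\<close>

lemma tendsto_blinfun_inverse:
  fixes A R :: "'a::metric_space \<Rightarrow> 'b::real_normed_vector \<Rightarrow>\<^sub>L 'b"
  assumes "open Q" "q \<in> Q" "continuous_on Q A"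
    and l: "\<And>q. q \<in> Q \<Longrightarrow> R q o\<^sub>L A q = id_blinfun"
    and r: "\<And>q. q \<in> Q \<Longrightarrow> A q o\<^sub>L R q = id_blinfun"
  shows "(R \<longlongrightarrow> R q) (at q)"
proof -
  have A: "(A \<longlongrightarrow> A q) (at q)"
    using assms(1-3) continuous_on_eq_continuous_at isCont_def by blast
  have n: "((\<lambda>p. norm (A p - A q) * norm (R q)) \<longlongrightarrow> 0) (at q)"
    by (rule tendsto_eq_intros tendsto_norm_zero LIM_zero A | simp)+
  have ev: "\<forall>\<^sub>F p in at q. norm (A p - A q) * norm (R q) < 1/2 \<and> p \<in> Q"
    using order_tendstoD(2)[OF n, of "1/2"] assms(1,2)
    by (auto simp: eventually_conj_iff eventually_at_in_open')
  have "\<forall>\<^sub>F p in at q. norm (R p - R q) \<le> 2 * norm (R q) * (norm (A p - A q) * norm (R q))"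
    using ev
  proof (eventually_elim)
    case (elim p)
    have "norm (R p - R q) = norm (R p o\<^sub>L ((A p - A q) o\<^sub>L R q))"
      using blinfun_inverse_diff[OF l r] elim assms(2) by simp
    also have "\<dots> \<le> norm (R p) * norm ((A p - A q) o\<^sub>L R q)"
      by (rule norm_blinfun_compose)
    also have "\<dots> \<le> norm (R p) * (norm (A p - A q) * norm (R q))"
      by (intro mult_left_mono norm_blinfun_compose) auto
    finally have d: "norm (R p - R q) \<le> norm (R p) * (norm (A p - A q) * norm (R q))" .
    have "norm (R p) \<le> norm (R q) + norm (R p - R q)"
      by (metis add.commute diff_add_cancel norm_triangle_ineq)
    also have "\<dots> \<le> norm (R q) + norm (R p) * (1/2)"
      using order_trans[OF d mult_left_mono, of "1/2"] elim by auto
    finally have "norm (R p) \<le> 2 * norm (R q)" by simp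
    from order_trans[OF d mult_right_mono[OF this]] show ?case by simp
  qed
  moreover have "((\<lambda>p. 2 * norm (R q) * (norm (A p - A q) * norm (R q))) \<longlongrightarrow> 0) (at q)"
    by (rule tendsto_eq_intros n | simp)+
  ultimately have "((\<lambda>p. R p - R q) \<longlongrightarrow> 0) (at q)"
    by (rule Lim_null_comparison)
  then show ?thesis by (simp add: LIM_zero_iff)
qed

lemma has_derivative_blinfun_inverse:
  fixes A R :: "'a::real_normed_vector \<Rightarrow> 'b::real_normed_vector \<Rightarrow>\<^sub>L 'b"
  assumes "open Q" "q \<in> Q" "continuous_on Q A" and A: "(A has_derivative A') (at q)"
    and l: "\<And>q. q \<in> Q \<Longrightarrow> R q o\<^sub>L A q = id_blinfun"
    and r: "\<And>q. q \<in> Q \<Longrightarrow> A q o\<^sub>L R q = id_blinfun"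
  shows "(R has_derivative (\<lambda>h. - (R q o\<^sub>L (A' h o\<^sub>L R q)))) (at q)"
proof -
  note comp = bounded_bilinear_blinfun_compose
  note cl = bounded_bilinear.bounded_linear_left[OF comp] bounded_bilinear.bounded_linear_right[OF comp]
  have A': "bounded_linear A'" using A by (rule has_derivative_bounded_linear)
  obtain K where K: "\<And>h. norm (A' h) \<le> norm h * K"
    using bounded_linear.bounded[OF A'] by blast
  have R0: "((\<lambda>h. R (q + h)) \<longlongrightarrow> R q) (at 0)"
    using tendsto_blinfun_inverse[OF assms(1-3) l r] by (simp add: LIM_offset_zero_iff)
  have A0: "((\<lambda>h. norm (A (q + h) - A q - A' h) / norm h) \<longlongrightarrow> 0) (at 0)"
    using A by (simp add: has_derivative_at)
  have "((\<lambda>h. norm (R (q + h) - R q - (- (R q o\<^sub>L (A' h o\<^sub>L R q)))) / norm h) \<longlongrightarrow> 0) (at 0)"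
  proof (rule Lim_null_comparison)
    \<comment> \<open>The resolvent identity splits the error in two: the remainder of
      \<open>A\<close>, multiplied by the convergent \<open>R (q + h)\<close>, and the linear term
      \<open>A' h\<close>, multiplied by the vanishing increment of \<open>R\<close>.\<close>
    let ?g = "\<lambda>h. norm (R (q + h)) * ((norm (A (q + h) - A q - A' h) / norm h) * norm (R q))
        + norm (R (q + h) - R q) * (K * norm (R q))"
    have "((\<lambda>h. norm (R (q + h) - R q)) \<longlongrightarrow> 0) (at 0)"
      by (intro tendsto_norm_zero LIM_zero R0)
    then show "(?g \<longlongrightarrow> 0) (at 0)"
      by - (rule tendsto_eq_intros A0 R0 | simp)+
    have "open ((\<lambda>h. q + h) -` Q)"
      by (rule open_vimage[OF assms(1)]) (intro continuous_intros)
    then have "\<forall>\<^sub>F h in at 0. q + h \<in> Q"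
      using assms(2) eventually_at_in_open'[of "(\<lambda>h. q + h) -` Q" 0] by simp
    moreover have "\<forall>\<^sub>F h in at (0::'a). h \<noteq> 0" by (simp add: eventually_at_filter)
    ultimately show "\<forall>\<^sub>F h in at 0. norm (norm (R (q + h) - R q - (- (R q o\<^sub>L (A' h o\<^sub>L R q)))) / norm h) \<le> ?g h"
    proof eventually_elim
      case (elim h)
      let ?D = "A (q + h) - A q - A' h"
      let ?Y = "R (q + h) o\<^sub>L ((A (q + h) - A q) o\<^sub>L R q)" and ?Z = "A' h o\<^sub>L R q"
      have X: "R (q + h) - R q = - ?Y"
        by (rule blinfun_inverse_diff[OF l r]) (use elim assms(2) in auto)
      have Y: "R (q + h) o\<^sub>L (?D o\<^sub>L R q) = ?Y - (R (q + h) o\<^sub>L ?Z)"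
        by (simp add: bounded_bilinear.diff_left[OF comp] bounded_bilinear.diff_right[OF comp])
      have Z: "(R (q + h) - R q) o\<^sub>L ?Z = (R (q + h) o\<^sub>L ?Z) - (R q o\<^sub>L ?Z)"
        by (rule bounded_bilinear.diff_left[OF comp])
      have e: "R (q + h) - R q - (- (R q o\<^sub>L ?Z))
          = - (R (q + h) o\<^sub>L (?D o\<^sub>L R q)) - ((R (q + h) - R q) o\<^sub>L ?Z)"
        unfolding Y Z unfolding X by simp
      have "norm (R (q + h) o\<^sub>L (?D o\<^sub>L R q)) \<le> norm (R (q + h)) * (norm ?D * norm (R q))"
        by (meson norm_blinfun_compose mult_left_mono norm_ge_zero order_trans)
      moreover have "norm ((R (q + h) - R q) o\<^sub>L (A' h o\<^sub>L R q))
          \<le> norm (R (q + h) - R q) * (norm (A' h) * norm (R q))"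
        by (meson norm_blinfun_compose mult_left_mono norm_ge_zero order_trans)
      moreover have "norm (R (q + h) - R q) * (norm (A' h) * norm (R q))
          \<le> norm (R (q + h) - R q) * ((norm h * K) * norm (R q))"
        by (intro mult_left_mono mult_right_mono K) auto
      ultimately have "norm (R (q + h) - R q - (- (R q o\<^sub>L (A' h o\<^sub>L R q))))
          \<le> norm (R (q + h)) * (norm ?D * norm (R q)) + norm (R (q + h) - R q) * ((norm h * K) * norm (R q))"
        unfolding e by (smt (verit) norm_triangle_ineq4 norm_minus_cancel)
      then show ?case using elim(2)
        by (simp add: field_simps)
    qed
  qed
  moreover have "bounded_linear (\<lambda>h. - (R q o\<^sub>L (A' h o\<^sub>L R q)))"
    by (intro bounded_linear_minus bounded_linear_compose[OF cl(2)] bounded_linear_compose[OF cl(1) A'])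
  ultimately show ?thesis by (simp add: has_derivative_at)
qed

text \<open>The derivative of \<open>R\<close> is a product of \<open>R\<close>, the derivative of
  \<open>A\<close> and \<open>R\<close>, so order \<open>k\<close> of \<open>R\<close> gives order
  \<open>Suc k\<close>.\<close>

lemma Ck_on_blinfun_inverse:
  fixes A R :: "'a::real_normed_vector \<Rightarrow> 'b::real_normed_vector \<Rightarrow>\<^sub>L 'b"
  assumes "open Q" "Ck_on k Q A"
    and l: "\<And>q. q \<in> Q \<Longrightarrow> R q o\<^sub>L A q = id_blinfun"
    and r: "\<And>q. q \<in> Q \<Longrightarrow> A q o\<^sub>L R q = id_blinfun"
  shows "Ck_on k Q R"
  using assms(2)
proof (induction k)
  case 0
  have "isCont R q" if "q \<in> Q" for q
    unfolding isCont_def using 0 tendsto_blinfun_inverse[OF assms(1) that _ l r] by simp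
  then show ?case by (simp add: continuous_at_imp_continuous_on)
next
  case (Suc k)
  note comp = bounded_bilinear_blinfun_compose
  have R: "Ck_on k Q R" using Suc Ck_on_Suc_imp by blast
  show ?case
  proof (rule Ck_on_SucI[OF assms(1)])
    show "(R has_derivative (\<lambda>h. - (R q o\<^sub>L (frechet_derivative A (at q) h o\<^sub>L R q)))) (at q)"
      if "q \<in> Q" for q
      by (rule has_derivative_blinfun_inverse[OF assms(1) that Ck_on_imp_continuous_on[OF Suc.prems]
            Ck_on_has_derivative[OF Suc.prems that] l r])
    show "Ck_on k Q (\<lambda>q. - (R q o\<^sub>L (frechet_derivative A (at q) h o\<^sub>L R q)))" for h
      using Suc.prems by (intro Ck_on_uminus Ck_on_bounded_bilinear[OF _ comp] R assms(1)) auto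
  qed
qed

text \<open>The equation \<open>R = 1 + G R\<close> is a fixed point problem for a contraction of
  the Banach space of operators, and its solution is a right inverse of \<open>1 - G\<close>. It is
  a left inverse as well, because \<open>R (x - G x) - x\<close> is fixed by \<open>G\<close> and
  therefore 0.\<close>

lemma blinfun_neumann:
  fixes G :: "'b::banach \<Rightarrow>\<^sub>L 'b"
  assumes "norm G \<le> 1/2"
  obtains R where "R o\<^sub>L (id_blinfun - G) = id_blinfun" "(id_blinfun - G) o\<^sub>L R = id_blinfun"
proof -
  note comp = bounded_bilinear_blinfun_compose
  have "\<exists>!R. id_blinfun + (G o\<^sub>L R) = R"
  proof (rule banach_fix_type[of "1/2"])
    show "\<forall>x y. dist (id_blinfun + (G o\<^sub>L x)) (id_blinfun + (G o\<^sub>L y)) \<le> 1/2 * dist x y"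
    proof (intro allI)
      fix x y :: "'b \<Rightarrow>\<^sub>L 'b"
      have "dist (id_blinfun + (G o\<^sub>L x)) (id_blinfun + (G o\<^sub>L y)) = norm (G o\<^sub>L (x - y))"
        by (simp add: dist_norm bounded_bilinear.diff_right[OF comp])
      also have "\<dots> \<le> norm G * norm (x - y)" by (rule norm_blinfun_compose)
      also have "\<dots> \<le> 1/2 * dist x y" using mult_right_mono[OF assms norm_ge_zero] by (simp add: dist_norm)
      finally show "dist (id_blinfun + (G o\<^sub>L x)) (id_blinfun + (G o\<^sub>L y)) \<le> 1/2 * dist x y" .
    qed
  qed auto
  then obtain R where R: "id_blinfun + (G o\<^sub>L R) = R" by blast
  have R': "x + G (R x) = R x" for x
    using arg_cong[OF R, of "\<lambda>f. f x"] by (simp add: blinfun.bilinear_simps)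
  have inj: "v = 0" if "v = G v" for v
  proof (rule ccontr)
    assume "v \<noteq> 0"
    have "norm v \<le> norm G * norm v" by (subst that) (rule norm_blinfun)
    also have "\<dots> \<le> 1/2 * norm v" using mult_right_mono[OF assms norm_ge_zero] by simp
    finally show False using \<open>v \<noteq> 0\<close> by simp
  qed
  show ?thesis
  proof (rule that)
    show "(id_blinfun - G) o\<^sub>L R = id_blinfun"
      by (rule blinfun_eqI) (use R' in \<open>simp add: blinfun.bilinear_simps algebra_simps\<close>)
    show "R o\<^sub>L (id_blinfun - G) = id_blinfun"
    proof (rule blinfun_eqI)
      fix x
      have "R (x - G x) - x = 0"
      proof (rule inj)
        show "R (x - G x) - x = G (R (x - G x) - x)"
          using R'[of "x - G x"] by (simp add: blinfun.bilinear_simps algebra_simps)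
      qed
      then show "(R o\<^sub>L (id_blinfun - G)) x = id_blinfun x"
        by (simp add: blinfun.bilinear_simps)
    qed
  qed
qed

text \<open>The derivative as a point of the normed space of operators, where continuity in the
  operator norm can be stated. The sum over the basis reduces its smoothness to that of the partial
  derivatives.\<close>

definition blinfun_derivative ::
    "('a::euclidean_space \<Rightarrow> 'b::real_normed_vector) \<Rightarrow> 'a \<Rightarrow> 'a \<Rightarrow>\<^sub>L 'b" where
  "blinfun_derivative f x =
     (\<Sum>i\<in>Basis. blinfun_scaleR_left (frechet_derivative f (at x) i) o\<^sub>L blinfun_inner_left i)"

lemma blinfun_derivative_apply:
  assumes "f differentiable (at x)"
  shows "blinfun_derivative f x v = frechet_derivative f (at x) v"
  unfolding blinfun_derivative_def linear_euclidean_expand[OF linear_frechet_derivative[OF assms], of v]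
  by (simp add: blinfun.sum_left blinfun_inner_left.rep_eq)

lemma smooth_on_blinfun_derivative:
  assumes "open U" "smooth_on U f"
  shows "smooth_on U (blinfun_derivative f)"
  unfolding smooth_on_def blinfun_derivative_def
  by (intro allI Ck_on_sum assms(1)
      Ck_on_bounded_linear[OF _ bounded_bilinear.bounded_linear_left[OF bounded_bilinear_blinfun_compose]]
      Ck_on_bounded_linear[OF _ bounded_linear_blinfun_scaleR_left]
      smooth_onD[OF smooth_on_derivative[OF assms(2)]])

text \<open>\<open>inverse_function_theorem\<close> provides a differentiable \<open>g\<close> whose
  derivative at \<open>y\<close> is \<open>R (g y)\<close>, with \<open>R x\<close> the inverse of
  the derivative of \<open>f\<close> at \<open>x\<close>. Since \<open>R\<close> is smooth, each
  order of smoothness of \<open>g\<close> produces the next.\<close>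

theorem smooth_inverse_function:
  fixes f :: "'a::euclidean_space \<Rightarrow> 'a"
  assumes "open U" "x0 \<in> U" "smooth_on U f" "inj (frechet_derivative f (at x0))"
  obtains U' V g where "open U'" "U' \<subseteq> U" "x0 \<in> U'" "open V" "homeomorphism U' V f g" "smooth_on V g"
    "\<And>x. x \<in> U' \<Longrightarrow> bij (frechet_derivative f (at x))"
proof -
  let ?f' = "blinfun_derivative f"
  have diff: "f differentiable (at x)" if "x \<in> U" for x
    using smooth_on_has_derivative[OF assms(3) that] unfolding differentiable_def by blast
  have app: "blinfun_apply (?f' x) = frechet_derivative f (at x)" if "x \<in> U" for x
    using blinfun_derivative_apply[OF diff[OF that]] by blast
  have lin: "linear (frechet_derivative f (at x0))"
    by (rule linear_frechet_derivative[OF diff[OF assms(2)]])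
  then obtain h where h: "linear h" "h \<circ> frechet_derivative f (at x0) = id"
    using linear_injective_left_inverse[OF lin assms(4)] by blast
  have inv: "Blinfun h o\<^sub>L ?f' x0 = id_blinfun"
  proof (rule blinfun_eqI)
    fix v
    have "h (frechet_derivative f (at x0) v) = v" using fun_cong[OF h(2), of v] by simp
    then show "(Blinfun h o\<^sub>L ?f' x0) v = id_blinfun v"
      using h(1) app[OF assms(2)]
      by (simp add: bounded_linear_Blinfun_apply linear_conv_bounded_linear)
  qed
  have der: "(f has_derivative blinfun_apply (?f' x)) (at x)" if "x \<in> U" for x
    unfolding app[OF that] by (rule smooth_on_has_derivative[OF assms(3) that])
  obtain U' V g g' where o: "open U'" "U' \<subseteq> U" "x0 \<in> U'" "open V" and hom: "homeomorphism U' V f g"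
    and g: "\<And>y. y \<in> V \<Longrightarrow> (g has_derivative (g' y)) (at y)"
    and g': "\<And>y. y \<in> V \<Longrightarrow> g' y = inv (blinfun_apply (?f' (g y)))"
    and bij: "\<And>y. y \<in> V \<Longrightarrow> bij (blinfun_apply (?f' (g y)))"
    using inverse_function_theorem[OF assms(1) der
        smooth_on_imp_continuous_on[OF smooth_on_blinfun_derivative[OF assms(1,3)]] assms(2) inv]
    by metis
  have gU: "g y \<in> U'" if "y \<in> V" for y using hom that by (auto simp: homeomorphism_def)
  have bijU: "bij (blinfun_apply (?f' x))" if "x \<in> U'" for x
    using bij[of "f x"] hom that by (auto simp: homeomorphism_def)
  define R where "R = (\<lambda>x. Blinfun (inv (blinfun_apply (?f' x))))"
  have Rapp: "blinfun_apply (R x) = inv (blinfun_apply (?f' x))" if "x \<in> U'" for x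
  proof -
    have "bounded_linear (inv (blinfun_apply (?f' x)))"
      using bijU[OF that] by (intro inj_linear_imp_inv_bounded_linear blinfun.bounded_linear_right bij_is_inj)
    then show ?thesis by (simp add: R_def bounded_linear_Blinfun_apply)
  qed
  have smR: "Ck_on k U' R" for k
  proof (rule Ck_on_blinfun_inverse[OF o(1)])
    show "Ck_on k U' ?f'"
      using smooth_onD[OF smooth_on_blinfun_derivative[OF assms(1,3)]] Ck_on_subset o(2) by blast
    show "R q o\<^sub>L ?f' q = id_blinfun" if "q \<in> U'" for q
      by (rule blinfun_eqI) (use Rapp[OF that] bijU[OF that] in \<open>simp add: bij_is_inj\<close>)
    show "?f' q o\<^sub>L R q = id_blinfun" if "q \<in> U'" for q
      by (rule blinfun_eqI) (use Rapp[OF that] bijU[OF that] in \<open>simp add: bij_is_surj surj_f_inv_f\<close>)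
  qed
  have "Ck_on k V g" for k
  proof (induction k)
    case 0
    then show ?case using hom by (simp add: homeomorphism_def)
  next
    case (Suc k)
    show ?case
    proof (rule Ck_on_SucI[OF o(4)])
      show "(g has_derivative (\<lambda>w. blinfun_apply (R (g y)) w)) (at y)" if "y \<in> V" for y
        using g[OF that] g'[OF that] Rapp[OF gU[OF that]] by simp
      show "Ck_on k V (\<lambda>y. blinfun_apply (R (g y)) w)" for w
        by (intro Ck_on_bounded_linear[OF o(4) blinfun.bounded_linear_left]
            Ck_on_compose[OF o(4,1) Suc smR]) (use gU in auto)
    qed
  qed
  then have "smooth_on V g" by (simp add: smooth_on_def)
  then show ?thesis using that o hom bijU app by (metis subsetD)
qed

section \<open>Smooth dependence of flows on initial values\<close>

definition unit_clamp :: "real \<Rightarrow> real" where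
  "unit_clamp t = max 0 (min 1 t)"

lemma unit_clamp_bounds [simp]: "0 \<le> unit_clamp t" "unit_clamp t \<le> 1"
  by (auto simp: unit_clamp_def)

lemma unit_clamp_id: "t \<in> {0..1} \<Longrightarrow> unit_clamp t = t"
  by (auto simp: unit_clamp_def)

lemma continuous_on_unit_clamp: "continuous_on S unit_clamp"
  unfolding unit_clamp_def by (intro continuous_intros)

text \<open>Curves are parametrised over the whole line, constant outside the unit interval, because the
  library provides the Banach space of bounded continuous functions only on a whole type.\<close>

definition curve_integral :: "(real \<Rightarrow>\<^sub>C 'e::euclidean_space) \<Rightarrow>\<^sub>L (real \<Rightarrow>\<^sub>C 'e)" where
  "curve_integral = Blinfun (\<lambda>u. Bcontfun (\<lambda>t. integral {0..unit_clamp t} (apply_bcontfun u)))"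

lemma curve_integrable: "apply_bcontfun u integrable_on {a..b::real}"
  for u :: "real \<Rightarrow>\<^sub>C 'e::euclidean_space"
  by (intro integrable_continuous_interval continuous_on_apply_bcontfun)

lemma norm_integral_curve_le:
  fixes u :: "real \<Rightarrow>\<^sub>C 'e::euclidean_space"
  shows "norm (integral {0..unit_clamp t} (apply_bcontfun u)) \<le> norm u"
proof -
  have "norm (integral {0..unit_clamp t} (apply_bcontfun u)) \<le> norm u * (unit_clamp t - 0)"
    by (rule integral_bound) (auto intro: norm_bounded)
  also have "\<dots> \<le> norm u * 1" by (intro mult_left_mono) auto
  finally show ?thesis by simp
qed

lemma integral_curve_bcontfun:
  fixes u :: "real \<Rightarrow>\<^sub>C 'e::euclidean_space"
  shows "(\<lambda>t. integral {0..unit_clamp t} (apply_bcontfun u)) \<in> bcontfun"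
proof (rule bcontfun_normI)
  have "continuous_on {0..1} (\<lambda>s. integral {0..s} (apply_bcontfun u))"
    by (rule indefinite_integral_continuous_1[OF curve_integrable])
  then show "continuous_on UNIV (\<lambda>t. integral {0..unit_clamp t} (apply_bcontfun u))"
    by (rule continuous_on_compose2[OF _ continuous_on_unit_clamp]) auto
qed (rule norm_integral_curve_le)

lemma curve_integral_works:
  "blinfun_apply curve_integral u = Bcontfun (\<lambda>t. integral {0..unit_clamp t} (apply_bcontfun u))"
proof -
  define I :: "(real \<Rightarrow>\<^sub>C 'a) \<Rightarrow> (real \<Rightarrow>\<^sub>C 'a)" where
    "I = (\<lambda>u. Bcontfun (\<lambda>t. integral {0..unit_clamp t} (apply_bcontfun u)))"
  have I: "apply_bcontfun (I u) t = integral {0..unit_clamp t} (apply_bcontfun u)" for u t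
    by (simp add: I_def Bcontfun_inverse[OF integral_curve_bcontfun])
  have "bounded_linear I"
  proof (rule bounded_linear_intro[where K = 1])
    show "I (u + v) = I u + I v" for u v
      by (rule bcontfun_eqI) (simp add: I integral_add[OF curve_integrable curve_integrable])
    show "I (c *\<^sub>R u) = c *\<^sub>R I u" for c u
      by (rule bcontfun_eqI) (simp add: I)
    show "norm (I u) \<le> norm u * 1" for u
      by (rule norm_bound) (simp add: I norm_integral_curve_le)
  qed
  then show ?thesis
    by (simp add: curve_integral_def I_def[symmetric] bounded_linear_Blinfun_apply) (simp add: I_def)
qed

lemma curve_integral_apply:
  "apply_bcontfun (blinfun_apply curve_integral u) t = integral {0..unit_clamp t} (apply_bcontfun u)"
  by (simp add: curve_integral_works Bcontfun_inverse[OF integral_curve_bcontfun])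

lemma norm_curve_integral_le: "norm (blinfun_apply curve_integral u) \<le> norm u"
  by (rule norm_bound) (simp add: curve_integral_apply norm_integral_curve_le)

lemma bounded_linear_const_bcontfun: "bounded_linear (const_bcontfun :: 'e::real_normed_vector \<Rightarrow> real \<Rightarrow>\<^sub>C 'e)"
proof (rule bounded_linear_intro[where K = 1])
  show "norm (const_bcontfun x :: real \<Rightarrow>\<^sub>C 'e) \<le> norm x * 1" for x
    by (rule norm_bound) (simp add: const_bcontfun.rep_eq)
qed (rule bcontfun_eqI, simp add: const_bcontfun.rep_eq)+

lemma bounded_linear_apply_bcontfun: "bounded_linear (\<lambda>u. apply_bcontfun u t)"
  for t :: "'a::topological_space"
  by (rule bounded_linear_intro[where K = 1]) (auto simp: norm_bounded)

text \<open>The derivative of a superposition operator sends \<open>w\<close> to the curve of values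
  of \<open>Db (u t)\<close> at \<open>w t\<close>. It is the sum over \<open>i\<close> of these
  products, with \<open>f\<close> the partial derivative of \<open>b\<close> in direction
  \<open>i\<close> along the curve; each summand is bilinear in \<open>f\<close> and
  \<open>w\<close>.\<close>

definition coord_mult :: "'e::euclidean_space \<Rightarrow> (real \<Rightarrow>\<^sub>C 'f::real_normed_vector) \<Rightarrow>
    (real \<Rightarrow>\<^sub>C 'e) \<Rightarrow> (real \<Rightarrow>\<^sub>C 'f)" where
  "coord_mult i f w = Bcontfun (\<lambda>t. (apply_bcontfun w t \<bullet> i) *\<^sub>R apply_bcontfun f t)"

lemma coord_mult_bound:
  "norm ((apply_bcontfun w t \<bullet> i) *\<^sub>R apply_bcontfun f t) \<le> norm f * norm w * norm i"
proof -
  have "norm ((apply_bcontfun w t \<bullet> i) *\<^sub>R apply_bcontfun f t) = \<bar>apply_bcontfun w t \<bullet> i\<bar> * norm (apply_bcontfun f t)"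
    by simp
  also have "\<dots> \<le> (norm w * norm i) * norm f"
    by (intro mult_mono norm_bounded order_trans[OF Cauchy_Schwarz_ineq2] mult_right_mono) auto
  finally show ?thesis by (simp add: ac_simps)
qed

lemma coord_mult_apply:
  "apply_bcontfun (coord_mult i f w) t = (apply_bcontfun w t \<bullet> i) *\<^sub>R apply_bcontfun f t"
proof -
  have "(\<lambda>t. (apply_bcontfun w t \<bullet> i) *\<^sub>R apply_bcontfun f t) \<in> bcontfun"
    by (rule bcontfun_normI[OF _ coord_mult_bound]) (intro continuous_intros continuous_on_apply_bcontfun)
  then show ?thesis by (simp add: coord_mult_def Bcontfun_inverse)
qed

lemma bounded_bilinear_coord_mult: "bounded_bilinear (coord_mult i)"
proof
  show "\<exists>K. \<forall>a b. norm (coord_mult i a b) \<le> norm a * norm b * K"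
    by (rule exI[of _ "norm i"]) (auto intro!: norm_bound simp: coord_mult_apply coord_mult_bound[simplified])
qed (auto intro!: bcontfun_eqI simp: coord_mult_apply algebra_simps inner_simps)

text \<open>The superposition (Nemytskii) operator of \<open>b\<close>. \<open>Bcontfun\<close> is
  meaningful here only if the composite is bounded and continuous, which
  \<open>comp_curve_apply\<close> gets from a compact range of \<open>u\<close>.\<close>

definition comp_curve :: "('e::euclidean_space \<Rightarrow> 'f::real_normed_vector) \<Rightarrow> (real \<Rightarrow>\<^sub>C 'e) \<Rightarrow> (real \<Rightarrow>\<^sub>C 'f)" where
  "comp_curve b u = Bcontfun (\<lambda>t. b (apply_bcontfun u t))"

lemma comp_curve_apply:
  assumes "compact B" "continuous_on B b" "u \<in> PiC UNIV (\<lambda>_. B)"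
  shows "apply_bcontfun (comp_curve b u) t = b (apply_bcontfun u t)"
proof -
  have u: "apply_bcontfun u t \<in> B" for t using assms(3) by (auto simp: mem_PiC_iff)
  have "bounded (b ` B)" using assms compact_continuous_image compact_imp_bounded by blast
  then obtain K where "\<And>x. x \<in> B \<Longrightarrow> norm (b x) \<le> K" by (auto simp: bounded_iff)
  then have "(\<lambda>t. b (apply_bcontfun u t)) \<in> bcontfun"
    using u by (intro bcontfun_normI continuous_on_compose2[OF assms(2)]) auto
  then show ?thesis by (simp add: comp_curve_def Bcontfun_inverse)
qed

text \<open>Uniform continuity of the derivative on the compact set \<open>B\<close> gives one
  \<open>d\<close> for all points; convexity keeps the segment from \<open>x\<close> to
  \<open>y\<close> inside \<open>B\<close>, where the mean value inequality applies. This uniformity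
  turns differentiability of \<open>b\<close> into differentiability for the sup norm of
  curves.\<close>

lemma uniformly_differentiable:
  fixes b :: "'e::euclidean_space \<Rightarrow> 'f::real_normed_vector"
  assumes "open U" "smooth_on U b" "compact B" "convex B" "B \<subseteq> U" "e > 0"
  obtains d where "d > 0" "\<And>x y. x \<in> B \<Longrightarrow> y \<in> B \<Longrightarrow> dist y x < d \<Longrightarrow>
    norm (b y - b x - frechet_derivative b (at x) (y - x)) \<le> e * norm (y - x)"
proof -
  let ?D = "blinfun_derivative b"
  have der: "(b has_derivative blinfun_apply (?D x)) (at x)" if "x \<in> U" for x
  proof -
    have "(b has_derivative frechet_derivative b (at x)) (at x)"
      by (rule smooth_on_has_derivative[OF assms(2) that])
    moreover from this have "blinfun_apply (?D x) = frechet_derivative b (at x)"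
      using blinfun_derivative_apply unfolding differentiable_def by blast
    ultimately show ?thesis by simp
  qed
  have "uniformly_continuous_on B ?D"
    using smooth_on_imp_continuous_on[OF smooth_on_blinfun_derivative[OF assms(1,2)]]
    by (intro compact_uniformly_continuous assms(3)) (rule continuous_on_subset[OF _ assms(5)])
  then obtain d where d: "d > 0" "\<And>x y. x \<in> B \<Longrightarrow> y \<in> B \<Longrightarrow> dist y x < d \<Longrightarrow> dist (?D y) (?D x) < e"
    unfolding uniformly_continuous_on_def using assms(6) by metis
  show ?thesis
  proof (rule that[OF d(1)])
    fix x y assume xy: "x \<in> B" "y \<in> B" "dist y x < d"
    have "norm (b y - b x - blinfun_apply (?D x) (y - x)) \<le> norm (y - x) * e"
    proof (rule differentiable_bound_linearization[of x y "closed_segment x y"])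
      show "x + t *\<^sub>R (y - x) \<in> closed_segment x y" if "t \<in> {0..1}" for t
        using that by (auto simp: closed_segment_def algebra_simps intro!: exI[of _ t])
      show "(b has_derivative blinfun_apply (?D z)) (at z within closed_segment x y)"
        if "z \<in> closed_segment x y" for z
        using der has_derivative_at_withinI that closed_segment_subset[OF xy(1,2) assms(4)] assms(5) by blast
      show "onorm (blinfun_apply (?D z) - blinfun_apply (?D x)) \<le> e" if "z \<in> closed_segment x y" for z
      proof -
        have "dist z x < d"
          using segment_bound[OF that] xy(3) by (simp add: dist_norm norm_minus_commute)
        moreover have "z \<in> B" using that closed_segment_subset[OF xy(1,2) assms(4)] by blast
        ultimately have "norm (?D z - ?D x) < e" using d(2) xy(1) by (simp add: dist_norm)
        moreover have "onorm (blinfun_apply (?D z) - blinfun_apply (?D x)) = norm (?D z - ?D x)"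
          by (simp only: norm_blinfun.rep_eq minus_blinfun.rep_eq fun_diff_def)
        ultimately show ?thesis by simp
      qed
    qed simp
    moreover have "blinfun_apply (?D x) (y - x) = frechet_derivative b (at x) (y - x)"
      using der[of x] xy(1) assms(5) by (intro blinfun_derivative_apply) (auto simp: differentiable_def)
    ultimately show "norm (b y - b x - frechet_derivative b (at x) (y - x)) \<le> e * norm (y - x)"
      by (simp add: mult.commute)
  qed
qed

definition comp_curve_deriv :: "('e::euclidean_space \<Rightarrow> 'f::real_normed_vector) \<Rightarrow> (real \<Rightarrow>\<^sub>C 'e) \<Rightarrow>
    (real \<Rightarrow>\<^sub>C 'e) \<Rightarrow>\<^sub>L (real \<Rightarrow>\<^sub>C 'f)" where
  "comp_curve_deriv b u =
     (\<Sum>i\<in>Basis. Blinfun (coord_mult i (comp_curve (\<lambda>x. frechet_derivative b (at x) i) u)))"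

lemma coord_mult_Blinfun: "blinfun_apply (Blinfun (coord_mult i f)) = coord_mult i f"
  by (rule bounded_linear_Blinfun_apply[OF bounded_bilinear.bounded_linear_right[OF bounded_bilinear_coord_mult]])

lemma comp_curve_deriv_eq:
  "blinfun_apply (comp_curve_deriv b u) w =
    (\<Sum>i\<in>Basis. coord_mult i (comp_curve (\<lambda>x. frechet_derivative b (at x) i) u) w)"
  by (simp add: comp_curve_deriv_def blinfun.sum_left coord_mult_Blinfun)

lemma apply_bcontfun_sum: "apply_bcontfun (\<Sum>i\<in>I. f i) t = (\<Sum>i\<in>I. apply_bcontfun (f i) t)"
  by (induction I rule: infinite_finite_induct) auto

text \<open>Curves are confined to a compact convex set inside the domain of the field. The set
  \<open>W\<close> of these curves is closed when \<open>B\<close> is, as the fixed point theorem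
  requires, and derivatives of superposition operators are taken within \<open>W\<close>.\<close>

locale curve_range =
  fixes U B :: "'e::euclidean_space set"
  assumes U: "open U" and B: "compact B" "convex B" "B \<subseteq> U"
begin

abbreviation "W \<equiv> PiC UNIV (\<lambda>_::real. B)"

lemma smooth_cont: "smooth_on U b \<Longrightarrow> continuous_on B b"
  using smooth_on_imp_continuous_on continuous_on_subset B(3) by blast

lemma comp_curve_deriv_apply:
  assumes "smooth_on U b" "u \<in> W"
  shows "apply_bcontfun (blinfun_apply (comp_curve_deriv b u) w) t
    = frechet_derivative b (at (apply_bcontfun u t)) (apply_bcontfun w t)"
proof -
  have "apply_bcontfun u t \<in> U" using assms(2) B(3) by (auto simp: mem_PiC_iff)
  then have "linear (frechet_derivative b (at (apply_bcontfun u t)))"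
    using smooth_on_has_derivative[OF assms(1)] has_derivative_linear by blast
  moreover have "continuous_on B (\<lambda>x. frechet_derivative b (at x) i)" for i
    by (rule smooth_cont[OF smooth_on_derivative[OF assms(1)]])
  ultimately show ?thesis
    by (simp add: comp_curve_deriv_eq apply_bcontfun_sum coord_mult_apply comp_curve_apply[OF B(1) _ assms(2)]
        linear_euclidean_expand[of _ "apply_bcontfun w t"])
qed

text \<open>The estimate of \<open>uniformly_differentiable\<close> holds with the same
  \<open>d\<close> at every time, so it passes to the supremum over \<open>t\<close>.\<close>

lemma comp_curve_has_derivative:
  assumes "smooth_on U b" "u \<in> W"
  shows "(comp_curve b has_derivative blinfun_apply (comp_curve_deriv b u)) (at u within W)"
  unfolding has_derivative_within_alt
proof (intro conjI allI impI)
  show "bounded_linear (blinfun_apply (comp_curve_deriv b u))" by (rule blinfun.bounded_linear_right)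
  fix e :: real assume e: "e > 0"
  obtain d where d: "d > 0" "\<And>x y. x \<in> B \<Longrightarrow> y \<in> B \<Longrightarrow> dist y x < d \<Longrightarrow>
      norm (b y - b x - frechet_derivative b (at x) (y - x)) \<le> e * norm (y - x)"
    using uniformly_differentiable[OF U assms(1) B e] by blast
  show "\<exists>d>0. \<forall>v\<in>W. norm (v - u) < d \<longrightarrow>
      norm (comp_curve b v - comp_curve b u - blinfun_apply (comp_curve_deriv b u) (v - u)) \<le> e * norm (v - u)"
  proof (intro exI[of _ d] conjI d(1) ballI impI norm_bound)
    fix v t assume v: "v \<in> W" "norm (v - u) < d"
    have uv: "apply_bcontfun u t \<in> B" "apply_bcontfun v t \<in> B" using assms(2) v(1) by (auto simp: mem_PiC_iff)
    have n: "norm (apply_bcontfun v t - apply_bcontfun u t) \<le> norm (v - u)"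
      using norm_bounded[of "v - u" t] by simp
    have "norm (apply_bcontfun (comp_curve b v - comp_curve b u - blinfun_apply (comp_curve_deriv b u) (v - u)) t)
        = norm (b (apply_bcontfun v t) - b (apply_bcontfun u t)
          - frechet_derivative b (at (apply_bcontfun u t)) (apply_bcontfun v t - apply_bcontfun u t))"
      by (simp add: comp_curve_deriv_apply[OF assms] comp_curve_apply[OF B(1) smooth_cont[OF assms(1)]] assms(2) v(1))
    also have "\<dots> \<le> e * norm (apply_bcontfun v t - apply_bcontfun u t)"
      by (rule d(2)) (use uv v(2) n in \<open>auto simp: dist_norm\<close>)
    also have "\<dots> \<le> e * norm (v - u)" using n e by simp
    finally show "norm (apply_bcontfun (comp_curve b v - comp_curve b u
        - blinfun_apply (comp_curve_deriv b u) (v - u)) t) \<le> e * norm (v - u)" .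
  qed
qed

text \<open>The induction ranges over all \<open>b\<close>, since the derivative is a sum of
  products of superposition operators of the partial derivatives of \<open>b\<close> with
  coordinates of the derivative of \<open>u\<close>.\<close>

lemma Ck_on_comp_curve:
  fixes b :: "'e \<Rightarrow> 'f::real_normed_vector"
  assumes "open Q" "Ck_on k Q u" "u ` Q \<subseteq> W" "smooth_on U b"
  shows "Ck_on k Q (\<lambda>q. comp_curve b (u q))"
  using assms(2,4)
proof (induction k arbitrary: b)
  case 0
  have "continuous_on W (comp_curve b)"
    using comp_curve_has_derivative[OF 0(2)] has_derivative_continuous
    unfolding continuous_on_eq_continuous_within by blast
  then show ?case using 0(1) assms(3) continuous_on_compose2 by auto
next
  case (Suc k)
  let ?u' = "\<lambda>q. frechet_derivative u (at q)"
  show ?case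
  proof (rule Ck_on_SucI[OF assms(1)])
    fix q assume q: "q \<in> Q"
    have "(u has_derivative ?u' q) (at q within Q)"
      by (rule has_derivative_at_withinI[OF Ck_on_has_derivative[OF Suc.prems(1) q]])
    moreover have "(comp_curve b has_derivative blinfun_apply (comp_curve_deriv b (u q))) (at (u q) within u ` Q)"
      using comp_curve_has_derivative[OF Suc.prems(2)] has_derivative_subset assms(3) q by blast
    ultimately have "((\<lambda>q. comp_curve b (u q)) has_derivative
        (\<lambda>h. blinfun_apply (comp_curve_deriv b (u q)) (?u' q h))) (at q within Q)"
      by (rule has_derivative_in_compose)
    then show "((\<lambda>q. comp_curve b (u q)) has_derivative
        (\<lambda>h. blinfun_apply (comp_curve_deriv b (u q)) (?u' q h))) (at q)"
      by (simp add: at_within_open[OF q assms(1)])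
  next
    show "Ck_on k Q (\<lambda>q. blinfun_apply (comp_curve_deriv b (u q)) (?u' q h))" for h
      unfolding comp_curve_deriv_eq
      using Suc.prems(1) Ck_on_Suc_imp[OF Suc.prems(1)] smooth_on_derivative[OF Suc.prems(2)]
      by (intro Ck_on_sum Ck_on_bounded_bilinear[OF _ bounded_bilinear_coord_mult] Suc.IH assms(1)) auto
  qed
qed

text \<open>Smoothness as an operator-valued map and not only on each fixed curve: the inverse of
  \<open>1 - lin\<close> will be differentiated in the space of operators.\<close>

lemma Ck_on_comp_curve_deriv:
  fixes b :: "'e \<Rightarrow> 'f::real_normed_vector"
  assumes "open Q" "Ck_on k Q u" "u ` Q \<subseteq> W" "smooth_on U b"
  shows "Ck_on k Q (\<lambda>q. comp_curve_deriv b (u q))"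
proof -
  have bl: "bounded_linear (\<lambda>f :: real \<Rightarrow>\<^sub>C 'f. Blinfun (coord_mult i f))" for i :: 'e
  proof -
    have "Blinfun (coord_mult i f) = bounded_bilinear.prod_right (coord_mult i) f" for f :: "real \<Rightarrow>\<^sub>C 'f"
      by (rule blinfun_eqI)
        (simp add: coord_mult_Blinfun bounded_bilinear.prod_right.rep_eq[OF bounded_bilinear_coord_mult])
    then have "(\<lambda>f :: real \<Rightarrow>\<^sub>C 'f. Blinfun (coord_mult i f)) = bounded_bilinear.prod_right (coord_mult i)"
      by blast
    then show ?thesis
      by (metis bounded_bilinear.bounded_linear_prod_right[OF bounded_bilinear_coord_mult])
  qed
  show ?thesis unfolding comp_curve_deriv_def
  proof (intro Ck_on_sum assms(1))
    show "Ck_on k Q (\<lambda>q. Blinfun (coord_mult i (comp_curve (\<lambda>x. frechet_derivative b (at x) i) (u q))))" for i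
      by (rule Ck_on_bounded_linear[OF assms(1) bl
            Ck_on_comp_curve[OF assms(1-3) smooth_on_derivative[OF assms(4)]]])
  qed
qed

end

instance bcontfun :: (metric_space, banach) banach ..

text \<open>Short-time Picard iteration. The bound \<open>\<delta> * K \<le> 1/2\<close> makes the
  iteration a contraction, and \<open>\<delta> * A \<le> r / 2\<close> keeps curves that start in
  the ball of radius \<open>r / 2\<close> within the ball of radius \<open>r\<close>.\<close>

locale picard = curve_range U "cball x0 r" for U :: "'e::euclidean_space set" and x0 r +
  fixes a :: "'e \<Rightarrow> 'e" and \<delta> K A :: real
  assumes r: "r > 0" and a: "smooth_on U a" and \<delta>: "\<delta> > 0"
    and K: "K \<ge> 0" "\<And>x v. x \<in> cball x0 r \<Longrightarrow> norm (frechet_derivative a (at x) v) \<le> K * norm v" "\<delta> * K \<le> 1/2"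
    and A: "\<And>x. x \<in> cball x0 r \<Longrightarrow> norm (a x) \<le> A" "\<delta> * A \<le> r / 2"
begin

definition "Q = {-\<delta><..<\<delta>} \<times> ball x0 (r / 2)"

lemma open_Q: "open Q"
  unfolding Q_def by (intro open_Times) auto

lemma A_nonneg: "A \<ge> 0"
  using order_trans[OF norm_ge_zero A(1)[of x0]] r by simp

lemma curve_in_ball: "u \<in> W \<Longrightarrow> apply_bcontfun u t \<in> cball x0 r"
  by (auto simp: mem_PiC_iff)

lemma comp_apply: "u \<in> W \<Longrightarrow> apply_bcontfun (comp_curve a u) t = a (apply_bcontfun u t)"
  by (rule comp_curve_apply[OF B(1) smooth_cont[OF a]])

lemma norm_comp_le: "u \<in> W \<Longrightarrow> norm (comp_curve a u) \<le> A"
  by (rule norm_bound) (use A(1) curve_in_ball in \<open>auto simp: comp_apply\<close>)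

lemma field_Lipschitz:
  assumes "x \<in> cball x0 r" "y \<in> cball x0 r"
  shows "norm (a x - a y) \<le> K * norm (x - y)"
proof (rule differentiable_bound[OF B(2) _ _ assms])
  fix z assume z: "z \<in> cball x0 r"
  show "(a has_derivative frechet_derivative a (at z)) (at z within cball x0 r)"
    using smooth_on_has_derivative[OF a] z B(3) has_derivative_at_withinI by blast
  show "onorm (frechet_derivative a (at z)) \<le> K"
    by (rule onorm_bound[OF K(1) K(2)[OF z]])
qed

lemma comp_Lipschitz:
  assumes "u \<in> W" "v \<in> W"
  shows "norm (comp_curve a u - comp_curve a v) \<le> K * norm (u - v)"
proof (rule norm_bound)
  fix t
  have "norm (apply_bcontfun (comp_curve a u - comp_curve a v) t)
      \<le> K * norm (apply_bcontfun u t - apply_bcontfun v t)"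
    using field_Lipschitz curve_in_ball assms by (auto simp: comp_apply)
  also have "\<dots> \<le> K * norm (u - v)"
    using norm_bounded[of "u - v" t] K(1) by (auto intro: mult_left_mono)
  finally show "norm (apply_bcontfun (comp_curve a u - comp_curve a v) t) \<le> K * norm (u - v)" .
qed

text \<open>A parameter \<open>q = (s, y)\<close> encodes the problem \<open>u' = s a(u)\<close>,
  \<open>u(0) = y\<close> on the unit interval. Rescaling time treats time and initial value alike,
  and makes \<open>step\<close> linear in \<open>q\<close>.\<close>

definition step :: "real \<times> 'e \<Rightarrow> (real \<Rightarrow>\<^sub>C 'e) \<Rightarrow> (real \<Rightarrow>\<^sub>C 'e)" where
  "step q u = const_bcontfun (snd q) + fst q *\<^sub>R curve_integral (comp_curve a u)"

lemma step_in_W: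
  assumes "q \<in> Q" "u \<in> W"
  shows "step q u \<in> W"
proof -
  have "apply_bcontfun (step q u) t \<in> cball x0 r" for t
  proof -
    let ?J = "apply_bcontfun (blinfun_apply curve_integral (comp_curve a u)) t"
    have J: "norm ?J \<le> A"
      by (rule order_trans[OF norm_bounded order_trans[OF norm_curve_integral_le norm_comp_le[OF assms(2)]]])
    have q: "\<bar>fst q\<bar> \<le> \<delta>" "norm (snd q - x0) \<le> r / 2"
      using assms(1) by (auto simp: Q_def dist_norm norm_minus_commute)
    have "norm (apply_bcontfun (step q u) t - x0) = norm ((snd q - x0) + fst q *\<^sub>R ?J)"
      by (simp add: step_def const_bcontfun.rep_eq algebra_simps)
    also have "\<dots> \<le> norm (snd q - x0) + \<bar>fst q\<bar> * norm ?J"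
      by (metis norm_triangle_ineq norm_scaleR)
    also have "\<dots> \<le> r / 2 + \<delta> * A"
      using q J \<delta> by (intro add_mono mult_mono) auto
    also have "\<dots> \<le> r" using A(2) by simp
    finally show ?thesis by (simp add: dist_norm norm_minus_commute)
  qed
  then show ?thesis by (auto simp: mem_PiC_iff)
qed

lemma const_bcontfun_diff: "const_bcontfun (x - y) = const_bcontfun x - const_bcontfun y"
  by (rule bcontfun_eqI) (simp add: const_bcontfun.rep_eq)

lemma scaled_integral_le:
  assumes "q \<in> Q" "norm v \<le> K * c" "c \<ge> 0"
  shows "norm (fst q *\<^sub>R blinfun_apply curve_integral v) \<le> 1/2 * c"
proof -
  have "norm (fst q *\<^sub>R blinfun_apply curve_integral v) \<le> \<delta> * (K * c)"
    using assms norm_curve_integral_le[of v] \<delta> by (auto simp: Q_def intro!: mult_mono)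
  also have "\<dots> \<le> 1/2 * c" using K(3) assms(3) mult_right_mono[of "\<delta> * K" "1/2" c] by simp
  finally show ?thesis .
qed

lemma step_contraction:
  assumes "q \<in> Q" "u \<in> W" "v \<in> W"
  shows "norm (step q u - step q v) \<le> 1/2 * norm (u - v)"
proof -
  have "step q u - step q v = fst q *\<^sub>R curve_integral (comp_curve a u - comp_curve a v)"
    by (simp add: step_def blinfun.bilinear_simps scaleR_diff_right)
  then show ?thesis using scaled_integral_le[OF assms(1) comp_Lipschitz[OF assms(2,3)]] by simp
qed

lemma ex1_fixed_point: "q \<in> Q \<Longrightarrow> \<exists>!u. u \<in> W \<and> step q u = u"
proof -
  assume q: "q \<in> Q"
  have "\<exists>!u\<in>W. step q u = u"
  proof (rule Banach_fix[of _ "1/2"])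
    show "complete W"
      unfolding complete_eq_closed by (rule closed_PiC) simp
    have "const_bcontfun x0 \<in> W" using r by (auto simp: mem_PiC_iff const_bcontfun.rep_eq)
    then show "W \<noteq> {}" by blast
    show "step q ` W \<subseteq> W" by (rule image_subsetI[OF step_in_W[OF q]])
    show "dist (step q u) (step q v) \<le> 1/2 * dist u v" if "u \<in> W" "v \<in> W" for u v
      using step_contraction[OF q that] by (simp add: dist_norm)
  qed simp_all
  then show ?thesis .
qed

definition "sol q = (THE u. u \<in> W \<and> step q u = u)"

lemma sol_in_W: "sol q \<in> W"
  and step_sol: "step q (sol q) = sol q" if "q \<in> Q"
proof -
  have "sol q \<in> W \<and> step q (sol q) = sol q"
    unfolding sol_def by (rule theI'[OF ex1_fixed_point[OF that]])
  then show "sol q \<in> W" "step q (sol q) = sol q" by simp_all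
qed

text \<open>The derivative of \<open>step\<close> in the parameter, at the solution. By linearity in
  the parameter it is also the exact increment.\<close>

definition "rhs q h = const_bcontfun (snd h) + fst h *\<^sub>R curve_integral (comp_curve a (sol q))"

lemma norm_rhs_le:
  assumes "q \<in> Q"
  shows "norm (rhs q h) \<le> (1 + A) * norm h"
proof -
  have "norm (const_bcontfun (snd h) :: real \<Rightarrow>\<^sub>C 'e) \<le> norm (snd h)"
    by (rule norm_bound) (simp add: const_bcontfun.rep_eq)
  also have "\<dots> \<le> norm h" by (metis norm_snd_le prod.collapse)
  finally have 1: "norm (const_bcontfun (snd h) :: real \<Rightarrow>\<^sub>C 'e) \<le> norm h" .
  have f: "\<bar>fst h\<bar> \<le> norm h" using norm_fst_le[of "fst h" "snd h"] by simp
  have "norm (blinfun_apply curve_integral (comp_curve a (sol q))) \<le> A"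
    by (rule order_trans[OF norm_curve_integral_le norm_comp_le[OF sol_in_W[OF assms]]])
  then have "norm (fst h *\<^sub>R blinfun_apply curve_integral (comp_curve a (sol q))) \<le> norm h * A"
    using f by (auto intro!: mult_mono)
  with 1 show ?thesis unfolding rhs_def by (auto intro!: order_trans[OF norm_triangle_ineq] simp: algebra_simps)
qed

text \<open>Changing the parameter at a fixed curve moves \<open>step\<close> by
  \<open>rhs q (p - q)\<close>; the contraction lets half of the change of the solution be absorbed
  on the left, whence the factor 2.\<close>

lemma sol_Lipschitz:
  assumes "p \<in> Q" "q \<in> Q"
  shows "norm (sol p - sol q) \<le> 2 * (1 + A) * norm (p - q)"
proof -
  have "step p (sol q) - step q (sol q) = rhs q (p - q)"
    by (simp add: step_def rhs_def const_bcontfun_diff scaleR_diff_left)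
  then have "sol p - sol q = (step p (sol p) - step p (sol q)) + rhs q (p - q)"
    using step_sol[OF assms(1)] step_sol[OF assms(2)] by (simp add: algebra_simps)
  then have "norm (sol p - sol q) \<le> 1/2 * norm (sol p - sol q) + (1 + A) * norm (p - q)"
    using norm_triangle_ineq step_contraction[OF assms(1) sol_in_W sol_in_W] norm_rhs_le[OF assms(2)] assms
    by (smt (verit))
  then show ?thesis by (simp add: algebra_simps)
qed

text \<open>The derivative of \<open>step q\<close> in the curve, at the solution;
  \<open>1 - lin q\<close> is the operator of the variational equation.\<close>

definition "lin q = fst q *\<^sub>R (curve_integral o\<^sub>L comp_curve_deriv a (sol q))"

lemma norm_comp_curve_deriv_le:
  assumes "u \<in> W"
  shows "norm (blinfun_apply (comp_curve_deriv a u) w) \<le> K * norm w"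
proof (rule norm_bound)
  fix t
  have "norm (apply_bcontfun (blinfun_apply (comp_curve_deriv a u) w) t) \<le> K * norm (apply_bcontfun w t)"
    using K(2)[OF curve_in_ball[OF assms]] by (simp add: comp_curve_deriv_apply[OF a assms])
  also have "\<dots> \<le> K * norm w" using norm_bounded K(1) by (auto intro: mult_left_mono)
  finally show "norm (apply_bcontfun (blinfun_apply (comp_curve_deriv a u) w) t) \<le> K * norm w" .
qed

lemma norm_lin_le:
  assumes "q \<in> Q"
  shows "norm (lin q) \<le> 1/2"
proof (rule norm_blinfun_bound)
  show "norm (blinfun_apply (lin q) w) \<le> 1/2 * norm w" for w
    using scaled_integral_le[OF assms norm_comp_curve_deriv_le[OF sol_in_W[OF assms]] norm_ge_zero, of w]
    by (simp add: lin_def blinfun.scaleR_left)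
qed simp

definition "res q = (SOME R. R o\<^sub>L (id_blinfun - lin q) = id_blinfun \<and> (id_blinfun - lin q) o\<^sub>L R = id_blinfun)"

lemma res_left: "q \<in> Q \<Longrightarrow> res q o\<^sub>L (id_blinfun - lin q) = id_blinfun"
  and res_right: "q \<in> Q \<Longrightarrow> (id_blinfun - lin q) o\<^sub>L res q = id_blinfun"
proof -
  assume q: "q \<in> Q"
  have "\<exists>R. R o\<^sub>L (id_blinfun - lin q) = id_blinfun \<and> (id_blinfun - lin q) o\<^sub>L R = id_blinfun"
    using blinfun_neumann[OF norm_lin_le[OF q]] by blast
  from someI_ex[OF this] show "res q o\<^sub>L (id_blinfun - lin q) = id_blinfun"
    "(id_blinfun - lin q) o\<^sub>L res q = id_blinfun" unfolding res_def by blast+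
qed

lemma res_eqI:
  assumes "q \<in> Q" "w - blinfun_apply (lin q) w = v"
  shows "blinfun_apply (res q) v = w"
  using arg_cong[OF res_left[OF assms(1)], of "\<lambda>f. blinfun_apply f w"] assms(2)
  by (simp add: blinfun.bilinear_simps)

text \<open>Implicit differentiation of \<open>step q (sol q) = sol q\<close>. Applying
  \<open>1 - lin q\<close> to the increment of \<open>sol\<close> leaves
  \<open>rhs q (p - q)\<close> and two errors: a product of two increments, and the linearisation
  error of the superposition operator. Both are of smaller order by
  \<open>sol_Lipschitz\<close>.\<close>

lemma sol_has_derivative:
  assumes q: "q \<in> Q"
  shows "(sol has_derivative (\<lambda>h. blinfun_apply (res q) (rhs q h))) (at q)"
proof -
  let ?u = "sol q" and ?J = "blinfun_apply curve_integral" and ?N = "blinfun_apply (comp_curve_deriv a (sol q))"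
  define M L where "M = norm (res q) + 1" and "L = 2 * (1 + A)"
  have M: "M > 0" "norm (res q) \<le> M" unfolding M_def by (auto intro: add_nonneg_pos)
  have L: "L > 0" using A_nonneg by (simp add: L_def)
  have id: "(sol p - ?u) - blinfun_apply (res q) (rhs q (p - q)) = blinfun_apply (res q)
      (fst (p - q) *\<^sub>R ?J (comp_curve a (sol p) - comp_curve a ?u)
      + fst q *\<^sub>R ?J (comp_curve a (sol p) - comp_curve a ?u - ?N (sol p - ?u)))" if p: "p \<in> Q" for p
  proof -
    have "(sol p - ?u) - blinfun_apply (lin q) (sol p - ?u) = rhs q (p - q)
      + (fst (p - q) *\<^sub>R ?J (comp_curve a (sol p) - comp_curve a ?u)
      + fst q *\<^sub>R ?J (comp_curve a (sol p) - comp_curve a ?u - ?N (sol p - ?u)))"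
    proof -
      have "sol p - ?u = step p (sol p) - step q ?u" using step_sol p q by simp
      then show ?thesis
        by (simp add: step_def rhs_def lin_def const_bcontfun_diff blinfun.diff_right
            blinfun.scaleR_left scaleR_diff_left scaleR_diff_right)
    qed
    from res_eqI[OF q this] show ?thesis by (simp add: blinfun.bilinear_simps algebra_simps)
  qed
  have "(sol has_derivative (\<lambda>h. blinfun_apply (res q) (rhs q h))) (at q within Q)"
    unfolding has_derivative_within_alt
  proof (intro conjI allI impI)
    have "bounded_linear (\<lambda>h. rhs q h)"
      unfolding rhs_def
      by (intro bounded_linear_add bounded_linear_compose[OF bounded_linear_const_bcontfun]
          bounded_linear_snd bounded_linear_compose[OF bounded_linear_scaleR_left bounded_linear_fst])
    then show "bounded_linear (\<lambda>h. blinfun_apply (res q) (rhs q h))"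
      by (rule bounded_linear_compose[OF blinfun.bounded_linear_right])
    fix e :: real assume e: "e > 0"
    \<comment> \<open>The linearisation error is later multiplied by
      \<open>M * \<delta> * L\<close>; this value makes its share \<open>e / 2\<close>.\<close>
    define \<eta> where "\<eta> = e / (2 * M * \<delta> * L)"
    have \<eta>: "\<eta> > 0" using e M \<delta> L by (simp add: \<eta>_def)
    obtain d where d: "d > 0" "\<And>v. v \<in> W \<Longrightarrow> norm (v - ?u) < d \<Longrightarrow>
        norm (comp_curve a v - comp_curve a ?u - ?N (v - ?u)) \<le> \<eta> * norm (v - ?u)"
      using comp_curve_has_derivative[OF a sol_in_W[OF q]] \<eta> unfolding has_derivative_within_alt by meson
    \<comment> \<open>The first entry puts \<open>sol p\<close> within \<open>d\<close> of
      \<open>sol q\<close>; the second gives the product of increments the share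
      \<open>e / 2\<close>. Using \<open>K + 1\<close> avoids a division by zero when
      \<open>K = 0\<close>.\<close>
    define d' where "d' = min (d / L) (e / (2 * M * (K + 1) * L))"
    have d': "d' > 0" using d(1) L e M K(1) by (simp add: d'_def)
    show "\<exists>d>0. \<forall>p\<in>Q. norm (p - q) < d \<longrightarrow>
        norm (sol p - sol q - blinfun_apply (res q) (rhs q (p - q))) \<le> e * norm (p - q)"
    proof (intro exI[of _ d'] conjI d' ballI impI)
      fix p assume p: "p \<in> Q" "norm (p - q) < d'"
      let ?h = "norm (p - q)"
      have \<Delta>: "norm (sol p - ?u) \<le> L * ?h" using sol_Lipschitz[OF p(1) q] by (simp add: L_def)
      moreover have "L * ?h < d" using p(2) L by (simp add: d'_def field_simps)
      ultimately have N: "norm (comp_curve a (sol p) - comp_curve a ?u - ?N (sol p - ?u)) \<le> \<eta> * (L * ?h)"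
        using d(2)[OF sol_in_W[OF p(1)]] \<eta> by (smt (verit) mult_left_mono)
      have C: "norm (comp_curve a (sol p) - comp_curve a ?u) \<le> (K + 1) * (L * ?h)"
        using order_trans[OF comp_Lipschitz[OF sol_in_W[OF p(1)] sol_in_W[OF q]] mult_mono[OF _ \<Delta>]] K(1) by auto
      have f: "\<bar>fst (p - q)\<bar> \<le> ?h"
        using norm_fst_le[of "fst (p - q)" "snd (p - q)"] by (simp only: prod.collapse real_norm_def)
      have h: "?h * (2 * M * (K + 1) * L) \<le> e"
        using p(2) M L K(1) by (simp add: d'_def pos_less_divide_eq)
      have "norm (fst (p - q) *\<^sub>R ?J (comp_curve a (sol p) - comp_curve a ?u)) \<le> ?h * ((K + 1) * (L * ?h))"
        unfolding norm_scaleR using f by (intro mult_mono order_trans[OF norm_curve_integral_le C]) auto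
      moreover have "norm (fst q *\<^sub>R ?J (comp_curve a (sol p) - comp_curve a ?u - ?N (sol p - ?u))) \<le> \<delta> * (\<eta> * (L * ?h))"
        unfolding norm_scaleR using q \<delta> by (intro mult_mono order_trans[OF norm_curve_integral_le N]) (auto simp: Q_def)
      ultimately have "norm (sol p - ?u - blinfun_apply (res q) (rhs q (p - q)))
          \<le> M * (?h * ((K + 1) * (L * ?h)) + \<delta> * (\<eta> * (L * ?h)))"
        unfolding id[OF p(1)] using M
        by (intro order_trans[OF norm_blinfun] mult_mono order_trans[OF norm_triangle_ineq] add_mono) auto
      also have "\<dots> = (?h * (2 * M * (K + 1) * L)) * ?h / 2 + e / 2 * ?h"
        using M L \<delta> by (simp add: \<eta>_def field_simps)
      also have "\<dots> \<le> e * ?h / 2 + e / 2 * ?h"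
        using mult_right_mono[OF h, of ?h] by simp
      finally show "norm (sol p - ?u - blinfun_apply (res q) (rhs q (p - q))) \<le> e * ?h" by simp
    qed
  qed
  then show ?thesis by (simp add: at_within_open[OF q open_Q])
qed

text \<open>The derivative \<open>res q (rhs q h)\<close> arises from \<open>sol\<close> by
  operations that preserve each order of smoothness, so order \<open>k\<close> of \<open>sol\<close>
  gives order \<open>Suc k\<close>.\<close>

lemma smooth_sol: "smooth_on Q sol"
  unfolding smooth_on_def
proof
  fix k
  note comp = bounded_bilinear_blinfun_compose
  have sW: "sol ` Q \<subseteq> W" using sol_in_W by blast
  show "Ck_on k Q sol"
  proof (induction k)
    case 0
    have "isCont sol q" if "q \<in> Q" for q
      using sol_has_derivative[OF that] has_derivative_continuous by blast
    then show ?case by (simp add: continuous_at_imp_continuous_on)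
  next
    case (Suc k)
    have fst: "Ck_on k Q fst"
      by (rule Ck_on_bounded_linear[OF open_Q bounded_linear_fst Ck_on_ident[OF open_Q]])
    have "Ck_on k Q (\<lambda>q. curve_integral o\<^sub>L comp_curve_deriv a (sol q))"
      by (rule Ck_on_bounded_linear[OF open_Q bounded_bilinear.bounded_linear_right[OF comp]
            Ck_on_comp_curve_deriv[OF open_Q Suc sW a]])
    then have "Ck_on k Q lin"
      unfolding lin_def by (rule Ck_on_scaleR[OF open_Q fst])
    then have "Ck_on k Q (\<lambda>q. id_blinfun - lin q)"
      by (rule Ck_on_diff[OF open_Q Ck_on_const[OF open_Q]])
    then have res: "Ck_on k Q res"
      by (rule Ck_on_blinfun_inverse[OF open_Q _ res_left res_right])
    have "Ck_on k Q (\<lambda>q. blinfun_apply curve_integral (comp_curve a (sol q)))"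
      by (rule Ck_on_bounded_linear[OF open_Q blinfun.bounded_linear_right Ck_on_comp_curve[OF open_Q Suc sW a]])
    then have "Ck_on k Q (\<lambda>q. fst h *\<^sub>R blinfun_apply curve_integral (comp_curve a (sol q)))" for h :: "real \<times> 'e"
      by (rule Ck_on_bounded_linear[OF open_Q bounded_linear_scaleR_right])
    then have "Ck_on k Q (\<lambda>q. rhs q h)" for h
      unfolding rhs_def by (rule Ck_on_add[OF open_Q Ck_on_const[OF open_Q]])
    then have "Ck_on k Q (\<lambda>q. blinfun_apply (res q) (rhs q h))" for h
      by (rule Ck_on_bounded_bilinear[OF open_Q bounded_bilinear_blinfun_apply res])
    then show ?case
      using sol_has_derivative by (intro Ck_on_SucI[OF open_Q]) auto
  qed
qed

lemma sol_apply:
  assumes "q \<in> Q"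
  shows "apply_bcontfun (sol q) t = snd q + fst q *\<^sub>R integral {0..unit_clamp t} (apply_bcontfun (comp_curve a (sol q)))"
proof -
  have "apply_bcontfun (sol q) t = apply_bcontfun (step q (sol q)) t" by (simp add: step_sol[OF assms])
  then show ?thesis by (simp add: step_def const_bcontfun.rep_eq curve_integral_apply)
qed

definition "speed q = Bcontfun (\<lambda>t. unit_clamp t *\<^sub>R a (apply_bcontfun (sol q) t))"

lemma speed_apply:
  assumes "q \<in> Q"
  shows "apply_bcontfun (speed q) t = unit_clamp t *\<^sub>R a (apply_bcontfun (sol q) t)"
proof -
  have "(\<lambda>t. unit_clamp t *\<^sub>R a (apply_bcontfun (sol q) t)) \<in> bcontfun"
  proof (rule bcontfun_normI)
    show "continuous_on UNIV (\<lambda>t. unit_clamp t *\<^sub>R a (apply_bcontfun (sol q) t))"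
      using curve_in_ball[OF sol_in_W[OF assms]]
      by (intro continuous_on_scaleR continuous_on_unit_clamp continuous_on_compose2[OF smooth_cont[OF a]]
          continuous_on_apply_bcontfun) auto
    show "norm (unit_clamp t *\<^sub>R a (apply_bcontfun (sol q) t)) \<le> A" for t
      using A(1)[OF curve_in_ball[OF sol_in_W[OF assms]], of t] mult_mono[of "unit_clamp t" 1 "norm (a (apply_bcontfun (sol q) t))" A]
      by auto
  qed
  then show ?thesis by (simp add: speed_def Bcontfun_inverse)
qed

text \<open>The variational equation for the time derivative is solved by \<open>t \<mapsto> t a(u t)\<close>, because
  \<open>(t a(u))' = a(u) + t Da(u) u'\<close> with \<open>u' = \<epsilon> a(u)\<close>.\<close>

lemma speed_equation:
  assumes q: "q \<in> Q"
  shows "speed q - blinfun_apply (lin q) (speed q) = rhs q (1, 0)"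
proof -
  let ?u = "apply_bcontfun (sol q)" and ?N = "comp_curve_deriv a (sol q)"
  let ?g = "comp_curve a (sol q) + fst q *\<^sub>R blinfun_apply ?N (speed q)"
  have u': "(?u has_vector_derivative fst q *\<^sub>R a (?u s)) (at s within {0..1})" if s: "s \<in> {0..1}" for s
  proof (rule has_vector_derivative_transform[OF s])
    have "((\<lambda>s. integral {0..s} (apply_bcontfun (comp_curve a (sol q)))) has_vector_derivative
        apply_bcontfun (comp_curve a (sol q)) s) (at s within {0..1})"
      by (rule integral_has_vector_derivative[OF continuous_on_apply_bcontfun s])
    then show "((\<lambda>s. snd q + fst q *\<^sub>R integral {0..s} (apply_bcontfun (comp_curve a (sol q)))) has_vector_derivative
        fst q *\<^sub>R a (?u s)) (at s within {0..1})"
      unfolding comp_apply[OF sol_in_W[OF q]] has_vector_derivative_def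
      by (rule has_derivative_eq_rhs[OF has_derivative_add[OF has_derivative_const
              has_derivative_scaleR_right]]) (auto simp: fun_eq_iff)
  qed (use unit_clamp_id in \<open>simp add: sol_apply[OF q]\<close>)
  \<comment> \<open>Solution curves are constant outside the unit interval.\<close>
  have clamp: "?u (unit_clamp t) = ?u t" for t
    by (simp add: sol_apply[OF q] unit_clamp_id)
  have "speed q = blinfun_apply curve_integral ?g"
  proof (rule bcontfun_eqI)
    fix t
    let ?T = "unit_clamp t"
    have "((\<lambda>s. apply_bcontfun ?g s) has_integral ?T *\<^sub>R a (?u ?T) - 0 *\<^sub>R a (?u 0)) {0..?T}"
    proof (rule fundamental_theorem_of_calculus)
      fix s assume s: "s \<in> {0..?T}"
      then have s1: "s \<in> {0..1}" by (auto intro: order_trans)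
      have U: "?u s \<in> U" using curve_in_ball[OF sol_in_W[OF q]] B(3) by blast
      have "(a has_derivative frechet_derivative a (at (?u s))) (at (?u s) within ?u ` {0..?T})"
        by (rule has_derivative_at_withinI[OF smooth_on_has_derivative[OF a U]])
      moreover have "(?u has_derivative (\<lambda>x. x *\<^sub>R (fst q *\<^sub>R a (?u s)))) (at s within {0..?T})"
        using has_vector_derivative_within_subset[OF u'[OF s1], of "{0..?T}"]
        unfolding has_vector_derivative_def by simp
      ultimately have "((\<lambda>s. a (?u s)) has_derivative
          (\<lambda>x. frechet_derivative a (at (?u s)) (x *\<^sub>R (fst q *\<^sub>R a (?u s))))) (at s within {0..?T})"
        by (rule has_derivative_in_compose[rotated])
      moreover have lin: "linear (frechet_derivative a (at (?u s)))"
        using smooth_on_has_derivative[OF a U] has_derivative_linear by blast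
      ultimately have "((\<lambda>s. a (?u s)) has_vector_derivative
          fst q *\<^sub>R frechet_derivative a (at (?u s)) (a (?u s))) (at s within {0..?T})"
        by (simp add: has_vector_derivative_def linear_scale)
      then have "((\<lambda>s. s *\<^sub>R a (?u s)) has_vector_derivative
          s *\<^sub>R (fst q *\<^sub>R frechet_derivative a (at (?u s)) (a (?u s))) + 1 *\<^sub>R a (?u s)) (at s within {0..?T})"
        by (intro has_vector_derivative_scaleR DERIV_ident)
      then show "((\<lambda>s. s *\<^sub>R a (?u s)) has_vector_derivative apply_bcontfun ?g s) (at s within {0..?T})"
        using s1 lin by (simp add: comp_apply[OF sol_in_W[OF q]] comp_curve_deriv_apply[OF a sol_in_W[OF q]]
            speed_apply[OF q] unit_clamp_id linear_scale ac_simps)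
    qed simp
    then have "integral {0..?T} (apply_bcontfun ?g) = ?T *\<^sub>R a (?u ?T)"
      by (simp add: integral_unique)
    then show "apply_bcontfun (speed q) t = apply_bcontfun (blinfun_apply curve_integral ?g) t"
      by (simp only: curve_integral_apply speed_apply[OF q] clamp)
  qed
  then show ?thesis
    using linear_0[OF bounded_linear.linear[OF bounded_linear_const_bcontfun]]
    by (simp add: lin_def rhs_def blinfun.bilinear_simps algebra_simps)
qed

section \<open>The flow and its derivatives\<close>

definition "flow q = apply_bcontfun (sol q) 1"

lemma smooth_flow: "smooth_on Q flow"
  unfolding flow_def by (rule smooth_on_bounded_linear[OF open_Q bounded_linear_apply_bcontfun smooth_sol])

lemma flow_in_U: "q \<in> Q \<Longrightarrow> flow q \<in> U"
  using curve_in_ball[OF sol_in_W] B(3) unfolding flow_def by blast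

lemma flow_zero: "(0, y) \<in> Q \<Longrightarrow> flow (0, y) = y"
  by (simp add: flow_def sol_apply)

lemma frechet_derivative_flow:
  assumes "q \<in> Q"
  shows "frechet_derivative flow (at q) h = apply_bcontfun (blinfun_apply (res q) (rhs q h)) 1"
proof -
  have "(flow has_derivative (\<lambda>h. apply_bcontfun (blinfun_apply (res q) (rhs q h)) 1)) (at q)"
    unfolding flow_def
    by (rule bounded_linear.has_derivative[OF bounded_linear_apply_bcontfun sol_has_derivative[OF assms]])
  from frechet_derivative_at[OF this] show ?thesis by metis
qed

lemma flow_time_derivative:
  assumes "q \<in> Q"
  shows "frechet_derivative flow (at q) (1, 0) = a (flow q)"
  by (simp add: frechet_derivative_flow[OF assms] res_eqI[OF assms speed_equation[OF assms]]
      speed_apply[OF assms] flow_def unit_clamp_id)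

text \<open>If the field does not change in direction \<open>k\<close>, the constant curve
  \<open>k\<close> solves the variational equation, hence is the derivative of the flow in that
  direction.\<close>

lemma flow_symmetry:
  assumes q: "q \<in> Q" and k: "\<And>x. x \<in> U \<Longrightarrow> frechet_derivative a (at x) k = 0"
  shows "frechet_derivative flow (at q) (0, k) = k"
proof -
  have "blinfun_apply (comp_curve_deriv a (sol q)) (const_bcontfun k) = 0"
    by (rule bcontfun_eqI)
      (use k curve_in_ball[OF sol_in_W[OF q]] B(3) in
        \<open>auto simp: comp_curve_deriv_apply[OF a sol_in_W[OF q]] const_bcontfun.rep_eq subset_iff\<close>)
  then have "const_bcontfun k - blinfun_apply (lin q) (const_bcontfun k) = rhs q (0, k)"
    by (simp add: lin_def rhs_def blinfun.bilinear_simps)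
  from res_eqI[OF q this] show ?thesis
    by (simp add: frechet_derivative_flow[OF q] const_bcontfun.rep_eq)
qed

end

theorem smooth_local_flow:
  fixes a :: "'e::euclidean_space \<Rightarrow> 'e"
  assumes "open U" "x0 \<in> U" "smooth_on U a"
  obtains d \<rho> :: real and \<phi> where "d > 0" "\<rho> > 0" "smooth_on ({-d<..<d} \<times> ball x0 \<rho>) \<phi>"
    "\<And>q. q \<in> {-d<..<d} \<times> ball x0 \<rho> \<Longrightarrow> \<phi> q \<in> U"
    "\<And>y. y \<in> ball x0 \<rho> \<Longrightarrow> \<phi> (0, y) = y"
    "\<And>q. q \<in> {-d<..<d} \<times> ball x0 \<rho> \<Longrightarrow> frechet_derivative \<phi> (at q) (1, 0) = a (\<phi> q)"
    "\<And>q k. q \<in> {-d<..<d} \<times> ball x0 \<rho> \<Longrightarrow> \<forall>x\<in>U. frechet_derivative a (at x) k = 0 \<Longrightarrow>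
      frechet_derivative \<phi> (at q) (0, k) = k"
proof -
  obtain r where r: "r > 0" "cball x0 r \<subseteq> U" using assms(1,2) open_contains_cball by blast
  have "continuous_on (cball x0 r) a" "continuous_on (cball x0 r) (blinfun_derivative a)"
    using smooth_on_imp_continuous_on[OF assms(3)] r(2) continuous_on_subset
      smooth_on_imp_continuous_on[OF smooth_on_blinfun_derivative[OF assms(1,3)]] by blast+
  then have "bounded (a ` cball x0 r)" "bounded (blinfun_derivative a ` cball x0 r)"
    using compact_continuous_image compact_imp_bounded compact_cball by blast+
  then obtain A K where A: "A > 0" "\<And>x. x \<in> cball x0 r \<Longrightarrow> norm (a x) \<le> A"
    and K: "K > 0" "\<And>x. x \<in> cball x0 r \<Longrightarrow> norm (blinfun_derivative a x) \<le> K"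
    unfolding bounded_pos by blast
  define d where "d = min (1 / (2 * K)) (r / (2 * A))"
  have d: "d > 0" "d * K \<le> 1/2" "d * A \<le> r / 2"
    using A(1) K(1) r(1) by (auto simp: d_def min_def field_simps)
  interpret picard U x0 r a d K A
  proof unfold_locales
    fix x v assume x: "x \<in> cball x0 r"
    have "frechet_derivative a (at x) v = blinfun_apply (blinfun_derivative a x) v"
      by (rule blinfun_derivative_apply[symmetric, OF differentiableI[OF smooth_on_has_derivative[OF assms(3)]]])
        (use x r(2) in blast)
    then show "norm (frechet_derivative a (at x) v) \<le> K * norm v"
      using order_trans[OF norm_blinfun mult_right_mono[OF K(2)[OF x]]] by simp
  qed (use assms r A K d in auto)
  show ?thesis
    by (rule that[where d = d and \<rho> = "r / 2" and \<phi> = flow, folded Q_def])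
      (use d(1) r(1) smooth_flow flow_in_U flow_zero flow_time_derivative flow_symmetry in \<open>auto simp: Q_def\<close>)
qed

section \<open>Straightening a vector field\<close>

text \<open>\<open>\<psi>\<close> follows the flow of \<open>X\<close> for time \<open>z $ j\<close>
  from a hyperplane transversal to \<open>X\<close>, so that \<open>X\<close> becomes the coordinate
  field with index \<open>j\<close>. Transversality is witnessed by an index \<open>m\<close> that
  may differ from \<open>j\<close>. As neither lies in \<open>K\<close> and \<open>X\<close> is
  constant in the directions of \<open>K\<close>, both the parametrisation of the hyperplane and the
  flow preserve these directions.\<close>

theorem straighten_field:
  fixes X :: "real^'n \<Rightarrow> real^'n" and x0 :: "real^'n" and K :: "'n::finite set"
  assumes "open U" "x0 \<in> U" "smooth_on U X" and m: "X x0 $ m \<noteq> 0" "m \<notin> K" and j: "j \<notin> K"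
    and K: "\<forall>k\<in>K. \<forall>x\<in>U. frechet_derivative X (at x) (axis k 1) = 0"
  obtains Z V :: "(real^'n) set" and \<psi> g where "open Z" "open V" "V \<subseteq> U" "x0 \<in> V" "homeomorphism Z V \<psi> g"
    "smooth_on Z \<psi>" "smooth_on V g"
    "\<forall>z\<in>Z. frechet_derivative \<psi> (at z) (axis j 1) = X (\<psi> z)"
    "\<forall>z\<in>Z. \<forall>k\<in>K. frechet_derivative \<psi> (at z) (axis k 1) = axis k 1"
proof -
  obtain d \<rho> :: real and \<phi> where d: "d > 0" "\<rho> > 0" and sm: "smooth_on ({-d<..<d} \<times> ball x0 \<rho>) \<phi>"
    and inU: "\<And>q. q \<in> {-d<..<d} \<times> ball x0 \<rho> \<Longrightarrow> \<phi> q \<in> U"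
    and zero: "\<And>y. y \<in> ball x0 \<rho> \<Longrightarrow> \<phi> (0, y) = y"
    and time: "\<And>q. q \<in> {-d<..<d} \<times> ball x0 \<rho> \<Longrightarrow> frechet_derivative \<phi> (at q) (1, 0) = X (\<phi> q)"
    and sym: "\<And>q k. q \<in> {-d<..<d} \<times> ball x0 \<rho> \<Longrightarrow>
      \<forall>x\<in>U. frechet_derivative X (at x) k = 0 \<Longrightarrow> frechet_derivative \<phi> (at q) (0, k) = k"
    by (rule smooth_local_flow[OF assms(1-3)]) (rule that, assumption, assumption, assumption, blast+)
  define Q where "Q = {-d<..<d} \<times> ball x0 \<rho>"
  note sm = sm[folded Q_def] and inU = inU[folded Q_def] and time = time[folded Q_def] and sym = sym[folded Q_def]
  have openQ: "open Q" unfolding Q_def by (intro open_Times) auto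
  text \<open>The initial values of the flow form the hyperplane \<open>y\<^sub>m = (x0)\<^sub>m\<close>, which \<open>X\<close> crosses; \<open>P\<close>
    parametrises its directions by the coordinates other than \<open>j\<close>.\<close>
  define \<sigma> where "\<sigma> = Transposition.transpose j m"
  define P :: "real^'n \<Rightarrow> real^'n" where "P z = (\<chi> i. if i = m then 0 else z $ \<sigma> i)" for z
  have linP: "linear P"
    by (rule linearI) (auto simp: P_def vec_eq_iff)
  have blP: "bounded_linear P" using linP by (simp add: linear_conv_bounded_linear)
  define \<kappa> where "\<kappa> = (\<lambda>z. (z $ j, x0 + P z))"
  define \<psi> where "\<psi> = (\<lambda>z. \<phi> (\<kappa> z))"
  have \<kappa>': "(\<kappa> has_derivative (\<lambda>h. (h $ j, P h))) (at z)" for z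
    unfolding \<kappa>_def
    by (rule has_derivative_eq_rhs[OF has_derivative_Pair[OF bounded_linear_imp_has_derivative[OF bounded_linear_vec_nth]
          has_derivative_add[OF has_derivative_const bounded_linear_imp_has_derivative[OF blP]]]]) simp
  have sm\<kappa>: "smooth_on UNIV \<kappa>"
    unfolding smooth_on_def
  proof
    show "Ck_on k UNIV \<kappa>" for k
    proof (cases k)
      case 0
      have "isCont \<kappa> z" for z using \<kappa>' has_derivative_continuous by blast
      then show ?thesis using 0 by (simp add: continuous_at_imp_continuous_on)
    next
      case (Suc k')
      show ?thesis unfolding Suc
        by (rule Ck_on_SucI[OF open_UNIV \<kappa>' Ck_on_const[OF open_UNIV]])
    qed
  qed
  define Z0 where "Z0 = \<kappa> -` Q"
  have openZ0: "open Z0"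
    unfolding Z0_def using smooth_on_imp_continuous_on[OF sm\<kappa>] openQ open_vimage by blast
  have \<psi>: "smooth_on Z0 \<psi>"
    unfolding \<psi>_def
    by (rule smooth_on_compose[OF openZ0 openQ smooth_on_subset[OF sm\<kappa>] sm]) (auto simp: Z0_def)
  have \<psi>': "frechet_derivative \<psi> (at z) h = frechet_derivative \<phi> (at (\<kappa> z)) (h $ j, P h)" if "z \<in> Z0" for z h
  proof -
    have "(\<phi> has_derivative frechet_derivative \<phi> (at (\<kappa> z))) (at (\<kappa> z))"
      by (rule smooth_on_has_derivative[OF sm]) (use that in \<open>simp add: Z0_def\<close>)
    from has_derivative_compose[OF \<kappa>' this]
    have "(\<psi> has_derivative (\<lambda>h. frechet_derivative \<phi> (at (\<kappa> z)) (h $ j, P h))) (at z)"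
      unfolding \<psi>_def .
    from fun_cong[OF frechet_derivative_at[OF this], of h] show ?thesis by simp
  qed
  have Pj: "P (axis j 1) = 0"
    by (auto simp: P_def vec_eq_iff axis_def \<sigma>_def Transposition.transpose_def split: if_splits)
  have PK: "P (axis k 1) = axis k 1" if "k \<in> K" for k
    using that m(2) j by (auto simp: P_def vec_eq_iff axis_def \<sigma>_def Transposition.transpose_def split: if_splits)
  have k0: "\<kappa> 0 = (0, x0)" using linear_0[OF linP] by (simp add: \<kappa>_def)
  have Z00: "0 \<in> Z0" using d by (simp add: Z0_def k0 Q_def)
  have \<psi>0: "\<psi> 0 = x0" using d zero by (simp add: \<psi>_def k0)
  \<comment> \<open>The space part comes from \<open>\<phi> (0, y) = y\<close>, the time part from
    the flow equation.\<close>
  have \<phi>2: "frechet_derivative \<phi> (at (0, x0)) (t, w) = t *\<^sub>R X x0 + w" for t w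
  proof -
    have q: "(0, x0) \<in> Q" using d by (simp add: Q_def)
    have der: "(\<phi> has_derivative frechet_derivative \<phi> (at (0, x0))) (at (0, x0))"
      by (rule smooth_on_has_derivative[OF sm q])
    have "((\<lambda>y. (0::real, y)) has_derivative (\<lambda>w. (0, w))) (at x0)"
      by (intro has_derivative_Pair has_derivative_const has_derivative_ident)
    from has_derivative_compose[OF this der]
    have "((\<lambda>y. \<phi> (0, y)) has_derivative (\<lambda>w. frechet_derivative \<phi> (at (0, x0)) (0, w))) (at x0)" .
    then have "((\<lambda>y. y) has_derivative (\<lambda>w. frechet_derivative \<phi> (at (0, x0)) (0, w))) (at x0)"
      by (rule has_derivative_transform_within_open[where s = "ball x0 \<rho>"]) (use d zero in auto)
    then have w: "frechet_derivative \<phi> (at (0, x0)) (0, w) = w"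
      by (rule fun_cong[OF has_derivative_unique[OF _ has_derivative_ident]])
    have "(t, w) = t *\<^sub>R (1, 0) + (0, w)" by simp
    then have "frechet_derivative \<phi> (at (0, x0)) (t, w)
        = t *\<^sub>R frechet_derivative \<phi> (at (0, x0)) (1, 0) + frechet_derivative \<phi> (at (0, x0)) (0, w)"
      by (simp only: linear_add[OF has_derivative_linear[OF der]] linear_scale[OF has_derivative_linear[OF der]])
    then show ?thesis using w time[OF q] zero[of x0] d by simp
  qed
  have "inj (frechet_derivative \<psi> (at 0))"
  proof (subst linear_injective_0)
    show "linear (frechet_derivative \<psi> (at 0))"
      using smooth_on_has_derivative[OF \<psi> Z00] has_derivative_linear by blast
    show "\<forall>h. frechet_derivative \<psi> (at 0) h = 0 \<longrightarrow> h = 0"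
    proof (intro allI impI)
      fix h assume "frechet_derivative \<psi> (at 0) h = 0"
      then have h: "h $ j *\<^sub>R X x0 + P h = 0" by (simp add: \<psi>'[OF Z00] k0 \<phi>2)
      \<comment> \<open>\<open>P h\<close> has no component \<open>m\<close> while
        \<open>X x0\<close> has one, so the time coordinate of \<open>h\<close> must vanish.\<close>
      from arg_cong[OF this, of "\<lambda>v. v $ m"] have hj: "h $ j = 0" using m by (simp add: P_def)
      have "h $ i = 0" for i
      proof (cases "i = j")
        case False
        then have "\<sigma> i \<noteq> m" "\<sigma> (\<sigma> i) = i" by (auto simp: \<sigma>_def Transposition.transpose_def split: if_splits)
        then have "P h $ \<sigma> i = h $ i" by (simp add: P_def)
        then show ?thesis using h hj by simp
      qed (use hj in simp)
      then show "h = 0" by (simp add: vec_eq_iff)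
    qed
  qed
  then obtain Z V g where Z: "open Z" "Z \<subseteq> Z0" "0 \<in> Z" "open V" and hom: "homeomorphism Z V \<psi> g"
    and g: "smooth_on V g"
    by (rule smooth_inverse_function[OF openZ0 Z00 \<psi>]) (rule that, assumption+)
  show ?thesis
  proof (rule that[OF Z(1) Z(4) _ _ hom smooth_on_subset[OF \<psi> Z(2)] g])
    have V: "V = \<psi> ` Z" using hom by (simp add: homeomorphism_def)
    show "V \<subseteq> U" using Z(2) inU unfolding V \<psi>_def Z0_def by auto
    show "x0 \<in> V" using Z(3) \<psi>0 unfolding V by force
    have d: "frechet_derivative \<psi> (at z) (axis j 1) = X (\<psi> z) \<and>
        (\<forall>k\<in>K. frechet_derivative \<psi> (at z) (axis k 1) = axis k 1)" if z: "z \<in> Z" for z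
    proof (intro conjI ballI)
      have Q: "\<kappa> z \<in> Q" "z \<in> Z0" using Z(2) z by (auto simp: Z0_def)
      show "frechet_derivative \<psi> (at z) (axis j 1) = X (\<psi> z)"
        using time[OF Q(1)] by (simp add: \<psi>'[OF Q(2)] Pj) (simp add: \<psi>_def)
      fix k assume k: "k \<in> K"
      have "(axis k 1 :: real^'n) $ j = 0" using k j by (auto simp: axis_def)
      then show "frechet_derivative \<psi> (at z) (axis k 1) = axis k 1"
        using sym[OF Q(1), of "axis k 1"] K k PK[OF k] by (simp add: \<psi>'[OF Q(2)])
    qed
    show "\<forall>z\<in>Z. frechet_derivative \<psi> (at z) (axis j 1) = X (\<psi> z)"
      "\<forall>z\<in>Z. \<forall>k\<in>K. frechet_derivative \<psi> (at z) (axis k 1) = axis k 1"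
      using d by blast+
  qed
qed

section \<open>Algebra of the torsion tensors at a point\<close>

text \<open>\<open>A\<close> is the operator at a point, and \<open>D v\<close> its derivative in direction \<open>v\<close>.\<close>

definition nij :: "('a::ab_group_add \<Rightarrow> 'a) \<Rightarrow> ('a \<Rightarrow> 'a \<Rightarrow> 'a) \<Rightarrow> 'a \<Rightarrow> 'a \<Rightarrow> 'a" where
  "nij A D v w = D (A v) w - D (A w) v + A (D w v) - A (D v w)"

definition haa :: "('a::ab_group_add \<Rightarrow> 'a) \<Rightarrow> ('a \<Rightarrow> 'a \<Rightarrow> 'a) \<Rightarrow> 'a \<Rightarrow> 'a \<Rightarrow> 'a" where
  "haa A D v w = A (A (nij A D v w)) + nij A D (A v) (A w) - A (nij A D (A v) w) - A (nij A D v (A w))"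

definition tor :: "('a::ab_group_add \<Rightarrow> 'a) \<Rightarrow> ('a \<Rightarrow> 'a \<Rightarrow> 'a) \<Rightarrow> 'a \<Rightarrow> 'a \<Rightarrow> 'a" where
  "tor B H v w = B (H (B v) w) - B (H v (B w)) + H (B (B v)) w"

text \<open>Let \<open>B_v\<close> and \<open>B_w\<close> denote \<open>B\<close> acting on the
  first and second argument. The Haantjes torsion is \<open>(B - B_v)(B - B_w)\<close> applied to
  the Nijenhuis torsion, and a scalar added to \<open>B\<close> drops out of both factors. The
  Nijenhuis torsion itself changes by \<open>d(Bv) w - d(Bw) v + d(w) Bv - d(v) Bw\<close>, each
  term of which is annihilated by one of the factors.\<close>

lemma haa_shift:
  fixes B :: "'a::real_vector \<Rightarrow> 'a"
  assumes B: "linear B" and D1: "\<And>w. linear (\<lambda>v. D v w)" and D2: "\<And>v. linear (D v)" and d: "linear d"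
  shows "haa (\<lambda>v. c *\<^sub>R v + B v) (\<lambda>v w. d v *\<^sub>R w + D v w) v w = haa B D v w"
proof -
  note [simp] = linear_add[OF B] linear_diff[OF B] linear_scale[OF B]
    linear_add[OF D1] linear_scale[OF D1] linear_add[OF D2] linear_scale[OF D2]
    linear_add[OF d] linear_scale[OF d]
  show ?thesis
    by (simp add: haa_def nij_def algebra_simps)
qed

lemma scaleR_3: "3 *\<^sub>R x = x + x + x" for x :: "'a::real_vector"
  using scaleR_add_left[of 2 1 x] by (simp add: scaleR_2)

lemma scaleR_4: "4 *\<^sub>R x = x + x + x + x" for x :: "'a::real_vector"
  using scaleR_add_left[of 3 1 x] by (simp add: scaleR_3)

text \<open>The first-order jet at a point of a field with \<open>B^4 = 0\<close>;
  \<open>D_nil\<close> is this identity differentiated in direction \<open>u\<close>.\<close>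

locale nilpotent_jet =
  fixes B :: "'a::real_vector \<Rightarrow> 'a" and D :: "'a \<Rightarrow> 'a \<Rightarrow> 'a"
  assumes B: "linear B" and D1: "\<And>w. linear (\<lambda>v. D v w)" and D2: "\<And>v. linear (D v)"
    and nil: "\<And>v. B (B (B (B v))) = 0"
    and D_nil: "\<And>u v. D u (B (B (B v))) + B (D u (B (B v)) + B (D u (B v) + B (D u v))) = 0"
begin

lemmas lin_simps [simp] = linear_add[OF B] linear_diff[OF B] linear_scale[OF B] linear_neg[OF B] linear_0[OF B]
    linear_add[OF D1] linear_scale[OF D1] linear_diff[OF D1] linear_neg[OF D1] linear_0[OF D1]
    linear_add[OF D2] linear_scale[OF D2] linear_diff[OF D2] linear_neg[OF D2] linear_0[OF D2]

definition E :: "'a \<Rightarrow> nat \<Rightarrow> 'a" where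
  "E v i = (B ^^ i) v"

text \<open>The derivative in direction \<open>u\<close> of the field \<open>B\<^sup>i v\<close>, for constant \<open>v\<close>.\<close>

primrec DE :: "'a \<Rightarrow> 'a \<Rightarrow> nat \<Rightarrow> 'a" where
  "DE v u 0 = 0"
| "DE v u (Suc i) = D u (E v i) + B (DE v u i)"

text \<open>The Lie bracket of the fields \<open>B\<^sup>i v\<close> and \<open>B\<^sup>j v\<close>.\<close>

definition br :: "'a \<Rightarrow> nat \<Rightarrow> nat \<Rightarrow> 'a" where
  "br v i j = DE v (E v i) j - DE v (E v j) i"

lemma B_E: "B (E v i) = E v (Suc i)"
  by (simp add: E_def)

lemma E_zero: "i \<ge> 4 \<Longrightarrow> E v i = 0"
proof (induction i rule: dec_induct)
  case base
  then show ?case by (simp add: E_def nil eval_nat_numeral)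
next
  case (step i)
  then show ?case by (simp add: B_E[symmetric])
qed

lemma DE_zero: "i \<ge> 4 \<Longrightarrow> DE v u i = 0"
proof (induction i rule: dec_induct)
  case base
  have "DE v u (Suc (Suc (Suc (Suc 0)))) = 0"
    using D_nil[of u v] by (simp add: E_def)
  then show ?case by (simp add: eval_nat_numeral)
next
  case (step i)
  then show ?case by (simp add: E_zero)
qed

lemma br_zero: "i \<ge> 4 \<Longrightarrow> br v i j = 0" "j \<ge> 4 \<Longrightarrow> br v i j = 0"
proof -
  have "DE v 0 i = 0" for i by (induction i) auto
  then show "i \<ge> 4 \<Longrightarrow> br v i j = 0" "j \<ge> 4 \<Longrightarrow> br v i j = 0"
    by (simp_all add: br_def E_zero DE_zero)
qed

lemma br_swap: "br v j i = - br v i j"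
  by (simp add: br_def)

text \<open>The fields \<open>B^i v\<close> are not constant, but their derivatives
  \<open>DE\<close> cancel by tensoriality, and what remains can be written with Lie brackets
  alone.\<close>

lemma nij_E: "nij B D (E v i) (E v j) =
    B (B (br v i j)) + br v (Suc i) (Suc j) - B (br v (Suc i) j) - B (br v i (Suc j))"
  by (simp add: nij_def br_def B_E algebra_simps)

abbreviation "T \<equiv> tor B (haa B D)"

text \<open>Let \<open>S\<close> and \<open>S'\<close> raise the first and second index of the
  bracket. Then the Nijenhuis torsion is \<open>(B - S)(B - S')\<close>, the Haantjes torsion
  \<open>(B - S)^2 (B - S')^2\<close>, and \<open>T\<close> is
  \<open>(B S - B S' + S^2) (B - S)^2 (B - S')^2\<close>, all applied to \<open>br\<close>.
  Expanding with \<open>B^4 = S^4 = S'^4 = 0\<close> gives the coefficients.\<close>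

lemma tor_E: "T (E v i) (E v j) =
    - B (B (B (br v (i+3) j - br v (i+2) (j+1) + 3 *\<^sub>R br v (i+1) (j+2) + br v i (j+3))))
    + B (B (2 *\<^sub>R br v (i+3) (j+1) + br v (i+2) (j+2) + 2 *\<^sub>R br v (i+1) (j+3)))
    - B (br v (i+3) (j+2) + br v (i+2) (j+3))"
proof -
  have h: "haa B D (E v i) (E v j) =
      - 2 *\<^sub>R B (B (B (br v (i+1) j + br v i (j+1))))
      + B (B (br v (i+2) j + 4 *\<^sub>R br v (i+1) (j+1) + br v i (j+2)))
      - 2 *\<^sub>R B (br v (i+2) (j+1) + br v (i+1) (j+2)) + br v (i+2) (j+2)" for i j
    unfolding haa_def B_E nij_E
    by (simp add: nil scaleR_2 scaleR_4 algebra_simps)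
  show ?thesis
    unfolding tor_def B_E h
    by (simp add: nil scaleR_2 scaleR_3 scaleR_4 br_zero algebra_simps numeral_eq_Suc)
qed

lemma tor_zero_imp:
  assumes "\<And>v w. T v w = 0"
  shows "B (B (B (br v 1 2))) = 0" "B (B (B (br v 1 3))) = 0" "B (B (br v 2 3)) = 0"
proof -
  have self: "br v i i = 0" for i by (simp add: br_def)
  have "T (E v 0) (E v 0) = - 4 *\<^sub>R B (B (B (br v 1 2)))"
    unfolding tor_E using br_swap[of v 0 3] br_swap[of v 1 2] br_swap[of v 1 3] br_swap[of v 2 3]
    by (simp add: self scaleR_2 scaleR_3 scaleR_4 algebra_simps numeral_eq_Suc)
  then show "B (B (B (br v 1 2))) = 0" using assms by simp
  have "T (E v 1) (E v 0) = - 2 *\<^sub>R B (B (B (br v 1 3))) + B (B (br v 2 3))"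
    unfolding tor_E using br_swap[of v 1 3] br_swap[of v 2 3]
    by (simp add: self br_zero scaleR_2 scaleR_3 algebra_simps numeral_eq_Suc)
  moreover have "T (E v 0) (E v 1) = - 2 *\<^sub>R B (B (B (br v 1 3))) - B (B (br v 2 3))"
    unfolding tor_E using br_swap[of v 1 3] br_swap[of v 2 3]
    by (simp add: self br_zero scaleR_2 scaleR_3 algebra_simps numeral_eq_Suc)
  ultimately have e: "- 2 *\<^sub>R B (B (B (br v 1 3))) + B (B (br v 2 3)) = 0"
    "- 2 *\<^sub>R B (B (B (br v 1 3))) - B (B (br v 2 3)) = 0"
    using assms by metis+
  \<comment> \<open>The two identities differ only in the sign of the second bracket, so their
    difference isolates it.\<close>
  from arg_cong2[OF e, of "(-)"] have "2 *\<^sub>R B (B (br v 2 3)) = 0" by (simp add: scaleR_2 algebra_simps)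
  then show z: "B (B (br v 2 3)) = 0" by simp
  show "B (B (B (br v 1 3))) = 0" using e(1) z by simp
qed

text \<open>No further bracket survives: an index of at least 4 gives zero, and
  \<open>[e_0, e_3]\<close>, \<open>B^2[e_1, e_3]\<close> and \<open>B[e_2, e_3]\<close> occur only
  in antisymmetric pairs that cancel.\<close>

lemma tor_E_zero:
  assumes "B (B (B (br v 1 2))) = 0" "B (B (B (br v 1 3))) = 0" "B (B (br v 2 3)) = 0"
    and "i < 4" "j < 4"
  shows "T (E v i) (E v j) = 0"
proof -
  have self: "br v i i = 0" for i by (simp add: br_def)
  have "i = 0 \<or> i = 1 \<or> i = 2 \<or> i = 3" "j = 0 \<or> j = 1 \<or> j = 2 \<or> j = 3"
    using assms(4,5) by auto
  then show ?thesis
    unfolding tor_E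
    using assms(1-3) br_swap[of v 0 3] br_swap[of v 1 2] br_swap[of v 1 3] br_swap[of v 2 3]
    by (elim disjE) (simp_all add: self br_zero scaleR_2 scaleR_3 algebra_simps numeral_eq_Suc)
qed

lemma nij_bilinear:
  "nij B D (v + v') w = nij B D v w + nij B D v' w" "nij B D (c *\<^sub>R v) w = c *\<^sub>R nij B D v w"
  "nij B D v (w + w') = nij B D v w + nij B D v w'" "nij B D v (c *\<^sub>R w) = c *\<^sub>R nij B D v w"
  by (simp_all add: nij_def algebra_simps)

lemma haa_bilinear:
  "haa B D (v + v') w = haa B D v w + haa B D v' w" "haa B D (c *\<^sub>R v) w = c *\<^sub>R haa B D v w"
  "haa B D v (w + w') = haa B D v w + haa B D v w'" "haa B D v (c *\<^sub>R w) = c *\<^sub>R haa B D v w"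
  by (simp_all add: haa_def nij_bilinear algebra_simps)

lemma tor_bilinear:
  "T (v + v') w = T v w + T v' w" "T (c *\<^sub>R v) w = c *\<^sub>R T v w"
  "T v (w + w') = T v w + T v w'" "T v (c *\<^sub>R w) = c *\<^sub>R T v w"
  by (simp_all add: tor_def haa_bilinear algebra_simps)

text \<open>Antisymmetrised and applied to fields annihilated by \<open>B\<^sup>k\<close>, the derivative of \<open>B\<^sup>k\<close> is
  \<open>- B\<^sup>k\<close> of the Lie bracket, so it measures the non-integrability of the kernel.\<close>

definition pd2 :: "'a \<Rightarrow> 'a \<Rightarrow> 'a" where
  "pd2 u w = D u (B w) + B (D u w)"

definition pd3 :: "'a \<Rightarrow> 'a \<Rightarrow> 'a" where
  "pd3 u w = D u (B (B w)) + B (D u (B w)) + B (B (D u w))"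

lemma pd_linear:
  "pd2 (v + v') w = pd2 v w + pd2 v' w" "pd2 (c *\<^sub>R v) w = c *\<^sub>R pd2 v w"
  "pd2 v (w + w') = pd2 v w + pd2 v w'" "pd2 v (c *\<^sub>R w) = c *\<^sub>R pd2 v w"
  "pd3 (v + v') w = pd3 v w + pd3 v' w" "pd3 (c *\<^sub>R v) w = c *\<^sub>R pd3 v w"
  "pd3 v (w + w') = pd3 v w + pd3 v w'" "pd3 v (c *\<^sub>R w) = c *\<^sub>R pd3 v w"
  by (simp_all add: pd2_def pd3_def algebra_simps)

lemma pd2_E: "pd2 (E v i) (E v j) - pd2 (E v j) (E v i) = - B (B (br v i j))" if "i \<ge> 2" "j \<ge> 2"
proof -
  have "pd2 u (E v j) = - B (B (DE v u j))" if "j \<ge> 2" for u j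
    using DE_zero[of "Suc (Suc j)" v u] that by (simp add: pd2_def B_E algebra_simps eq_neg_iff_add_eq_0)
  then show ?thesis using that by (simp add: br_def)
qed

lemma pd3_E: "pd3 (E v i) (E v j) - pd3 (E v j) (E v i) = - B (B (B (br v i j)))" if "i \<ge> 1" "j \<ge> 1"
proof -
  have "pd3 u (E v j) = - B (B (B (DE v u j)))" if "j \<ge> 1" for u j
    using DE_zero[of "Suc (Suc (Suc j))" v u] that
    by (simp add: pd3_def B_E algebra_simps eq_neg_iff_add_eq_0)
  then show ?thesis using that by (simp add: br_def)
qed

end

text \<open>\<open>v\<close> is a cyclic vector: its images under the powers of \<open>B\<close>
  span the space, as \<open>ker4\<close> shows.\<close>

locale regular_nilpotent_jet = nilpotent_jet +
  fixes v :: 'a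
  assumes ker: "\<And>w. B w = 0 \<Longrightarrow> \<exists>c. w = c *\<^sub>R B (B (B v))"
begin

lemma ker1: "B w = 0 \<Longrightarrow> \<exists>a. w = a *\<^sub>R E v 3"
  using ker by (simp add: E_def numeral_3_eq_3)

text \<open>\<open>B w\<close> lies in the previous kernel and is thus \<open>B\<close> of a
  combination of vectors \<open>E v i\<close>; subtracting that combination from \<open>w\<close>
  leaves an element of \<open>ker B\<close>. The next two kernels are treated alike.\<close>

lemma ker2: "B (B w) = 0 \<Longrightarrow> \<exists>a b. w = a *\<^sub>R E v 2 + b *\<^sub>R E v 3"
proof -
  assume "B (B w) = 0"
  then obtain a where a: "B w = a *\<^sub>R E v 3" using ker1 by blast
  have "B (w - a *\<^sub>R E v 2) = 0" by (simp add: a B_E numeral_eq_Suc)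
  then obtain b where "w - a *\<^sub>R E v 2 = b *\<^sub>R E v 3" using ker1 by blast
  then have "w = a *\<^sub>R E v 2 + b *\<^sub>R E v 3" by (simp add: algebra_simps)
  then show ?thesis by blast
qed

lemma ker3: "B (B (B w)) = 0 \<Longrightarrow> \<exists>a b c. w = a *\<^sub>R E v 1 + b *\<^sub>R E v 2 + c *\<^sub>R E v 3"
proof -
  assume "B (B (B w)) = 0"
  then obtain a b where a: "B w = a *\<^sub>R E v 2 + b *\<^sub>R E v 3" using ker2 by blast
  have "B (w - a *\<^sub>R E v 1 - b *\<^sub>R E v 2) = 0" by (simp add: a B_E numeral_eq_Suc)
  then obtain c where "w - a *\<^sub>R E v 1 - b *\<^sub>R E v 2 = c *\<^sub>R E v 3" using ker1 by blast
  then have "w = a *\<^sub>R E v 1 + b *\<^sub>R E v 2 + c *\<^sub>R E v 3" by (simp add: algebra_simps)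
  then show ?thesis by blast
qed

lemma ker4: "\<exists>a b c d. w = a *\<^sub>R E v 0 + b *\<^sub>R E v 1 + c *\<^sub>R E v 2 + d *\<^sub>R E v 3"
proof -
  obtain a b c where a: "B w = a *\<^sub>R E v 1 + b *\<^sub>R E v 2 + c *\<^sub>R E v 3" using ker3[OF nil] by blast
  have "B (w - a *\<^sub>R E v 0 - b *\<^sub>R E v 1 - c *\<^sub>R E v 2) = 0" by (simp add: a B_E numeral_eq_Suc)
  then obtain d where "w - a *\<^sub>R E v 0 - b *\<^sub>R E v 1 - c *\<^sub>R E v 2 = d *\<^sub>R E v 3" using ker1 by blast
  then have "w = a *\<^sub>R E v 0 + b *\<^sub>R E v 1 + c *\<^sub>R E v 2 + d *\<^sub>R E v 3" by (simp add: algebra_simps)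
  then show ?thesis by blast
qed

lemma tor_zeroI:
  assumes "B (B (B (br v 1 2))) = 0" "B (B (B (br v 1 3))) = 0" "B (B (br v 2 3)) = 0"
  shows "T x y = 0"
proof -
  note z = tor_E_zero[OF assms]
  obtain a b c d where x: "x = a *\<^sub>R E v 0 + b *\<^sub>R E v 1 + c *\<^sub>R E v 2 + d *\<^sub>R E v 3" using ker4 by blast
  obtain a' b' c' d' where y: "y = a' *\<^sub>R E v 0 + b' *\<^sub>R E v 1 + c' *\<^sub>R E v 2 + d' *\<^sub>R E v 3" using ker4 by blast
  show ?thesis unfolding x y by (simp add: tor_bilinear z)
qed

text \<open>The antisymmetric part of \<open>pd2\<close> is bilinear, so on \<open>ker B^2\<close>
  it is determined by the single pair \<open>E v 2\<close>, \<open>E v 3\<close>.\<close>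

lemma ker2_integrable:
  assumes T: "\<And>v w. T v w = 0" and "B (B x) = 0" "B (B y) = 0"
  shows "pd2 x y = pd2 y x"
proof -
  obtain a b where x: "x = a *\<^sub>R E v 2 + b *\<^sub>R E v 3" using ker2[OF assms(2)] by blast
  obtain a' b' where y: "y = a' *\<^sub>R E v 2 + b' *\<^sub>R E v 3" using ker2[OF assms(3)] by blast
  have "pd2 (E v 2) (E v 3) = pd2 (E v 3) (E v 2)"
    using pd2_E[of 2 3 v] tor_zero_imp(3)[OF T] by simp
  then show ?thesis unfolding x y by (simp add: pd_linear algebra_simps)
qed

lemma ker3_integrable:
  assumes T: "\<And>v w. T v w = 0" and "B (B (B x)) = 0" "B (B (B y)) = 0"
  shows "pd3 x y = pd3 y x"
proof -
  obtain a b c where x: "x = a *\<^sub>R E v 1 + b *\<^sub>R E v 2 + c *\<^sub>R E v 3" using ker3[OF assms(2)] by blast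
  obtain a' b' c' where y: "y = a' *\<^sub>R E v 1 + b' *\<^sub>R E v 2 + c' *\<^sub>R E v 3" using ker3[OF assms(3)] by blast
  \<comment> \<open>For the third pair, \<open>B^3\<close> of the bracket vanishes because
    \<open>B^2\<close> of it does.\<close>
  have "pd3 (E v 1) (E v 2) = pd3 (E v 2) (E v 1)" "pd3 (E v 1) (E v 3) = pd3 (E v 3) (E v 1)"
    "pd3 (E v 2) (E v 3) = pd3 (E v 3) (E v 2)"
    using pd3_E[of 1 2 v] pd3_E[of 1 3 v] pd3_E[of 2 3 v] tor_zero_imp[OF T] by simp_all
  then show ?thesis unfolding x y by (simp add: pd_linear algebra_simps)
qed

end

section \<open>Symmetry of second derivatives\<close>

lemma frechet_derivativeI: "(f has_derivative f') (at x) \<Longrightarrow> frechet_derivative f (at x) = f'"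
  by (rule frechet_derivative_at[symmetric])

lemma frechet_derivative_eqI: "(f has_derivative f') (at x) \<Longrightarrow> frechet_derivative f (at x) v = f' v"
  by (simp add: frechet_derivativeI)

lemma line_has_derivative:
  fixes f :: "'a::real_normed_vector \<Rightarrow> real"
  assumes "smooth_on U f" "y + s *\<^sub>R u \<in> U"
  shows "((\<lambda>s. f (y + s *\<^sub>R u)) has_real_derivative frechet_derivative f (at (y + s *\<^sub>R u)) u) (at s)"
proof -
  have f: "(f has_derivative frechet_derivative f (at (y + s *\<^sub>R u))) (at (y + s *\<^sub>R u))"
    by (rule smooth_on_has_derivative[OF assms])
  have "((\<lambda>s. y + s *\<^sub>R u) has_derivative (\<lambda>t. t *\<^sub>R u)) (at s)"
    by (auto intro!: derivative_eq_intros)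
  from has_derivative_compose[OF this f] show ?thesis
    by (simp add: has_field_derivative_def linear_scale[OF has_derivative_linear[OF f]] mult.commute[of _ "_ :: real"] mult_commute_abs)
qed

text \<open>The mean value theorem is applied twice: in direction \<open>u\<close> to the difference
  of \<open>f\<close> along two parallel segments, then in direction \<open>v\<close>.\<close>

lemma second_difference:
  fixes f :: "'a::real_normed_vector \<Rightarrow> real"
  assumes sm: "smooth_on U f" and h: "h > 0"
    and U: "\<And>s t. s \<in> {0..h} \<Longrightarrow> t \<in> {0..h} \<Longrightarrow> x + s *\<^sub>R u + t *\<^sub>R v \<in> U"
  obtains s t where "s \<in> {0..h}" "t \<in> {0..h}"
    "f (x + h *\<^sub>R u + h *\<^sub>R v) - f (x + h *\<^sub>R u) - f (x + h *\<^sub>R v) + f x =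
      h * h * frechet_derivative (\<lambda>y. frechet_derivative f (at y) u) (at (x + s *\<^sub>R u + t *\<^sub>R v)) v"
proof -
  let ?Du = "\<lambda>y. frechet_derivative f (at y) u"
  define g where "g s = f (x + h *\<^sub>R v + s *\<^sub>R u) - f (x + s *\<^sub>R u)" for s
  have "\<exists>z>0. z < h \<and> g h - g 0 = (h - 0) * (?Du (x + h *\<^sub>R v + z *\<^sub>R u) - ?Du (x + z *\<^sub>R u))"
  proof (rule MVT2[OF h])
    fix s assume "0 \<le> s" "s \<le> h"
    then show "(g has_real_derivative ?Du (x + h *\<^sub>R v + s *\<^sub>R u) - ?Du (x + s *\<^sub>R u)) (at s)"
      unfolding g_def using U[of s h] U[of s 0] h
      by (intro DERIV_diff line_has_derivative[OF sm]) (auto simp: ac_simps)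
  qed
  then obtain s where s: "0 < s" "s < h"
    "g h - g 0 = h * (?Du (x + h *\<^sub>R v + s *\<^sub>R u) - ?Du (x + s *\<^sub>R u))" by auto
  have "\<exists>z>0. z < h \<and> ?Du (x + s *\<^sub>R u + h *\<^sub>R v) - ?Du (x + s *\<^sub>R u + 0 *\<^sub>R v)
      = (h - 0) * frechet_derivative ?Du (at (x + s *\<^sub>R u + z *\<^sub>R v)) v"
  proof (rule MVT2[OF h])
    fix t assume "0 \<le> t" "t \<le> h"
    then show "((\<lambda>t. ?Du (x + s *\<^sub>R u + t *\<^sub>R v)) has_real_derivative
        frechet_derivative ?Du (at (x + s *\<^sub>R u + t *\<^sub>R v)) v) (at t)"
      using U[of s t] s by (intro line_has_derivative[OF smooth_on_derivative[OF sm]]) auto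
  qed
  then obtain t where t: "0 < t" "t < h" "?Du (x + s *\<^sub>R u + h *\<^sub>R v) - ?Du (x + s *\<^sub>R u)
      = h * frechet_derivative ?Du (at (x + s *\<^sub>R u + t *\<^sub>R v)) v" by auto
  have "x + h *\<^sub>R v + s *\<^sub>R u = x + s *\<^sub>R u + h *\<^sub>R v" "x + h *\<^sub>R v + h *\<^sub>R u = x + h *\<^sub>R u + h *\<^sub>R v"
    by (simp_all add: algebra_simps)
  with s(3) t(3) have "f (x + h *\<^sub>R u + h *\<^sub>R v) - f (x + h *\<^sub>R u) - f (x + h *\<^sub>R v) + f x =
      h * h * frechet_derivative ?Du (at (x + s *\<^sub>R u + t *\<^sub>R v)) v"
    by (simp add: g_def algebra_simps)
  then show ?thesis using s(1,2) t(1,2) by (intro that[of s t]) auto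
qed

text \<open>The second difference is symmetric in \<open>u\<close> and \<open>v\<close>, so the two
  mixed derivatives take a common value at points near \<open>x\<close>. By continuity their values
  at \<open>x\<close> differ by less than \<open>2 * e\<close>, the assumed gap.\<close>

lemma second_derivative_symmetric_real:
  fixes f :: "'a::real_normed_vector \<Rightarrow> real"
  assumes "open U" "x \<in> U" and sm: "smooth_on U f"
  shows "frechet_derivative (\<lambda>y. frechet_derivative f (at y) u) (at x) v =
    frechet_derivative (\<lambda>y. frechet_derivative f (at y) v) (at x) u" (is "?F u v x = ?F v u x")
proof (rule ccontr)
  assume ne: "?F u v x \<noteq> ?F v u x"
  define e where "e = \<bar>?F u v x - ?F v u x\<bar> / 2"
  have e: "e > 0" using ne by (simp add: e_def)
  have cont: "isCont (\<lambda>x. ?F a b x) x" for a b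
    by (rule bspec[OF iffD1[OF continuous_on_eq_continuous_at[OF assms(1)]
          smooth_on_imp_continuous_on[OF smooth_on_derivative[OF smooth_on_derivative[OF sm]]]] assms(2)])
  obtain d1 d2 where d1: "d1 > 0" "\<And>y. dist y x < d1 \<Longrightarrow> dist (?F u v y) (?F u v x) < e"
    and d2: "d2 > 0" "\<And>y. dist y x < d2 \<Longrightarrow> dist (?F v u y) (?F v u x) < e"
    using cont[of u v, unfolded continuous_at_eps_delta, rule_format, OF e]
      cont[of v u, unfolded continuous_at_eps_delta, rule_format, OF e] by blast
  obtain d3 where d3: "d3 > 0" "ball x d3 \<subseteq> U" using assms(1,2) open_contains_ball by blast
  define d where "d = min d1 (min d2 d3)"
  have d: "d > 0" using d1 d2 d3 by (simp add: d_def)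
  \<comment> \<open>Small enough that the parallelogram spanned by \<open>h u\<close> and
    \<open>h v\<close> stays within \<open>d\<close> of \<open>x\<close>; the summand 1 covers
    \<open>u = v = 0\<close>.\<close>
  define h where "h = d / (2 * (norm u + norm v + 1))"
  have h: "h > 0" using d by (auto simp: h_def intro!: divide_pos_pos add_nonneg_pos)
  have h2: "h * (norm u + norm v) < d"
  proof -
    have "h * (norm u + norm v) \<le> h * (norm u + norm v + 1)" using h by simp
    also have "\<dots> = d / 2"
    proof -
      have "norm u + norm v + 1 \<noteq> 0" by (smt (verit) norm_ge_zero)
      then show ?thesis by (simp add: h_def field_simps)
    qed
    finally show ?thesis using d by simp
  qed
  have near: "dist (x + s *\<^sub>R a + t *\<^sub>R b) x < d"
    if "s \<in> {0..h}" "t \<in> {0..h}" "norm a + norm b = norm u + norm v" for s t a b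
  proof -
    have "dist (x + s *\<^sub>R a + t *\<^sub>R b) x = norm (s *\<^sub>R a + t *\<^sub>R b)" by (simp add: dist_norm algebra_simps)
    also have "\<dots> \<le> s * norm a + t * norm b"
      using norm_triangle_ineq[of "s *\<^sub>R a" "t *\<^sub>R b"] that by simp
    also have "\<dots> \<le> h * norm a + h * norm b" using that by (intro add_mono mult_right_mono) auto
    also have "\<dots> < d" using h2 that(3) by (simp add: distrib_left[symmetric])
    finally show ?thesis .
  qed
  have "x + s *\<^sub>R u + t *\<^sub>R v \<in> U" "x + s *\<^sub>R v + t *\<^sub>R u \<in> U" if "s \<in> {0..h}" "t \<in> {0..h}" for s t
    using near[OF that, of u v] near[OF that, of v u] d3 by (auto simp: d_def dist_commute subset_iff)
  note U = this
  obtain s t where st: "s \<in> {0..h}" "t \<in> {0..h}"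
    "f (x + h *\<^sub>R u + h *\<^sub>R v) - f (x + h *\<^sub>R u) - f (x + h *\<^sub>R v) + f x = h * h * ?F u v (x + s *\<^sub>R u + t *\<^sub>R v)"
    by (rule second_difference[OF sm h]) (erule (1) U(1), rule that)
  obtain s' t' where st': "s' \<in> {0..h}" "t' \<in> {0..h}"
    "f (x + h *\<^sub>R v + h *\<^sub>R u) - f (x + h *\<^sub>R v) - f (x + h *\<^sub>R u) + f x = h * h * ?F v u (x + s' *\<^sub>R v + t' *\<^sub>R u)"
    by (rule second_difference[OF sm h]) (erule (1) U(2), rule that)
  have "f (x + h *\<^sub>R u + h *\<^sub>R v) = f (x + h *\<^sub>R v + h *\<^sub>R u)" by (simp add: ac_simps)
  then have "h * h * ?F u v (x + s *\<^sub>R u + t *\<^sub>R v) = h * h * ?F v u (x + s' *\<^sub>R v + t' *\<^sub>R u)"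
    using st(3) st'(3) by linarith
  then have eq: "?F u v (x + s *\<^sub>R u + t *\<^sub>R v) = ?F v u (x + s' *\<^sub>R v + t' *\<^sub>R u)" using h by simp
  have 1: "dist (?F u v (x + s *\<^sub>R u + t *\<^sub>R v)) (?F u v x) < e"
    using d1(2) near[OF st(1,2), of u v] by (simp add: d_def)
  have 2: "dist (?F v u (x + s' *\<^sub>R v + t' *\<^sub>R u)) (?F v u x) < e"
    using d2(2) near[OF st'(1,2), of v u] by (simp add: d_def)
  have "dist (?F u v x) (?F v u x) < e + e"
    by (rule dist_triangle_less_add[OF 1[unfolded eq, THEN ord_eq_less_trans[OF dist_commute]]
          2[THEN ord_eq_less_trans[OF dist_commute]]])
  then show False by (simp add: e_def dist_real_def)
qed

lemma frechet_derivative_bounded_linear: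
  assumes "bounded_linear L" "f differentiable (at x)"
  shows "frechet_derivative (\<lambda>y. L (f y)) (at x) v = L (frechet_derivative f (at x) v)"
  by (rule frechet_derivative_eqI[OF bounded_linear.has_derivative[OF assms(1)]])
    (use assms(2) frechet_derivative_works in blast)

lemma smooth_on_differentiable: "smooth_on U f \<Longrightarrow> x \<in> U \<Longrightarrow> f differentiable (at x)"
  using smooth_on_has_derivative differentiableI by blast

lemma second_derivative_symmetric:
  fixes f :: "'a::real_normed_vector \<Rightarrow> 'b::euclidean_space"
  assumes U: "open U" "x \<in> U" and sm: "smooth_on U f"
  shows "frechet_derivative (\<lambda>y. frechet_derivative f (at y) u) (at x) v =
    frechet_derivative (\<lambda>y. frechet_derivative f (at y) v) (at x) u"
proof (rule euclidean_eqI)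
  fix b :: 'b
  have fb: "smooth_on U (\<lambda>y. f y \<bullet> b)"
    by (rule smooth_on_bounded_linear[OF U(1) bounded_linear_inner_left sm])
  have eq: "frechet_derivative (\<lambda>y. frechet_derivative (\<lambda>y. f y \<bullet> b) (at y) u) (at x) v
      = frechet_derivative (\<lambda>y. frechet_derivative f (at y) u) (at x) v \<bullet> b" for u v
  proof -
    have d: "(\<lambda>y. frechet_derivative f (at y) u) differentiable (at x)"
      by (rule smooth_on_differentiable[OF smooth_on_derivative[OF sm] U(2)])
    have "((\<lambda>y. frechet_derivative f (at y) u \<bullet> b) has_derivative
        (\<lambda>v. frechet_derivative (\<lambda>y. frechet_derivative f (at y) u) (at x) v \<bullet> b)) (at x)"
      by (rule bounded_linear.has_derivative[OF bounded_linear_inner_left])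
        (use d frechet_derivative_works in blast)
    then have "((\<lambda>y. frechet_derivative (\<lambda>y. f y \<bullet> b) (at y) u) has_derivative
        (\<lambda>v. frechet_derivative (\<lambda>y. frechet_derivative f (at y) u) (at x) v \<bullet> b)) (at x)"
      by (rule has_derivative_transform_within_open[OF _ U])
        (simp add: frechet_derivative_bounded_linear[OF bounded_linear_inner_left smooth_on_differentiable[OF sm]])
    then show ?thesis by (rule frechet_derivative_eqI)
  qed
  show "frechet_derivative (\<lambda>y. frechet_derivative f (at y) u) (at x) v \<bullet> b =
      frechet_derivative (\<lambda>y. frechet_derivative f (at y) v) (at x) u \<bullet> b"
    using second_derivative_symmetric_real[OF U fb, of u v] unfolding eq .
qed

section \<open>Charts, tangent vectors and operator fields\<close>

locale manifold =
  fixes M :: "'a topology" and S :: "('a, 'n::finite) chart set"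
  assumes manifold: "smooth_manifold M S"
begin

abbreviation img :: "('a, 'n) chart \<Rightarrow> (real^'n) set" where
  "img c \<equiv> snd c ` fst c"

lemma chart_on: "c \<in> S \<Longrightarrow> chart_on M c"
  and compat: "c \<in> S \<Longrightarrow> d \<in> S \<Longrightarrow> compatible c d"
  and maximal: "chart_on M c \<Longrightarrow> \<forall>d\<in>S. compatible c d \<Longrightarrow> c \<in> S"
  and covered: "p \<in> topspace M \<Longrightarrow> \<exists>c\<in>S. p \<in> fst c"
proof -
  note m = manifold[unfolded smooth_manifold_def, THEN conjunct2, THEN conjunct2]
  show "c \<in> S \<Longrightarrow> chart_on M c" using m by (elim conjE) (rule bspec)
  show "c \<in> S \<Longrightarrow> d \<in> S \<Longrightarrow> compatible c d" using m by (elim conjE) (drule (1) bspec, rule bspec)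
  show "chart_on M c \<Longrightarrow> \<forall>d\<in>S. compatible c d \<Longrightarrow> c \<in> S" using m by metis
  show "p \<in> topspace M \<Longrightarrow> \<exists>c\<in>S. p \<in> fst c" using m by (metis UN_E)
qed

lemma chart_domain: "c \<in> S \<Longrightarrow> openin M (fst c)"
  and open_img: "c \<in> S \<Longrightarrow> open (img c)"
  and chart_homeo: "c \<in> S \<Longrightarrow> homeomorphic_map (subtopology M (fst c)) (top_of_set (img c)) (snd c)"
  using chart_on by (auto simp: chart_on_def)

lemma chart_subset: "c \<in> S \<Longrightarrow> fst c \<subseteq> topspace M"
  using chart_domain openin_subset by blast

lemma chart_inj: "c \<in> S \<Longrightarrow> inj_on (snd c) (fst c)"
  using homeomorphic_imp_injective_map[OF chart_homeo, of c] chart_subset[of c]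
  by (simp add: inf.absorb2)

lemma chart_inv_left [simp]: "c \<in> S \<Longrightarrow> p \<in> fst c \<Longrightarrow> chart_inv c (snd c p) = p"
  by (simp add: chart_inv_def chart_inj)

lemma chart_inv_right: "x \<in> img c \<Longrightarrow> snd c (chart_inv c x) = x"
  and chart_inv_in: "x \<in> img c \<Longrightarrow> chart_inv c x \<in> fst c"
  by (simp_all add: chart_inv_def f_inv_into_f inv_into_into)

lemma chart_open_image:
  assumes "c \<in> S" "openin M W" "W \<subseteq> fst c"
  shows "open (snd c ` W)"
proof -
  have "openin (subtopology M (fst c)) W"
    using assms(2,3) by (simp add: openin_open_subtopology[OF chart_domain[OF assms(1)]])
  then have "openin (top_of_set (img c)) (snd c ` W)"
    using homeomorphic_imp_open_map[OF chart_homeo[OF assms(1)]] by (simp add: open_map_def)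
  then show ?thesis by (rule openin_open_trans[OF _ open_img[OF assms(1)]])
qed

lemma open_overlap:
  assumes "c \<in> S" "openin M W"
  shows "open (snd c ` (fst c \<inter> W))"
  using assms chart_domain by (intro chart_open_image openin_Int) auto

lemma chart_open_preimage:
  assumes "c \<in> S" "open V"
  shows "openin M {p \<in> fst c. snd c p \<in> V}"
proof -
  have "continuous_map (subtopology M (fst c)) (top_of_set (img c)) (snd c)"
    by (rule homeomorphic_imp_continuous_map[OF chart_homeo[OF assms(1)]])
  moreover have "openin (top_of_set (img c)) (img c \<inter> V)" by (rule openin_open_Int[OF assms(2)])
  ultimately have "openin (subtopology M (fst c)) {p \<in> topspace (subtopology M (fst c)). snd c p \<in> img c \<inter> V}"
    by (rule openin_continuous_map_preimage)
  moreover have "{p \<in> topspace (subtopology M (fst c)). snd c p \<in> img c \<inter> V} = {p \<in> fst c. snd c p \<in> V}"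
    using chart_subset[OF assms(1)] by auto
  ultimately show ?thesis by (simp add: openin_open_subtopology[OF chart_domain[OF assms(1)]])
qed

lemma transition_apply [simp]: "c \<in> S \<Longrightarrow> p \<in> fst c \<Longrightarrow> transition c d (snd c p) = snd d p"
  by (simp add: transition_def)

lemma smooth_transition: "c \<in> S \<Longrightarrow> d \<in> S \<Longrightarrow> smooth_on (snd c ` (fst c \<inter> fst d)) (transition c d)"
  using compat by (simp add: compatible_def)

section \<open>Jacobi matrices, tangent vectors and vector fields\<close>

definition jac :: "('a, 'n) chart \<Rightarrow> ('a, 'n) chart \<Rightarrow> 'a \<Rightarrow> real^'n \<Rightarrow> real^'n" where
  "jac c d p = frechet_derivative (transition c d) (at (snd c p))"

lemma transition_has_derivative:
  assumes "c \<in> S" "d \<in> S" "p \<in> fst c" "p \<in> fst d"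
  shows "(transition c d has_derivative jac c d p) (at (snd c p))"
  unfolding jac_def by (rule smooth_on_has_derivative[OF smooth_transition[OF assms(1,2)]]) (use assms in auto)

lemma linear_jac:
  assumes "c \<in> S" "d \<in> S" "p \<in> fst c" "p \<in> fst d"
  shows "linear (jac c d p)"
  by (rule has_derivative_linear[OF transition_has_derivative[OF assms]])

lemma jac_cocycle:
  assumes "c \<in> S" "d \<in> S" "e \<in> S" "p \<in> fst c" "p \<in> fst d" "p \<in> fst e"
  shows "jac d e p (jac c d p v) = jac c e p v"
proof -
  have "((\<lambda>x. transition d e (transition c d x)) has_derivative (\<lambda>v. jac d e p (jac c d p v))) (at (snd c p))"
    using has_derivative_compose[OF transition_has_derivative[OF assms(1,2,4,5)], of "transition d e" "jac d e p"]
      transition_has_derivative[OF assms(2,3,5,6)] assms by simp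
  then have "(transition c e has_derivative (\<lambda>v. jac d e p (jac c d p v))) (at (snd c p))"
  proof (rule has_derivative_transform_within_open)
    show "open (snd c ` (fst c \<inter> fst d))" by (rule open_overlap[OF assms(1) chart_domain[OF assms(2)]])
  qed (use assms in auto)
  from frechet_derivative_eqI[OF this] show ?thesis by (simp add: jac_def)
qed

lemma jac_self:
  assumes "c \<in> S" "p \<in> fst c"
  shows "jac c c p v = v"
proof -
  have "((\<lambda>x. x) has_derivative (\<lambda>v. v)) (at (snd c p))" by (rule has_derivative_ident)
  then have "(transition c c has_derivative (\<lambda>v. v)) (at (snd c p))"
    by (rule has_derivative_transform_within_open[OF _ open_img[OF assms(1)]]) (use assms in auto)
  from frechet_derivative_eqI[OF this] show ?thesis by (simp add: jac_def)
qed

lemma jac_inverse: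
  assumes "c \<in> S" "d \<in> S" "p \<in> fst c" "p \<in> fst d"
  shows "jac d c p (jac c d p v) = v"
  using jac_cocycle[OF assms(1,2,1,3,4,3)] jac_self[OF assms(1,3)] by simp

text \<open>For fixed \<open>v\<close> and varying \<open>p\<close> this is the field with constant
  coefficients \<open>v\<close> in the chart \<open>c\<close>, used to evaluate tensors on arbitrary
  vectors.\<close>

definition tangent_of :: "('a, 'n) chart \<Rightarrow> 'a \<Rightarrow> real^'n \<Rightarrow> ('a, 'n) tvec" where
  "tangent_of c p v = (\<lambda>d. if d \<in> S \<and> p \<in> fst c \<inter> fst d then jac c d p v else 0)"

lemma tangent_spaceI:
  assumes "\<And>c. \<not> (c \<in> S \<and> p \<in> fst c) \<Longrightarrow> v c = 0"
    and "\<And>c d. c \<in> S \<Longrightarrow> d \<in> S \<Longrightarrow> p \<in> fst c \<Longrightarrow> p \<in> fst d \<Longrightarrow> v d = jac c d p (v c)"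
  shows "v \<in> tangent_space S p"
  unfolding tangent_space_def jac_def[symmetric] mem_Collect_eq using assms by (meson IntD1 IntD2)

lemma tangent_outside: "v \<in> tangent_space S p \<Longrightarrow> \<not> (c \<in> S \<and> p \<in> fst c) \<Longrightarrow> v c = 0"
  unfolding tangent_space_def mem_Collect_eq by blast

lemma tangent_jac:
  "v \<in> tangent_space S p \<Longrightarrow> c \<in> S \<Longrightarrow> d \<in> S \<Longrightarrow> p \<in> fst c \<Longrightarrow> p \<in> fst d \<Longrightarrow> v d = jac c d p (v c)"
  unfolding tangent_space_def jac_def[symmetric] mem_Collect_eq by (meson IntI)

lemma tangent_of_in: "c \<in> S \<Longrightarrow> p \<in> fst c \<Longrightarrow> tangent_of c p v \<in> tangent_space S p"
  by (rule tangent_spaceI) (auto simp: tangent_of_def jac_cocycle)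

lemma tangent_of_self: "c \<in> S \<Longrightarrow> p \<in> fst c \<Longrightarrow> tangent_of c p v c = v"
  by (simp add: tangent_of_def jac_self)

lemma tangent_of_eq: "v \<in> tangent_space S p \<Longrightarrow> c \<in> S \<Longrightarrow> p \<in> fst c \<Longrightarrow> tangent_of c p (v c) = v"
  by (rule ext) (simp add: tangent_of_def tangent_jac[symmetric] tangent_outside)

lemma coord_field_eq: "coord_field S c j p = tangent_of c p (axis j 1)"
  by (auto simp: coord_field_def tangent_of_def jac_def)

lemma tangent_space_lincomb:
  assumes "v \<in> tangent_space S p" "w \<in> tangent_space S p"
  shows "(\<lambda>c. a *\<^sub>R v c + b *\<^sub>R w c) \<in> tangent_space S p"
proof (rule tangent_spaceI)
  fix c d assume cd: "c \<in> S" "d \<in> S" "p \<in> fst c" "p \<in> fst d"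
  show "a *\<^sub>R v d + b *\<^sub>R w d = jac c d p (a *\<^sub>R v c + b *\<^sub>R w c)"
    unfolding tangent_jac[OF assms(1) cd] tangent_jac[OF assms(2) cd]
    by (simp add: linear_add[OF linear_jac[OF cd]] linear_scale[OF linear_jac[OF cd]])
qed (simp add: tangent_outside[OF assms(1)] tangent_outside[OF assms(2)])

lemma tangent_space_add: "v \<in> tangent_space S p \<Longrightarrow> w \<in> tangent_space S p \<Longrightarrow> v + w \<in> tangent_space S p"
  and tangent_space_diff: "v \<in> tangent_space S p \<Longrightarrow> w \<in> tangent_space S p \<Longrightarrow> v - w \<in> tangent_space S p"
  using tangent_space_lincomb[of v p w 1 1] tangent_space_lincomb[of v p w 1 "-1"]
  by (simp_all add: plus_fun_def fun_diff_def)

lemma bij_tangent: "c \<in> S \<Longrightarrow> p \<in> fst c \<Longrightarrow> bij_betw (\<lambda>v. v c) (tangent_space S p) UNIV"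
  by (rule bij_betw_byWitness[where f' = "tangent_of c p"])
    (auto simp: tangent_of_in tangent_of_self tangent_of_eq)

text \<open>Differentiability is the right regularity: \<open>op_apply\<close> preserves it, and the
  torsions are built from brackets of such fields without ever differentiating a bracket.\<close>

definition vfield_on :: "'a set \<Rightarrow> ('a, 'n) vfield \<Rightarrow> bool" where
  "vfield_on W \<xi> \<longleftrightarrow> openin M W \<and> (\<forall>p\<in>W. \<xi> p \<in> tangent_space S p \<and>
     (\<forall>d\<in>S. p \<in> fst d \<longrightarrow> (\<lambda>x. \<xi> (chart_inv d x) d) differentiable (at (snd d p))))"

lemma vfield_onD:
  assumes "vfield_on W \<xi>" "p \<in> W"
  shows "openin M W" "\<xi> p \<in> tangent_space S p"
    "d \<in> S \<Longrightarrow> p \<in> fst d \<Longrightarrow> ((\<lambda>x. \<xi> (chart_inv d x) d) has_derivative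
      frechet_derivative (\<lambda>x. \<xi> (chart_inv d x) d) (at (snd d p))) (at (snd d p))"
  using assms by (auto simp: vfield_on_def frechet_derivative_works[symmetric])

lemma vfield_tangent_of:
  assumes c: "c \<in> S"
  shows "vfield_on (fst c) (\<lambda>p. tangent_of c p v)"
  unfolding vfield_on_def
proof (intro conjI ballI impI)
  show "openin M (fst c)" by (rule chart_domain[OF c])
  fix p assume p: "p \<in> fst c"
  show "tangent_of c p v \<in> tangent_space S p" by (rule tangent_of_in[OF c p])
  fix d assume d: "d \<in> S" "p \<in> fst d"
  let ?O = "snd d ` (fst d \<inter> fst c)"
  have O: "open ?O" by (rule open_overlap[OF d(1) chart_domain[OF c]])
  have "smooth_on ?O (\<lambda>x. frechet_derivative (transition c d) (at (transition d c x)) v)"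
  proof (rule smooth_on_compose[OF O, where f = "transition d c"
        and g = "\<lambda>x. frechet_derivative (transition c d) (at x) v"])
    show "open (snd c ` (fst c \<inter> fst d))" by (rule open_overlap[OF c chart_domain[OF d(1)]])
    show "smooth_on ?O (transition d c)" by (rule smooth_transition[OF d(1) c])
    show "smooth_on (snd c ` (fst c \<inter> fst d)) (\<lambda>x. frechet_derivative (transition c d) (at x) v)"
      by (rule smooth_on_derivative[OF smooth_transition[OF c d(1)]])
    show "transition d c ` ?O \<subseteq> snd c ` (fst c \<inter> fst d)"
    proof (rule image_subsetI)
      fix x assume "x \<in> ?O"
      then obtain q where "q \<in> fst d" "q \<in> fst c" "x = snd d q" by blast
      then show "transition d c x \<in> snd c ` (fst c \<inter> fst d)" using d(1) by simp
    qed
  qed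
  then have "smooth_on ?O (\<lambda>x. tangent_of c (chart_inv d x) v d)"
  proof (rule smooth_on_cong[OF O, rotated])
    fix x assume "x \<in> ?O"
    then obtain q where "q \<in> fst d" "q \<in> fst c" "x = snd d q" by blast
    then show "frechet_derivative (transition c d) (at (transition d c x)) v
        = tangent_of c (chart_inv d x) v d"
      using c d(1) by (simp add: tangent_of_def jac_def)
  qed
  then show "(\<lambda>x. tangent_of c (chart_inv d x) v d) differentiable (at (snd d p))"
    by (rule smooth_on_differentiable) (use p d in auto)
qed

text \<open>The symmetry of the second derivative of the transition map makes the second order terms in the
  transformation of the bracket cancel.\<close>

lemma vfield_transform_derivative:
  assumes \<eta>: "vfield_on W \<eta>" and p: "p \<in> W" "c \<in> S" "d \<in> S" "p \<in> fst c" "p \<in> fst d"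
  shows "frechet_derivative (\<lambda>y. \<eta> (chart_inv d y) d) (at (snd d p)) (jac c d p u) =
    jac c d p (frechet_derivative (\<lambda>x. \<eta> (chart_inv c x) c) (at (snd c p)) u)
    + (\<Sum>i\<in>Basis. (\<eta> p c \<bullet> i) *\<^sub>R
        frechet_derivative (\<lambda>x. frechet_derivative (transition c d) (at x) i) (at (snd c p)) u)"
proof -
  let ?\<eta>c = "\<lambda>x. \<eta> (chart_inv c x) c" and ?\<eta>d = "\<lambda>x. \<eta> (chart_inv d x) d" and ?\<phi> = "transition c d"
  let ?x = "snd c p"
  let ?O = "snd c ` (fst c \<inter> (fst d \<inter> W))"
  note W = vfield_onD(1)[OF \<eta> p(1)]
  have O: "open ?O" "?x \<in> ?O"
    using open_overlap[OF p(2) openin_Int[OF chart_domain[OF p(3)] W]] p by auto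
  have \<eta>c: "(?\<eta>c has_derivative frechet_derivative ?\<eta>c (at ?x)) (at ?x)"
    and \<eta>d: "(?\<eta>d has_derivative frechet_derivative ?\<eta>d (at (snd d p))) (at (snd d p))"
    by (rule vfield_onD(3)[OF \<eta> p(1,2,4)] vfield_onD(3)[OF \<eta> p(1,3,5)])+
  have "((\<lambda>x. ?\<eta>d (?\<phi> x)) has_derivative (\<lambda>u. frechet_derivative ?\<eta>d (at (snd d p)) (jac c d p u))) (at ?x)"
    using has_derivative_compose[OF transition_has_derivative[OF p(2-5)], of ?\<eta>d] \<eta>d p by simp
  then have 1: "((\<lambda>x. \<Sum>i\<in>Basis. (?\<eta>c x \<bullet> i) *\<^sub>R frechet_derivative ?\<phi> (at x) i) has_derivative
      (\<lambda>u. frechet_derivative ?\<eta>d (at (snd d p)) (jac c d p u))) (at ?x)"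
  proof (rule has_derivative_transform_within_open[OF _ O])
    fix x assume "x \<in> ?O"
    then obtain q where q: "q \<in> fst c" "q \<in> fst d" "q \<in> W" "x = snd c q" by auto
    have "\<eta> q d = jac c d q (\<eta> q c)"
      by (rule tangent_jac[OF vfield_onD(2)[OF \<eta> q(3)] p(2,3) q(1,2)])
    then show "?\<eta>d (?\<phi> x) = (\<Sum>i\<in>Basis. (?\<eta>c x \<bullet> i) *\<^sub>R frechet_derivative ?\<phi> (at x) i)"
      using linear_euclidean_expand[OF linear_jac[OF p(2,3) q(1,2)], of "\<eta> q c"] p(2,3) q by (simp add: jac_def)
  qed
  have dd: "((\<lambda>x. frechet_derivative ?\<phi> (at x) i) has_derivative
      frechet_derivative (\<lambda>x. frechet_derivative ?\<phi> (at x) i) (at ?x)) (at ?x)" for i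
    by (rule smooth_on_has_derivative[OF smooth_on_derivative[OF smooth_transition[OF p(2,3)]]]) (use p in auto)
  have "((\<lambda>x. \<Sum>i\<in>Basis. (?\<eta>c x \<bullet> i) *\<^sub>R frechet_derivative ?\<phi> (at x) i) has_derivative
      (\<lambda>u. \<Sum>i\<in>Basis. (?\<eta>c ?x \<bullet> i) *\<^sub>R frechet_derivative (\<lambda>x. frechet_derivative ?\<phi> (at x) i) (at ?x) u
        + (frechet_derivative ?\<eta>c (at ?x) u \<bullet> i) *\<^sub>R frechet_derivative ?\<phi> (at ?x) i)) (at ?x)"
    by (rule has_derivative_sum, rule has_derivative_scaleR[OF has_derivative_inner_left[OF \<eta>c] dd])
  from has_derivative_unique[OF 1 this] have
    "frechet_derivative ?\<eta>d (at (snd d p)) (jac c d p u) =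
      (\<Sum>i\<in>Basis. (?\<eta>c ?x \<bullet> i) *\<^sub>R frechet_derivative (\<lambda>x. frechet_derivative ?\<phi> (at x) i) (at ?x) u
        + (frechet_derivative ?\<eta>c (at ?x) u \<bullet> i) *\<^sub>R frechet_derivative ?\<phi> (at ?x) i)"
    by (rule fun_cong)
  then show ?thesis
    unfolding linear_euclidean_expand[OF linear_jac[OF p(2-5)], of "frechet_derivative ?\<eta>c (at ?x) u"] sum.distrib
    unfolding jac_def chart_inv_left[OF p(2,4)] by (simp only: add.commute)
qed

text \<open>In the torsions \<open>L\<close> is applied to brackets, and \<open>L_matrix\<close>
  computes \<open>L\<close> on genuine tangent vectors only.\<close>

lemma lie_bracket_tangent:
  assumes \<xi>: "vfield_on W \<xi>" and \<eta>: "vfield_on W \<eta>" and p: "p \<in> W"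
  shows "lie_bracket S \<xi> \<eta> p \<in> tangent_space S p"
proof -
  have *: "lie_bracket S \<xi> \<eta> p d = jac c d p (lie_bracket S \<xi> \<eta> p c)"
    if cd: "c \<in> S" "d \<in> S" "p \<in> fst c" "p \<in> fst d" for c d
  proof -
    let ?D = "\<lambda>i. frechet_derivative (\<lambda>x. frechet_derivative (transition c d) (at x) i) (at (snd c p))"
    have sm: "smooth_on (snd c ` (fst c \<inter> fst d)) (transition c d)" by (rule smooth_transition[OF cd(1,2)])
    have O: "open (snd c ` (fst c \<inter> fst d))" "snd c p \<in> snd c ` (fst c \<inter> fst d)"
      using open_overlap[OF cd(1) chart_domain[OF cd(2)]] cd by auto
    have lin: "linear (?D i)" for i
      by (rule has_derivative_linear[OF smooth_on_has_derivative[OF smooth_on_derivative[OF sm] O(2)]])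
    have 1: "(\<Sum>i\<in>Basis. (v \<bullet> i) *\<^sub>R ?D i w) = (\<Sum>i\<in>Basis. \<Sum>k\<in>Basis. ((v \<bullet> i) * (w \<bullet> k)) *\<^sub>R ?D i k)" for v w
      by (simp add: linear_euclidean_expand[OF lin, of _ w] scaleR_sum_right)
    have 2: "(\<Sum>i\<in>Basis. \<Sum>k\<in>Basis. ((v \<bullet> i) * (w \<bullet> k)) *\<^sub>R ?D i k)
        = (\<Sum>i\<in>Basis. \<Sum>k\<in>Basis. ((w \<bullet> i) * (v \<bullet> k)) *\<^sub>R ?D i k)" for v w
      by (subst sum.swap, intro sum.cong refl)
        (simp only: second_derivative_symmetric[OF O sm, of _ "_ :: real^'n"] mult.commute)
    have sym: "(\<Sum>i\<in>Basis. (v \<bullet> i) *\<^sub>R ?D i w) = (\<Sum>i\<in>Basis. (w \<bullet> i) *\<^sub>R ?D i v)" for v w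
      unfolding 1 by (rule 2)
    have \<xi>\<eta>: "\<xi> p d = jac c d p (\<xi> p c)" "\<eta> p d = jac c d p (\<eta> p c)"
      by (rule tangent_jac[OF vfield_onD(2)[OF \<xi> p] cd] tangent_jac[OF vfield_onD(2)[OF \<eta> p] cd])+
    have br: "lie_bracket S \<xi> \<eta> p e = frechet_derivative (\<lambda>x. \<eta> (chart_inv e x) e) (at (snd e p)) (\<xi> p e)
        - frechet_derivative (\<lambda>x. \<xi> (chart_inv e x) e) (at (snd e p)) (\<eta> p e)" if "e \<in> S" "p \<in> fst e" for e
      using that by (simp add: lie_bracket_def)
    show ?thesis
      unfolding br[OF cd(1,3)] br[OF cd(2,4)] \<xi>\<eta> vfield_transform_derivative[OF \<xi> p cd]
        vfield_transform_derivative[OF \<eta> p cd] linear_diff[OF linear_jac[OF cd]] sym[of "\<xi> p c" "\<eta> p c"]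
      by simp
  qed
  show ?thesis
    by (rule tangent_spaceI[OF _ *]) (auto simp: lie_bracket_def)
qed

end

lemma bounded_bilinear_matrix_vector_mult:
  "bounded_bilinear ((*v) :: real^'n^'m \<Rightarrow> real^'n \<Rightarrow> real^'m)"
  unfolding bilinear_conv_bounded_bilinear[symmetric] bilinear_def
  by (intro conjI allI linearI)
    (simp_all add: matrix_vector_right_distrib matrix_vector_mult_add_rdistrib scaleR_matrix_vector_assoc
      matrix_vector_mult_scaleR)

locale operator_field = manifold M S for M :: "'a topology" and S :: "('a, 'n::finite) chart set" +
  fixes L :: "('a, 'n) opfield"
  assumes operator: "smooth_operator_field M S L"
begin

lemma L_tangent: "p \<in> topspace M \<Longrightarrow> v \<in> tangent_space S p \<Longrightarrow> L p v \<in> tangent_space S p"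
  using operator unfolding smooth_operator_field_def by blast

lemma L_lincomb: "p \<in> topspace M \<Longrightarrow> v \<in> tangent_space S p \<Longrightarrow> w \<in> tangent_space S p \<Longrightarrow>
    L p (\<lambda>c. a *\<^sub>R v c + b *\<^sub>R w c) = (\<lambda>c. a *\<^sub>R L p v c + b *\<^sub>R L p w c)"
  using operator unfolding smooth_operator_field_def by blast

text \<open>One induction carries both claims, because linearity of \<open>L p\<close> is available
  only on tangent vectors. The empty sum is a combination with both coefficients 0.\<close>

lemma tangent_sum_and_L:
  fixes a :: "'j \<Rightarrow> real"
  assumes p: "p \<in> topspace M" and w: "\<And>j. w j \<in> tangent_space S p" and F: "finite F"
  shows "(\<lambda>d. \<Sum>j\<in>F. a j *\<^sub>R w j d) \<in> tangent_space S p \<and>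
    L p (\<lambda>d. \<Sum>j\<in>F. a j *\<^sub>R w j d) = (\<lambda>d. \<Sum>j\<in>F. a j *\<^sub>R L p (w j) d)"
  using F
proof induction
  case empty
  show ?case
    using tangent_space_lincomb[OF w w, where a = 0 and b = 0] L_lincomb[OF p w w, where a = 0 and b = 0]
    by simp
next
  case (insert i F)
  show ?case
    using tangent_space_lincomb[OF w[of i], of "\<lambda>d. \<Sum>j\<in>F. a j *\<^sub>R w j d" "a i" 1]
      L_lincomb[OF p w[of i], of "\<lambda>d. \<Sum>j\<in>F. a j *\<^sub>R w j d" "a i" 1] insert by simp
qed

text \<open>\<open>v\<close> and the combination of coordinate vectors with coefficients
  \<open>v c\<close> are tangent vectors with equal components in \<open>c\<close>, hence equal;
  then linearity gives the matrix product.\<close>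

lemma L_matrix:
  assumes c: "c \<in> S" "p \<in> fst c" and v: "v \<in> tangent_space S p"
  shows "L p v c = op_matrix S L c p *v v c"
proof -
  have p: "p \<in> topspace M" using chart_subset c by blast
  let ?w = "\<lambda>j. coord_field S c j p"
  have w: "?w j \<in> tangent_space S p" for j unfolding coord_field_eq by (rule tangent_of_in[OF c])
  let ?u = "\<lambda>d. \<Sum>j\<in>UNIV. (v c $ j) *\<^sub>R ?w j d"
  note u = tangent_sum_and_L[where w = ?w and F = UNIV and a = "\<lambda>j. v c $ j", OF p w finite]
  have "?u c = v c"
    by (simp add: coord_field_eq tangent_of_self[OF c] vec_eq_iff axis_def if_distrib cong: if_cong)
  then have "tangent_of c p (v c) = ?u"
    using tangent_of_eq[OF conjunct1[OF u] c] by simp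
  then have uv: "?u = v" by (simp only: tangent_of_eq[OF v c])
  show ?thesis
    using fun_cong[OF conjunct2[OF u], of c] unfolding uv
    by (simp add: vec_eq_iff op_matrix_def op_apply_def matrix_vector_mult_def mult.commute)
qed

abbreviation opA :: "('a, 'n) chart \<Rightarrow> 'a \<Rightarrow> real^'n \<Rightarrow> real^'n" where
  "opA c p \<equiv> (*v) (op_matrix S L c p)"

definition opD :: "('a, 'n) chart \<Rightarrow> 'a \<Rightarrow> real^'n \<Rightarrow> real^'n \<Rightarrow> real^'n" where
  "opD c p u v = frechet_derivative (\<lambda>x. op_matrix S L c (chart_inv c x)) (at (snd c p)) u *v v"

lemma smooth_op_matrix: "c \<in> S \<Longrightarrow> smooth_on (img c) (\<lambda>x. op_matrix S L c (chart_inv c x))"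
  using operator unfolding smooth_operator_field_def by blast

lemma op_apply_derivative:
  assumes \<xi>: "vfield_on W \<xi>" and p: "p \<in> W" "d \<in> S" "p \<in> fst d"
  shows "((\<lambda>x. op_apply L \<xi> (chart_inv d x) d) has_derivative
    (\<lambda>u. opA d p (frechet_derivative (\<lambda>x. \<xi> (chart_inv d x) d) (at (snd d p)) u)
      + opD d p u (\<xi> p d))) (at (snd d p))"
proof -
  have 1: "((\<lambda>x. op_matrix S L d (chart_inv d x)) has_derivative
      frechet_derivative (\<lambda>x. op_matrix S L d (chart_inv d x)) (at (snd d p))) (at (snd d p))"
    by (rule smooth_on_has_derivative[OF smooth_op_matrix[OF p(2)]]) (use p in auto)
  have O: "open (snd d ` (fst d \<inter> W))" "snd d p \<in> snd d ` (fst d \<inter> W)"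
    using open_overlap[OF p(2) vfield_onD(1)[OF \<xi> p(1)]] p by auto
  show ?thesis
    using bounded_bilinear.FDERIV[OF bounded_bilinear_matrix_vector_mult 1 vfield_onD(3)[OF \<xi> p]]
    unfolding opD_def chart_inv_left[OF p(2,3)]
  proof (rule has_derivative_transform_within_open[OF _ O])
    fix x assume "x \<in> snd d ` (fst d \<inter> W)"
    then obtain q where q: "q \<in> fst d" "q \<in> W" "x = snd d q" by blast
    show "op_matrix S L d (chart_inv d x) *v \<xi> (chart_inv d x) d = op_apply L \<xi> (chart_inv d x) d"
      using L_matrix[OF p(2) q(1) vfield_onD(2)[OF \<xi> q(2)]] p(2) q by (simp add: op_apply_def)
  qed
qed

lemma vfield_op_apply:
  assumes \<xi>: "vfield_on W \<xi>"
  shows "vfield_on W (op_apply L \<xi>)"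
proof -
  have W: "openin M W" using \<xi> by (simp add: vfield_on_def)
  show ?thesis
    unfolding vfield_on_def
  proof (intro conjI ballI impI W)
    fix p assume p: "p \<in> W"
    then have "p \<in> topspace M" using W openin_subset by blast
    then show "op_apply L \<xi> p \<in> tangent_space S p"
      unfolding op_apply_def by (rule L_tangent[OF _ vfield_onD(2)[OF \<xi> p]])
    show "(\<lambda>x. op_apply L \<xi> (chart_inv d x) d) differentiable (at (snd d p))" if "d \<in> S" "p \<in> fst d" for d
      using op_apply_derivative[OF \<xi> p that] by (rule differentiableI)
  qed
qed

section \<open>The torsions in coordinates\<close>

lemma bracket_comp:
  assumes "c \<in> S" "p \<in> fst c"
  shows "lie_bracket S \<xi> \<eta> p c = frechet_derivative (\<lambda>x. \<eta> (chart_inv c x) c) (at (snd c p)) (\<xi> p c)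
    - frechet_derivative (\<lambda>x. \<xi> (chart_inv c x) c) (at (snd c p)) (\<eta> p c)"
  using assms by (simp add: lie_bracket_def)

lemma nijenhuis_at: "nijenhuis S L \<xi> \<eta> p = L p (L p (lie_bracket S \<xi> \<eta> p))
    + lie_bracket S (op_apply L \<xi>) (op_apply L \<eta>) p
    - L p (lie_bracket S (op_apply L \<xi>) \<eta> p) - L p (lie_bracket S \<xi> (op_apply L \<eta>) p)"
  unfolding nijenhuis_def op_apply_def by simp

lemma haantjes_at: "haantjes S L \<xi> \<eta> p = L p (L p (nijenhuis S L \<xi> \<eta> p))
    + nijenhuis S L (op_apply L \<xi>) (op_apply L \<eta>) p
    - L p (nijenhuis S L (op_apply L \<xi>) \<eta> p) - L p (nijenhuis S L \<xi> (op_apply L \<eta>) p)"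
  unfolding haantjes_def op_apply_def by simp

lemma nijenhuis_tangent:
  assumes \<xi>: "vfield_on W \<xi>" and \<eta>: "vfield_on W \<eta>" and p: "p \<in> W"
  shows "nijenhuis S L \<xi> \<eta> p \<in> tangent_space S p"
proof -
  have M: "p \<in> topspace M" using vfield_onD(1)[OF \<xi> p] p openin_subset by blast
  note f = vfield_op_apply[OF \<xi>] vfield_op_apply[OF \<eta>]
  show ?thesis
    unfolding nijenhuis_at
    by (intro tangent_space_add tangent_space_diff L_tangent[OF M] lie_bracket_tangent[OF _ _ p] f \<xi> \<eta>)
qed

text \<open>The derivatives of \<open>\<xi>\<close> and \<open>\<eta>\<close> cancel, so only their
  values at \<open>p\<close> and the first-order jet of \<open>L\<close> remain: the torsion is a
  tensor.\<close>

lemma nijenhuis_comp: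
  assumes \<xi>: "vfield_on W \<xi>" and \<eta>: "vfield_on W \<eta>" and p: "p \<in> W" and c: "c \<in> S" "p \<in> fst c"
  shows "nijenhuis S L \<xi> \<eta> p c = nij (opA c p) (opD c p) (\<xi> p c) (\<eta> p c)"
proof -
  have M: "p \<in> topspace M" using chart_subset c by blast
  note f = vfield_op_apply[OF \<xi>] vfield_op_apply[OF \<eta>]
  note L = L_matrix[OF c]
  have L\<xi>: "op_apply L \<xi> p c = opA c p (\<xi> p c)" and L\<eta>: "op_apply L \<eta> p c = opA c p (\<eta> p c)"
    unfolding op_apply_def by (rule L[OF vfield_onD(2)[OF \<xi> p]] L[OF vfield_onD(2)[OF \<eta> p]])+
  note T = lie_bracket_tangent[OF \<xi> \<eta> p] lie_bracket_tangent[OF f(1) \<eta> p] lie_bracket_tangent[OF \<xi> f(2) p]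
  let ?d = "\<lambda>\<zeta>. frechet_derivative (\<lambda>x. \<zeta> (chart_inv c x) c) (at (snd c p))"
  have d: "?d (op_apply L \<zeta>) u = opA c p (?d \<zeta> u) + opD c p u (\<zeta> p c)" if "vfield_on W \<zeta>" for \<zeta> u
    by (rule frechet_derivative_eqI[OF op_apply_derivative[OF that p c]])
  show ?thesis
    unfolding nijenhuis_at plus_fun_apply minus_apply L[OF L_tangent[OF M T(1)]] L[OF T(1)] L[OF T(2)] L[OF T(3)]
      bracket_comp[OF c] d[OF \<xi>] d[OF \<eta>] L\<xi> L\<eta> nij_def
    by (simp add: matrix_vector_right_distrib matrix_vector_mult_diff_distrib)
qed

lemma haantjes_tangent:
  assumes \<xi>: "vfield_on W \<xi>" and \<eta>: "vfield_on W \<eta>" and p: "p \<in> W"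
  shows "haantjes S L \<xi> \<eta> p \<in> tangent_space S p"
proof -
  have M: "p \<in> topspace M" using vfield_onD(1)[OF \<xi> p] p openin_subset by blast
  note f = vfield_op_apply[OF \<xi>] vfield_op_apply[OF \<eta>]
  show ?thesis
    unfolding haantjes_at
    by (intro tangent_space_add tangent_space_diff L_tangent[OF M] nijenhuis_tangent[OF _ _ p] f \<xi> \<eta>)
qed

lemma haantjes_field_comp:
  assumes \<xi>: "vfield_on W \<xi>" and \<eta>: "vfield_on W \<eta>" and p: "p \<in> W" and c: "c \<in> S" "p \<in> fst c"
  shows "haantjes S L \<xi> \<eta> p c = haa (opA c p) (opD c p) (\<xi> p c) (\<eta> p c)"
proof -
  have M: "p \<in> topspace M" using chart_subset c by blast
  note f = vfield_op_apply[OF \<xi>] vfield_op_apply[OF \<eta>]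
  note L = L_matrix[OF c]
  have L\<xi>: "op_apply L \<xi> p c = opA c p (\<xi> p c)" and L\<eta>: "op_apply L \<eta> p c = opA c p (\<eta> p c)"
    unfolding op_apply_def by (rule L[OF vfield_onD(2)[OF \<xi> p]] L[OF vfield_onD(2)[OF \<eta> p]])+
  note T = nijenhuis_tangent[OF \<xi> \<eta> p] nijenhuis_tangent[OF f(1) \<eta> p] nijenhuis_tangent[OF \<xi> f(2) p]
  note N = nijenhuis_comp[OF _ _ p c]
  show ?thesis
    unfolding haantjes_at plus_fun_apply minus_apply L[OF L_tangent[OF M T(1)]] L[OF T(1)] L[OF T(2)] L[OF T(3)]
      N[OF \<xi> \<eta>] N[OF f] N[OF f(1) \<eta>] N[OF \<xi> f(2)] L\<xi> L\<eta> haa_def ..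
qed

lemma haantjes_comp_eq:
  assumes c: "c \<in> S" "p \<in> fst c"
  shows "haantjes_comp S L c p i j k = haa (opA c p) (opD c p) (axis j 1) (axis k 1) $ i"
proof -
  have "coord_field S c j = (\<lambda>p. tangent_of c p (axis j 1))" for j
    by (rule ext) (rule coord_field_eq)
  then show ?thesis
    using haantjes_field_comp[OF vfield_tangent_of[OF c(1)] vfield_tangent_of[OF c(1)] c(2) c]
    by (simp add: haantjes_comp_def tangent_of_self[OF c])
qed

text \<open>Both sides are readings of one tangent vector, the Haantjes torsion of two fields with
  constant coefficients in \<open>c\<close>.\<close>

lemma haa_tensorial:
  assumes cd: "c \<in> S" "d \<in> S" "p \<in> fst c" "p \<in> fst d"
  shows "haa (opA d p) (opD d p) (jac c d p v) (jac c d p w) = jac c d p (haa (opA c p) (opD c p) v w)"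
proof -
  let ?h = "haantjes S L (\<lambda>p. tangent_of c p v) (\<lambda>p. tangent_of c p w) p"
  note f = vfield_tangent_of[OF cd(1)]
  have "?h c = haa (opA c p) (opD c p) v w"
    using haantjes_field_comp[OF f f cd(3) cd(1,3)] by (simp add: tangent_of_self[OF cd(1,3)])
  moreover have "?h d = haa (opA d p) (opD d p) (jac c d p v) (jac c d p w)"
    using haantjes_field_comp[OF f f cd(3) cd(2,4)] cd by (simp add: tangent_of_def)
  moreover have "?h d = jac c d p (?h c)"
    by (rule tangent_jac[OF haantjes_tangent[OF f f cd(3)] cd])
  ultimately show ?thesis by simp
qed

lemma opA_jac:
  assumes cd: "c \<in> S" "d \<in> S" "p \<in> fst c" "p \<in> fst d"
  shows "opA d p (jac c d p v) = jac c d p (opA c p v)"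
proof -
  have M: "p \<in> topspace M" using chart_subset cd by blast
  note T = tangent_of_in[OF cd(1,3), of v]
  have "L p (tangent_of c p v) d = jac c d p (L p (tangent_of c p v) c)"
    by (rule tangent_jac[OF L_tangent[OF M T] cd])
  then show ?thesis
    unfolding L_matrix[OF cd(1,3) T] L_matrix[OF cd(2,4) T] tangent_of_self[OF cd(1,3)]
    using cd by (simp add: tangent_of_def)
qed

end

context manifold
begin

text \<open>\<open>\<psi>\<close> leads from new to old coordinates, and maximality of the atlas
  admits the new chart. Its Jacobi matrix is the derivative of \<open>\<psi>\<close>, which
  expresses the new coordinate fields in the old chart.\<close>

lemma new_chart:
  assumes c: "c \<in> S" and Z: "open Z" and V: "open V" "V \<subseteq> img c" and hom: "homeomorphism Z V \<psi> g"
    and sm: "smooth_on Z \<psi>" "smooth_on V g"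
  defines "c' \<equiv> ({p \<in> fst c. snd c p \<in> V}, \<lambda>p. g (snd c p))"
  shows "c' \<in> S" "img c' = Z"
    "\<And>p. p \<in> fst c' \<Longrightarrow> jac c' c p = frechet_derivative \<psi> (at (snd c' p))"
    "\<And>p. p \<in> fst c' \<Longrightarrow> \<psi> (snd c' p) = snd c p"
proof -
  have fst': "fst c' = {p \<in> fst c. snd c p \<in> V}" and snd': "snd c' p = g (snd c p)" for p
    by (simp_all add: c'_def)
  have g: "g y \<in> Z" "\<psi> (g y) = y" if "y \<in> V" for y
    using hom that by (auto simp: homeomorphism_def)
  have \<psi>: "\<psi> z \<in> V" "g (\<psi> z) = z" if "z \<in> Z" for z
    using hom that by (auto simp: homeomorphism_def)
  have W: "openin M (fst c')" unfolding fst' by (rule chart_open_preimage[OF c V(1)])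
  have cW: "snd c ` fst c' = V" using V(2) unfolding fst' by blast
  have gV: "g ` V = Z" using hom by (simp add: homeomorphism_def)
  show img': "img c' = Z" using gV cW by (simp add: snd' image_image[of g "snd c", symmetric])
  have \<psi>': "\<psi> (snd c' p) = snd c p" if "p \<in> fst c'" for p
    using g(2) that by (simp add: snd' fst')
  then show "\<And>p. p \<in> fst c' \<Longrightarrow> \<psi> (snd c' p) = snd c p" .
  have inv': "chart_inv c' z = chart_inv c (\<psi> z)" if "z \<in> Z" for z
  proof -
    have q: "chart_inv c (\<psi> z) \<in> fst c" "snd c (chart_inv c (\<psi> z)) = \<psi> z"
      using \<psi>(1)[OF that] V(2) chart_inv_in[of "\<psi> z" c] chart_inv_right[of "\<psi> z" c] by blast+
    have inj: "inj_on (snd c') (fst c')"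
      by (rule inj_onI) (metis (mono_tags, lifting) \<psi>' chart_inj[OF c] fst' inj_onD mem_Collect_eq)
    show ?thesis
      unfolding chart_inv_def[of c']
      by (rule inv_into_f_eq[OF inj]) (use q \<psi>[OF that] in \<open>simp_all add: fst' snd'\<close>)
  qed
  have h1: "homeomorphic_map (subtopology M (fst c')) (top_of_set V) (snd c)"
  proof -
    have "homeomorphic_map (subtopology (subtopology M (fst c)) (fst c')) (subtopology (top_of_set (img c)) V) (snd c)"
    proof (rule homeomorphic_map_subtopologies[OF chart_homeo[OF c]])
      show "snd c ` (topspace (subtopology M (fst c)) \<inter> fst c') = topspace (top_of_set (img c)) \<inter> V"
        using chart_subset[OF c] V(2) unfolding fst' by auto
    qed
    moreover have "fst c \<inter> fst c' = fst c'" "img c \<inter> V = V" using V(2) by (auto simp: fst')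
    ultimately show ?thesis by (simp add: subtopology_subtopology)
  qed
  have "homeomorphic_maps (top_of_set V) (top_of_set Z) g \<psi>"
    unfolding homeomorphic_maps_def
    using hom by (auto simp: homeomorphism_def)
  then have h2: "homeomorphic_map (top_of_set V) (top_of_set Z) g" by (rule homeomorphic_maps_imp_map)
  have hom': "homeomorphic_map (subtopology M (fst c')) (top_of_set Z) (snd c')"
    using homeomorphic_map_compose[OF h1 h2] by (simp add: c'_def o_def)
  have on: "chart_on M c'"
    unfolding chart_on_def img' using W Z hom' by blast
  have comp: "compatible c' d" if d: "d \<in> S" for d
    unfolding compatible_def
  proof (intro conjI)
    let ?O = "snd c ` (fst c \<inter> fst d)"
    have O: "open ?O" by (rule open_overlap[OF c chart_domain[OF d]])
    have eq: "snd c' ` (fst c' \<inter> fst d) = Z \<inter> \<psi> -` ?O"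
    proof (intro set_eqI iffI)
      fix z assume "z \<in> snd c' ` (fst c' \<inter> fst d)"
      then obtain p where "p \<in> fst c'" "p \<in> fst d" "z = snd c' p" by blast
      then show "z \<in> Z \<inter> \<psi> -` ?O" using \<psi>'[of p] img' by (auto simp: fst')
    next
      fix z assume z: "z \<in> Z \<inter> \<psi> -` ?O"
      then obtain p where p: "p \<in> fst c" "p \<in> fst d" "\<psi> z = snd c p" by blast
      then have "p \<in> fst c'" "z = snd c' p" using z \<psi>[of z] by (auto simp: fst' snd' simp flip: p(3))
      then show "z \<in> snd c' ` (fst c' \<inter> fst d)" using p by blast
    qed
    have O': "open (Z \<inter> \<psi> -` ?O)"
      using continuous_open_preimage[OF smooth_on_imp_continuous_on[OF sm(1)] Z O] .
    have "smooth_on (Z \<inter> \<psi> -` ?O) (\<lambda>z. transition c d (\<psi> z))"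
      by (rule smooth_on_compose[OF O' O smooth_on_subset[OF sm(1)] smooth_transition[OF c d]]) auto
    then show "smooth_on (snd c' ` (fst c' \<inter> fst d)) (transition c' d)"
      unfolding eq by (rule smooth_on_cong[OF O', rotated]) (simp add: transition_def inv')
    have P: "open (snd d ` (fst c' \<inter> fst d))"
      using open_overlap[OF d W] by (simp add: Int_commute)
    have "smooth_on (snd d ` (fst c' \<inter> fst d)) (\<lambda>y. g (transition d c y))"
    proof (rule smooth_on_compose[OF P V(1) smooth_on_subset[OF smooth_transition[OF d c]] sm(2)])
      show "snd d ` (fst c' \<inter> fst d) \<subseteq> snd d ` (fst d \<inter> fst c)" by (auto simp: fst')
      show "transition d c ` snd d ` (fst c' \<inter> fst d) \<subseteq> V"
      proof (intro image_subsetI)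
        fix p assume "p \<in> snd d ` (fst c' \<inter> fst d)"
        then obtain q where "q \<in> fst c'" "q \<in> fst d" "p = snd d q" by blast
        then show "transition d c p \<in> V" using d by (simp add: fst')
      qed
    qed
    then show "smooth_on (snd d ` (fst c' \<inter> fst d)) (transition d c')"
      by (rule smooth_on_cong[OF P, rotated]) (simp add: transition_def snd')
  qed
  show c': "c' \<in> S" by (rule maximal[OF on]) (simp add: comp)
  show "jac c' c p = frechet_derivative \<psi> (at (snd c' p))" if p: "p \<in> fst c'" for p
  proof -
    have z: "snd c' p \<in> Z" using img' p by blast
    have "(transition c' c has_derivative frechet_derivative \<psi> (at (snd c' p))) (at (snd c' p))"
    proof (rule has_derivative_transform_within_open[OF smooth_on_has_derivative[OF sm(1) z] Z z])
      fix z assume "z \<in> Z"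
      then show "\<psi> z = transition c' c z"
        using \<psi>(1) V(2) by (simp add: transition_def inv' chart_inv_right subset_iff)
    qed
    from frechet_derivativeI[OF this] show ?thesis by (simp add: jac_def)
  qed
qed

end

section \<open>Operators similar to a single Jordan block\<close>

lemma four_cases: "(i::4) = 0 \<or> i = 1 \<or> i = 2 \<or> i = 3"
  using exhaust_4[of i] by auto

lemma UNIV_four: "(UNIV :: 4 set) = {0, 1, 2, 3}"
  using four_cases by auto

lemma sum_four: "(\<Sum>i\<in>UNIV. f (i::4)) = f 0 + f 1 + f 2 + f 3"
  unfolding UNIV_four by (simp add: ac_simps)

lemma less_four [simp]: "(0::4) < 1" "(0::4) < 2" "(0::4) < 3" "(1::4) < 2" "(1::4) < 3" "(2::4) < 3"
  by (simp_all add: less_bit0_def bit0.Rep_0 bit0.Rep_1 bit0.Rep_numeral)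

lemma not_less_four [simp]: "\<not> (1::4) < 0" "\<not> (2::4) < 0" "\<not> (3::4) < 0" "\<not> (2::4) < 1" "\<not> (3::4) < 1" "\<not> (3::4) < 2"
  by (simp_all add: not_less less_imp_le)

lemma jordan_block4_apply:
  "(jordan_block4 \<mu> *v a) = \<mu> *\<^sub>R a + (\<chi> i. if i = 3 then 0 else a $ (i + 1))"
proof -
  have "(jordan_block4 \<mu> *v a) $ i = (\<mu> *\<^sub>R a + (\<chi> i. if i = 3 then 0 else a $ (i + 1))) $ i" for i
    using four_cases[of i]
    by (elim disjE) (simp_all add: matrix_vector_mult_def sum_four jordan_block4_def)
  then show ?thesis by (simp add: vec_eq_iff)
qed

lemma trace_jordan_block4: "trace (jordan_block4 \<mu>) = 4 * \<mu>"
  by (simp add: trace_def sum_four jordan_block4_def)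

definition shift4 :: "real^4 \<Rightarrow> real^4" where
  "shift4 a = (\<chi> i. if i = 3 then 0 else a $ (i + 1))"

lemma shift4_simps [simp]: "shift4 a $ 0 = a $ 1" "shift4 a $ 1 = a $ 2" "shift4 a $ 2 = a $ 3" "shift4 a $ 3 = 0"
  by (simp_all add: shift4_def)

lemma vec4_eqI: "a $ 0 = b $ 0 \<Longrightarrow> a $ 1 = b $ 1 \<Longrightarrow> a $ 2 = b $ 2 \<Longrightarrow> a $ 3 = b $ 3 \<Longrightarrow> a = (b :: 'a^4)"
  by (simp add: vec_eq_iff) (metis four_cases)

text \<open>A linear operator on a four-dimensional space is a single nilpotent Jordan block iff
  its fourth power vanishes, its third power does not, and its kernel is one-dimensional.\<close>

definition nilpotent_block :: "('a::real_vector \<Rightarrow> 'a) \<Rightarrow> bool" where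
  "nilpotent_block B \<longleftrightarrow> (\<forall>v. B (B (B (B v))) = 0) \<and> (\<exists>v. B (B (B v)) \<noteq> 0) \<and>
    (\<forall>v w. B (B (B v)) \<noteq> 0 \<longrightarrow> B w = 0 \<longrightarrow> (\<exists>c. w = c *\<^sub>R B (B (B v))))"

lemma nilpotent_block_conjugate:
  fixes B :: "real^4 \<Rightarrow> real^4"
  assumes Q: "linear Q" "bij Q" and B: "\<And>a. B (Q a) = Q (shift4 a)"
  shows "nilpotent_block B"
proof -
  have s4: "shift4 (shift4 (shift4 (shift4 a))) = 0" for a
    by (rule vec4_eqI) simp_all
  have surj: "\<exists>a. v = Q a" for v using Q(2) by (metis bij_pointE)
  have inj: "Q a = 0 \<longleftrightarrow> a = 0" for a using Q linear_0[OF Q(1)] by (metis bij_pointE)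
  show ?thesis
    unfolding nilpotent_block_def
  proof (intro conjI allI impI)
    show "B (B (B (B v))) = 0" for v
      using surj[of v] s4 linear_0[OF Q(1)] by (auto simp: B)
    have "shift4 (shift4 (shift4 (axis 3 1))) $ 0 = 1" by (simp add: axis_def)
    then have "B (B (B (Q (axis 3 1)))) \<noteq> 0" by (metis B inj zero_index zero_neq_one)
    then show "\<exists>v. B (B (B v)) \<noteq> 0" by blast
    fix v w assume vw: "B (B (B v)) \<noteq> 0" "B w = 0"
    obtain a b where a: "v = Q a" and b: "w = Q b" using surj by blast
    have "shift4 b = 0" using vw(2) by (simp add: b B inj)
    then have b0: "b $ 1 = 0" "b $ 2 = 0" "b $ 3 = 0" by (metis shift4_simps zero_index)+
    have "a $ 3 \<noteq> 0"
    proof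
      assume "a $ 3 = 0"
      then have "shift4 (shift4 (shift4 a)) = 0" by (intro vec4_eqI) simp_all
      then show False using vw(1) by (simp add: a B inj)
    qed
    \<comment> \<open>The cube of \<open>shift4\<close> sends \<open>a\<close> to
      \<open>a $ 3\<close> times the first basis vector, which spans the kernel containing
      \<open>b\<close>.\<close>
    then have "b = (b $ 0 / a $ 3) *\<^sub>R shift4 (shift4 (shift4 a))"
      using b0 by (intro vec4_eqI) simp_all
    then have "w = (b $ 0 / a $ 3) *\<^sub>R B (B (B v))"
      unfolding a b B by (metis linear_scale[OF Q(1)])
    then show "\<exists>c. w = c *\<^sub>R B (B (B v))" by blast
  qed
qed

text \<open>\<open>A\<close> is the conjugate of \<open>J\<close> by \<open>Q\<close>, and the trace
  is invariant under cyclic exchange. This identifies a quarter of the trace of \<open>L\<close>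
  with its eigenvalue and shows that it does not depend on the chart.\<close>

lemma trace_similar:
  fixes A J :: "real^'n^'n"
  assumes Q: "linear Q" "bij Q" and AQ: "\<And>a. A *v Q a = Q (J *v a)"
  shows "trace A = trace J"
proof -
  have R: "linear (inv Q)" using inj_linear_imp_inv_linear[OF Q(1)] bij_is_inj[OF Q(2)] by blast
  note [simp] = fun_cong[OF matrix_vector_mul(2)[OF Q(1)]] fun_cong[OF matrix_vector_mul(2)[OF R]]
  have 1: "A = (matrix Q ** J) ** matrix (inv Q)"
    by (simp add: matrix_eq matrix_vector_mul_assoc[symmetric] AQ[symmetric] surj_f_inv_f[OF bij_is_surj[OF Q(2)]])
  have 2: "matrix (inv Q) ** (matrix Q ** J) = J"
    by (simp add: matrix_eq matrix_vector_mul_assoc[symmetric] inv_f_f[OF bij_is_inj[OF Q(2)]])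
  show ?thesis unfolding 1 trace_mul_sym[of "matrix Q ** J"] 2 ..
qed

locale jordan_field = operator_field M S L for M :: "'a topology" and S :: "('a, 4) chart set" and L +
  assumes jordan: "\<And>p. p \<in> topspace M \<Longrightarrow> single_jordan_block S L p"
begin

abbreviation opB :: "('a, 4) chart \<Rightarrow> 'a \<Rightarrow> real^4 \<Rightarrow> real^4" where
  "opB c p \<equiv> (*v) (tracefree_matrix S L c p)"

definition eigenvalue :: "('a, 4) chart \<Rightarrow> 'a \<Rightarrow> real" where
  "eigenvalue c p = 1/4 * trace (op_matrix S L c p)"

lemma op_matrix_split: "op_matrix S L c p = tracefree_matrix S L c p + eigenvalue c p *\<^sub>R mat 1"
  by (simp add: tracefree_matrix_def eigenvalue_def)

lemma opA_split: "opA c p v = eigenvalue c p *\<^sub>R v + opB c p v"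
  by (simp add: op_matrix_split matrix_vector_mult_add_rdistrib scaleR_matrix_vector_assoc[symmetric])

lemma nilpotent_block_opB:
  assumes c: "c \<in> S" "p \<in> fst c"
  shows "nilpotent_block (opB c p)"
proof -
  have "p \<in> topspace M" using chart_subset c by blast
  from jordan[OF this] obtain \<mu> P where P: "bij_betw P UNIV (tangent_space S p)" "\<And>c. linear (\<lambda>a. P a c)"
    "\<And>a. L p (P a) = P (jordan_block4 \<mu> *v a)"
    unfolding single_jordan_block_def by blast
  define Q where "Q = (\<lambda>a. P a c)"
  have Q: "linear Q" using P(2) unfolding Q_def .
  have bij: "bij Q"
    using bij_betw_trans[OF P(1) bij_tangent[OF c]] by (simp add: Q_def o_def)
  have AQ: "opA c p (Q a) = Q (jordan_block4 \<mu> *v a)" for a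
  proof -
    have "P a \<in> tangent_space S p" using P(1) by (auto simp: bij_betw_def)
    from L_matrix[OF c this] show ?thesis by (simp add: Q_def P(3))
  qed
  have "eigenvalue c p = \<mu>"
    using trace_similar[OF Q bij AQ] by (simp add: eigenvalue_def trace_jordan_block4)
  then have "opB c p (Q a) = Q (shift4 a)" for a
    using AQ[of a] opA_split[of c p "Q a"]
    by (simp add: jordan_block4_apply shift4_def[symmetric] linear_add[OF Q] linear_scale[OF Q])
  then show ?thesis by (rule nilpotent_block_conjugate[OF Q bij])
qed

lemma smooth_eigenvalue:
  assumes "c \<in> S"
  shows "smooth_on (img c) (\<lambda>x. eigenvalue c (chart_inv c x))"
proof -
  have "linear (\<lambda>A :: real^4^4. 1/4 * trace A)"
    by (rule linearI) (simp_all add: trace_def sum.distrib sum_distrib_left algebra_simps)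
  then show ?thesis
    unfolding eigenvalue_def
    by (intro smooth_on_bounded_linear[OF open_img[OF assms] _ smooth_op_matrix[OF assms]])
      (simp add: linear_conv_bounded_linear)
qed

lemma smooth_tracefree:
  assumes "c \<in> S"
  shows "smooth_on (img c) (\<lambda>x. tracefree_matrix S L c (chart_inv c x))"
proof -
  have "smooth_on (img c) (\<lambda>x. op_matrix S L c (chart_inv c x) - eigenvalue c (chart_inv c x) *\<^sub>R mat 1)"
    unfolding smooth_on_def
    by (intro allI Ck_on_diff[OF open_img[OF assms] smooth_onD[OF smooth_op_matrix[OF assms]]]
        Ck_on_bounded_linear[OF open_img[OF assms] bounded_linear_scaleR_left smooth_onD[OF smooth_eigenvalue[OF assms]]])
  then show ?thesis by (simp add: op_matrix_split)
qed

definition opDB :: "('a, 4) chart \<Rightarrow> 'a \<Rightarrow> real^4 \<Rightarrow> real^4 \<Rightarrow> real^4" where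
  "opDB c p u v = frechet_derivative (\<lambda>x. tracefree_matrix S L c (chart_inv c x)) (at (snd c p)) u *v v"

lemma tracefree_has_derivative:
  assumes "c \<in> S" "p \<in> fst c"
  shows "((\<lambda>x. tracefree_matrix S L c (chart_inv c x)) has_derivative
    frechet_derivative (\<lambda>x. tracefree_matrix S L c (chart_inv c x)) (at (snd c p))) (at (snd c p))"
  by (rule smooth_on_has_derivative[OF smooth_tracefree[OF assms(1)]]) (use assms in auto)

lemma tracefree_apply_has_derivative:
  assumes "c \<in> S" "p \<in> fst c" "(f has_derivative f') (at (snd c p))"
  shows "((\<lambda>x. tracefree_matrix S L c (chart_inv c x) *v f x) has_derivative
    (\<lambda>u. opB c p (f' u) + opDB c p u (f (snd c p)))) (at (snd c p))"
  using bounded_bilinear.FDERIV[OF bounded_bilinear_matrix_vector_mult tracefree_has_derivative[OF assms(1,2)] assms(3)]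
  by (simp add: opDB_def assms)

lemma opD_split:
  assumes c: "c \<in> S" "p \<in> fst c"
  shows "opD c p u v = frechet_derivative (\<lambda>x. eigenvalue c (chart_inv c x)) (at (snd c p)) u *\<^sub>R v + opDB c p u v"
proof -
  have "((\<lambda>x. eigenvalue c (chart_inv c x)) has_derivative
      frechet_derivative (\<lambda>x. eigenvalue c (chart_inv c x)) (at (snd c p))) (at (snd c p))"
    by (rule smooth_on_has_derivative[OF smooth_eigenvalue[OF c(1)]]) (use c in auto)
  then have "((\<lambda>x. eigenvalue c (chart_inv c x) *\<^sub>R (mat 1 :: real^4^4)) has_derivative
      (\<lambda>u. frechet_derivative (\<lambda>x. eigenvalue c (chart_inv c x)) (at (snd c p)) u *\<^sub>R mat 1)) (at (snd c p))"
    by (rule has_derivative_scaleR_left)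
  from has_derivative_add[OF tracefree_has_derivative[OF c] this]
  have "((\<lambda>x. op_matrix S L c (chart_inv c x)) has_derivative
      (\<lambda>u. frechet_derivative (\<lambda>x. tracefree_matrix S L c (chart_inv c x)) (at (snd c p)) u
        + frechet_derivative (\<lambda>x. eigenvalue c (chart_inv c x)) (at (snd c p)) u *\<^sub>R mat 1)) (at (snd c p))"
    unfolding op_matrix_split[symmetric] .
  from frechet_derivative_eqI[OF this] show ?thesis
    by (simp add: opD_def opDB_def matrix_vector_mult_add_rdistrib scaleR_matrix_vector_assoc[symmetric])
qed

lemma linear_opDB: "linear (opDB c p u)"
  unfolding opDB_def by (rule matrix_vector_mul_linear)

lemma linear_opDB_left:
  assumes "c \<in> S" "p \<in> fst c"
  shows "linear (\<lambda>u. opDB c p u v)"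
  unfolding opDB_def
  using bounded_linear_compose[OF bounded_bilinear.bounded_linear_left[OF bounded_bilinear_matrix_vector_mult]
      has_derivative_bounded_linear[OF tracefree_has_derivative[OF assms]]]
  by (simp add: linear_conv_bounded_linear)

lemma nilpotent_jet:
  assumes c: "c \<in> S" "p \<in> fst c"
  shows "nilpotent_jet (opB c p) (opDB c p)"
proof (rule nilpotent_jet.intro)
  show "linear (opB c p)" by (rule matrix_vector_mul_linear)
  show "linear (\<lambda>v. opDB c p v w)" for w by (rule linear_opDB_left[OF c])
  show "linear (opDB c p v)" for v by (rule linear_opDB)
  show "opB c p (opB c p (opB c p (opB c p v))) = 0" for v
    using nilpotent_block_opB[OF c] by (simp add: nilpotent_block_def)
  note d = tracefree_apply_has_derivative[OF c]
  let ?B = "\<lambda>x. (*v) (tracefree_matrix S L c (chart_inv c x))"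
  show "opDB c p u (opB c p (opB c p (opB c p v))) + opB c p (opDB c p u (opB c p (opB c p v))
      + opB c p (opDB c p u (opB c p v) + opB c p (opDB c p u v))) = 0" for u v
  proof -
    \<comment> \<open>The field \<open>B^4 v\<close> with constant \<open>v\<close> vanishes
      identically; its derivative is the identity \<open>D_nil\<close>.\<close>
    note D = d[OF d[OF d[OF d[OF has_derivative_const[of v]]]]]
    have z: "?B x (?B x (?B x (?B x v))) = 0" if "x \<in> img c" for x
      using nilpotent_block_opB[OF c(1) chart_inv_in[OF that]] by (simp add: nilpotent_block_def)
    have "((\<lambda>x. 0 :: real^4) has_derivative (\<lambda>u. opB c p (opB c p (opB c p (opB c p 0 + opDB c p u v)
        + opDB c p u (?B (snd c p) v)) + opDB c p u (?B (snd c p) (?B (snd c p) v)))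
        + opDB c p u (?B (snd c p) (?B (snd c p) (?B (snd c p) v))))) (at (snd c p))"
      by (rule has_derivative_transform_within_open[OF D open_img[OF c(1)]]) (use c z in auto)
    from fun_cong[OF has_derivative_unique[OF this has_derivative_const], of u] show ?thesis
      using c by (simp add: matrix_vector_right_distrib add.commute)
  qed
qed

lemma regular_nilpotent_jet:
  assumes c: "c \<in> S" "p \<in> fst c" and v: "opB c p (opB c p (opB c p v)) \<noteq> 0"
  shows "regular_nilpotent_jet (opB c p) (opDB c p) v"
  unfolding regular_nilpotent_jet_def regular_nilpotent_jet_axioms_def
  using nilpotent_jet[OF c] nilpotent_block_opB[OF c] v by (auto simp: nilpotent_block_def)

lemma haa_opA:
  assumes c: "c \<in> S" "p \<in> fst c"
  shows "haa (opA c p) (opD c p) v w = haa (opB c p) (opDB c p) v w"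
proof -
  interpret nilpotent_jet "opB c p" "opDB c p" by (rule nilpotent_jet[OF c])
  have d: "linear (frechet_derivative (\<lambda>x. eigenvalue c (chart_inv c x)) (at (snd c p)))"
    by (rule has_derivative_linear[OF smooth_on_has_derivative[OF smooth_eigenvalue[OF c(1)]]]) (use c in auto)
  have "opA c p = (\<lambda>v. eigenvalue c p *\<^sub>R v + opB c p v)" by (rule ext) (rule opA_split)
  moreover have "opD c p = (\<lambda>u v. frechet_derivative (\<lambda>x. eigenvalue c (chart_inv c x)) (at (snd c p)) u *\<^sub>R v
      + opDB c p u v)" by (intro ext) (rule opD_split[OF c])
  ultimately show ?thesis using haa_shift[OF B D1 D2 d] by simp
qed

abbreviation torB :: "('a, 4) chart \<Rightarrow> 'a \<Rightarrow> real^4 \<Rightarrow> real^4 \<Rightarrow> real^4" where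
  "torB c p \<equiv> tor (opB c p) (haa (opB c p) (opDB c p))"

lemma basis_expand: "(v :: real^'n) = (\<Sum>r\<in>UNIV. (v $ r) *\<^sub>R axis r 1)"
  by (simp add: vec_eq_iff axis_def if_distrib cong: if_cong)

lemma T_comp_eq:
  assumes c: "c \<in> S" "p \<in> fst c"
  shows "T_comp S L c p i j k = torB c p (axis j 1) (axis k 1) $ i"
proof -
  interpret nilpotent_jet "opB c p" "opDB c p" by (rule nilpotent_jet[OF c])
  let ?M = "tracefree_matrix S L c p" and ?h = "haa (opB c p) (opDB c p)"
  have l1: "linear (\<lambda>v. ?h v w)" and l2: "linear (?h v)" for v w
    by (rule linearI; simp add: haa_bilinear)+
  have H: "haantjes_comp S L c p s r k = ?h (axis r 1) (axis k 1) $ s" for s r k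
    using haantjes_comp_eq[OF c] haa_opA[OF c] by simp
  have e1: "?h v w $ s = (\<Sum>r\<in>UNIV. v $ r * ?h (axis r 1) w $ s)" for v w s
    by (subst basis_expand[of v]) (simp add: linear_sum[OF l1] linear_scale[OF l1])
  have e2: "?h v w $ s = (\<Sum>r\<in>UNIV. w $ r * ?h v (axis r 1) $ s)" for v w s
    by (subst basis_expand[of w]) (simp add: linear_sum[OF l2] linear_scale[OF l2])
  have col: "opB c p (axis j 1) $ r = ?M $ r $ j" for r j
    by (simp add: matrix_vector_mult_basis column_def)
  have mv: "opB c p v $ i = (\<Sum>s\<in>UNIV. ?M $ i $ s * v $ s)" for v i
    by (simp add: matrix_vector_mult_def)
  have 1: "opB c p (?h (opB c p (axis j 1)) (axis k 1)) $ i
      = (\<Sum>s\<in>UNIV. \<Sum>r\<in>UNIV. ?M $ i $ s * ?h (axis r 1) (axis k 1) $ s * ?M $ r $ j)"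
    by (simp only: mv e1[of "opB c p (axis j 1)"] col[unfolded mv] sum_distrib_left) (simp add: ac_simps)
  have 2: "opB c p (?h (axis j 1) (opB c p (axis k 1))) $ i
      = (\<Sum>s\<in>UNIV. \<Sum>r\<in>UNIV. ?M $ i $ s * ?h (axis j 1) (axis r 1) $ s * ?M $ r $ k)"
    by (simp only: mv e2[of _ "opB c p (axis k 1)"] col[unfolded mv] sum_distrib_left) (simp add: ac_simps)
  have 3: "?h (opB c p (opB c p (axis j 1))) (axis k 1) $ i
      = (\<Sum>s\<in>UNIV. \<Sum>r\<in>UNIV. ?h (axis s 1) (axis k 1) $ i * ?M $ s $ r * ?M $ r $ j)"
    by (simp only: e1[of "opB c p (opB c p (axis j 1))"] mv[of "opB c p (axis j 1)"] col
        sum_distrib_left sum_distrib_right) (simp add: ac_simps sum_distrib_left)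
  show ?thesis
    unfolding T_comp_def Let_def H tor_def vector_add_component vector_minus_component 1 2 3 ..
qed

lemma T_comp_zero_iff:
  assumes c: "c \<in> S" "p \<in> fst c"
  shows "(\<forall>i j k. T_comp S L c p i j k = 0) \<longleftrightarrow> (\<forall>v w. torB c p v w = 0)"
proof
  interpret nilpotent_jet "opB c p" "opDB c p" by (rule nilpotent_jet[OF c])
  assume "\<forall>i j k. T_comp S L c p i j k = 0"
  then have z: "torB c p (axis j 1) (axis k 1) = 0" for j k
    using T_comp_eq[OF c] by (simp add: vec_eq_iff)
  have l1: "linear (\<lambda>v. torB c p v w)" and l2: "linear (torB c p v)" for v w
    by (rule linearI; simp add: tor_bilinear)+
  have "torB c p (axis j 1) w = 0" for j w
    by (subst basis_expand[of w]) (simp add: linear_sum[OF l2] linear_scale[OF l2] z)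
  then have "torB c p v w = 0" for v w
    by (subst basis_expand[of v]) (simp add: linear_sum[OF l1] linear_scale[OF l1])
  then show "\<forall>v w. torB c p v w = 0" by blast
next
  assume "\<forall>v w. torB c p v w = 0"
  then show "\<forall>i j k. T_comp S L c p i j k = 0" using T_comp_eq[OF c] by simp
qed

lemma opB_jac:
  assumes cd: "c \<in> S" "d \<in> S" "p \<in> fst c" "p \<in> fst d"
  shows "opB d p (jac c d p v) = jac c d p (opB c p v)"
proof -
  have J: "linear (jac c d p)" by (rule linear_jac[OF cd])
  have ev: "eigenvalue d p = eigenvalue c p"
  proof -
    have "bij (jac c d p)"
      by (rule o_bij[of "jac d c p"]) (auto simp: fun_eq_iff jac_inverse cd)
    from trace_similar[OF J this opA_jac[OF cd]] show ?thesis by (simp add: eigenvalue_def)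
  qed
  show ?thesis
    using opA_jac[OF cd, of v] unfolding opA_split linear_add[OF J] linear_scale[OF J] ev by simp
qed

lemma torB_jac:
  assumes cd: "c \<in> S" "d \<in> S" "p \<in> fst c" "p \<in> fst d"
  shows "torB d p (jac c d p v) (jac c d p w) = jac c d p (torB c p v w)"
  using haa_tensorial[OF cd]
  by (simp add: tor_def opB_jac[OF cd] haa_opA cd linear_add[OF linear_jac[OF cd]] linear_diff[OF linear_jac[OF cd]])

end

section \<open>Flags of coordinate subspaces\<close>

lemma nat_four_cases: "n < 4 \<Longrightarrow> n = 0 \<or> n = 1 \<or> n = 2 \<or> n = (3::nat)"
  by auto

lemma of_nat_four_less: "a < 4 \<Longrightarrow> b < 4 \<Longrightarrow> (of_nat a :: 4) < of_nat b \<longleftrightarrow> a < b"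
  by (drule nat_four_cases, drule nat_four_cases) (elim disjE; simp)

lemma of_nat_four_inj: "a < 4 \<Longrightarrow> b < 4 \<Longrightarrow> (of_nat a :: 4) = of_nat b \<longleftrightarrow> a = b"
  using of_nat_four_less by (metis less_irrefl linorder_neqE_nat)

lemma of_nat_four_surj: "\<exists>n<4. (i::4) = of_nat n"
proof -
  have "i = of_nat 0 \<or> i = of_nat 1 \<or> i = of_nat 2 \<or> i = of_nat 3" using four_cases[of i] by simp
  then obtain n :: nat where "n \<in> {0, 1, 2, 3}" "i = of_nat n" by blast
  then show ?thesis by (intro exI[of _ n]) auto
qed

text \<open>The span of the first \<open>m\<close> coordinate vectors. Indices are naturals because
  addition in the type \<open>4\<close> is cyclic and the arguments below are inductions.\<close>

definition flag :: "nat \<Rightarrow> (real^4) set" where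
  "flag m = {w. \<forall>n. m \<le> n \<longrightarrow> n < 4 \<longrightarrow> w $ of_nat n = 0}"

lemma flagD: "w \<in> flag m \<Longrightarrow> m \<le> n \<Longrightarrow> n < 4 \<Longrightarrow> w $ of_nat n = 0"
  by (simp add: flag_def)

lemma flag_mono: "w \<in> flag m \<Longrightarrow> m \<le> m' \<Longrightarrow> w \<in> flag m'"
  by (auto simp: flag_def)

lemma flag_four: "w \<in> flag 4"
  by (simp add: flag_def)

lemma flag_zero: "w \<in> flag 0 \<Longrightarrow> w = 0"
  using of_nat_four_surj by (auto simp: flag_def vec_eq_iff) metis

lemma flag_add: "v \<in> flag m \<Longrightarrow> w \<in> flag m \<Longrightarrow> v + w \<in> flag m"
  and flag_diff: "v \<in> flag m \<Longrightarrow> w \<in> flag m \<Longrightarrow> v - w \<in> flag m"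
  by (simp_all add: flag_def)

lemma flag_strict_upper:
  fixes A :: "real^4^4"
  assumes A: "\<And>i j. j \<le> i \<Longrightarrow> A $ i $ j = 0" and w: "w \<in> flag (Suc m)"
  shows "A *v w \<in> flag m"
  unfolding flag_def
proof (intro CollectI allI impI)
  fix n assume n: "m \<le> n" "n < (4::nat)"
  have "A $ of_nat n $ j * w $ j = 0" for j
  proof -
    obtain b where b: "b < 4" "j = of_nat b" using of_nat_four_surj by blast
    show ?thesis
    proof (cases "n < b")
      case True
      then show ?thesis using flagD[OF w, of b] b n by simp
    next
      case False
      then have "\<not> of_nat n < j" using of_nat_four_less[OF n(2) b(1)] b(2) by simp
      then show ?thesis using A by simp
    qed
  qed
  then show "(A *v w) $ of_nat n = 0"
    by (simp only: matrix_vector_mult_def vec_lambda_beta sum.neutral_const)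
qed

text \<open>Modulo the coordinate vectors before index \<open>i\<close>, the vector
  \<open>axis i 1\<close> is an eigenvector for the diagonal entry, so the fourth power of that
  entry vanishes.\<close>

lemma nilpotent_upper_triangular_diagonal:
  fixes A :: "real^4^4"
  assumes A: "\<And>i j. j < i \<Longrightarrow> A $ i $ j = 0" and nil: "\<And>v. A *v (A *v (A *v (A *v v))) = 0"
  shows "A $ i $ i = 0"
proof -
  have step: "(A *v w) $ l = (if l = i then A $ i $ i * w $ i else 0)"
    if w: "\<And>l. i < l \<Longrightarrow> w $ l = 0" and l: "i \<le> l" for w l
  proof -
    have "A $ l $ j * w $ j = (if j = i then if l = i then A $ i $ i * w $ i else 0 else 0)" for j
      using A[of j l] A[of i l] w[of j] l by (cases "j = i"; cases "j < l") auto
    then show ?thesis by (simp add: matrix_vector_mult_def)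
  qed
  let ?e = "axis i 1 :: real^4"
  have z: "(A *v w) $ l = 0" if "\<And>l. i < l \<Longrightarrow> w $ l = 0" "i < l" for w l
    using step[OF that(1)] that(2) by simp
  have e: "?e $ l = 0" if "i < l" for l using that by (auto simp: axis_def)
  have "(A *v (A *v (A *v (A *v ?e)))) $ i = A $ i $ i * (A $ i $ i * (A $ i $ i * (A $ i $ i * 1)))"
    using step[OF z[OF z[OF z[OF e]]], of i] step[OF z[OF z[OF e]], of i] step[OF z[OF e], of i] step[OF e, of i]
    by simp
  then show ?thesis using nil[of ?e] by simp
qed

lemma linear_funpow: "linear (B :: 'a::real_vector \<Rightarrow> 'a) \<Longrightarrow> linear (B ^^ n)"
  by (induction n) (auto intro: linear_compose simp: linear_id)

text \<open>\<open>B^k\<close> maps \<open>ker B^(k+1)\<close> to the line \<open>ker B\<close>. The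
  coordinate vector with index \<open>k\<close> is not sent to 0, since by induction
  \<open>ker B^k\<close> contains only vectors whose component \<open>k\<close> is 0. Hence any
  element of \<open>ker B^(k+1)\<close> is a multiple of it plus an element of
  \<open>ker B^k\<close>.\<close>

lemma nilpotent_block_flag:
  fixes B :: "real^4 \<Rightarrow> real^4"
  assumes B: "linear B" "nilpotent_block B" and k: "k \<le> 4"
    and ad: "\<And>i. i < k \<Longrightarrow> (B ^^ Suc i) (axis (of_nat i) 1) = 0" and w: "(B ^^ k) w = 0"
  shows "w \<in> flag k"
  using k ad w
proof (induction k arbitrary: w)
  case 0
  then show ?case by (simp add: flag_def)
next
  case (Suc k)
  obtain v where v: "B (B (B v)) \<noteq> 0" using B(2) by (auto simp: nilpotent_block_def)
  have ker: "\<exists>c. u = c *\<^sub>R B (B (B v))" if "B u = 0" for u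
    using B(2) v that by (simp add: nilpotent_block_def)
  let ?e = "axis (of_nat k) 1 :: real^4"
  have IH: "u \<in> flag k" if "(B ^^ k) u = 0" for u
    using Suc.IH[of u] Suc.prems(1,2) that by simp
  have k: "k < 4" using Suc.prems(1) by simp
  have "(B ^^ k) ?e \<noteq> 0"
  proof
    assume "(B ^^ k) ?e = 0"
    from flagD[OF IH[OF this] order_refl k] show False by (simp add: axis_def)
  qed
  moreover obtain a where a: "(B ^^ k) ?e = a *\<^sub>R B (B (B v))"
    using ker[of "(B ^^ k) ?e"] Suc.prems(2)[of k] by auto
  ultimately have a0: "a \<noteq> 0" by auto
  obtain b where b: "(B ^^ k) w = b *\<^sub>R B (B (B v))"
    using ker[of "(B ^^ k) w"] Suc.prems(3) by auto
  have "(B ^^ k) (w - (b / a) *\<^sub>R ?e) = 0"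
    using a0 by (simp add: linear_diff[OF linear_funpow[OF B(1)]] linear_scale[OF linear_funpow[OF B(1)]] a b)
  note f = flagD[OF IH[OF this]]
  show ?case
    unfolding flag_def
  proof (intro CollectI allI impI)
    fix n assume n: "Suc k \<le> n" "n < (4::nat)"
    have "?e $ of_nat n = 0" using of_nat_four_inj[OF k n(2)] n(1) by (simp add: axis_def)
    then show "w $ of_nat n = 0" using f[of n] n by simp
  qed
qed

section \<open>The triangular coordinate systems\<close>

context jordan_field
begin

section \<open>Triangular coordinates force \<open>T\<close> to vanish\<close>

lemma strictly_upper_triangular:
  assumes c: "c \<in> S" "p \<in> fst c" and ut: "upper_triangular_in S L c" and ij: "j \<le> i"
  shows "tracefree_matrix S L c p $ i $ j = 0"
proof -
  have lt: "tracefree_matrix S L c p $ i $ j = 0" if "j < i" for i j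
    using ut c(2) that by (auto simp: upper_triangular_in_def tracefree_matrix_def mat_def)
  moreover have "tracefree_matrix S L c p $ i $ i = 0"
    by (rule nilpotent_upper_triangular_diagonal[OF lt])
      (use nilpotent_block_opB[OF c] in \<open>simp_all add: nilpotent_block_def\<close>)
  ultimately show ?thesis using ij by (cases "j = i") auto
qed

text \<open>\<open>B\<close> and its derivatives are strictly upper triangular, so each lowers the
  flag by one. Thus \<open>E v i\<close> and \<open>DE v u i\<close> lie in
  \<open>flag (4 - i)\<close>, the brackets \<open>[e_1, e_2]\<close> and \<open>[e_1, e_3]\<close>
  in \<open>flag 3\<close>, and \<open>[e_2, e_3]\<close> in \<open>flag 2\<close>; the powers of
  \<open>B\<close> in front of them lead to \<open>flag 0\<close>.\<close>

lemma torB_upper_triangular: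
  assumes c: "c \<in> S" "p \<in> fst c" and ut: "upper_triangular_in S L c"
  shows "torB c p x y = 0"
proof -
  let ?Bx = "\<lambda>x. tracefree_matrix S L c (chart_inv c x)"
  obtain v where v: "opB c p (opB c p (opB c p v)) \<noteq> 0"
    using nilpotent_block_opB[OF c] by (auto simp: nilpotent_block_def)
  interpret regular_nilpotent_jet "opB c p" "opDB c p" v by (rule regular_nilpotent_jet[OF c v])
  have Bf: "opB c p w \<in> flag m" if "w \<in> flag (Suc m)" for w m
    by (rule flag_strict_upper[OF strictly_upper_triangular[OF c ut] that])
  have Du: "frechet_derivative ?Bx (at (snd c p)) u $ i $ j = 0" if ij: "j \<le> i" for u i j
  proof -
    have "((\<lambda>x. ?Bx x $ i $ j) has_derivative (\<lambda>u. frechet_derivative ?Bx (at (snd c p)) u $ i $ j)) (at (snd c p))"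
      by (intro bounded_linear.has_derivative[OF bounded_linear_vec_nth] tracefree_has_derivative[OF c])
    then have "((\<lambda>x. 0) has_derivative (\<lambda>u. frechet_derivative ?Bx (at (snd c p)) u $ i $ j)) (at (snd c p))"
    proof (rule has_derivative_transform_within_open[OF _ open_img[OF c(1)]])
      show "snd c p \<in> img c" using c by blast
      show "?Bx x $ i $ j = 0" if "x \<in> img c" for x
        by (rule strictly_upper_triangular[OF c(1) chart_inv_in[OF that] ut ij])
    qed
    from fun_cong[OF has_derivative_unique[OF this has_derivative_const], of u] show ?thesis by simp
  qed
  have Df: "opDB c p u w \<in> flag m" if "w \<in> flag (Suc m)" for u w m
    unfolding opDB_def by (rule flag_strict_upper[OF Du that])
  have E: "E v i \<in> flag (4 - i)" if "i \<le> 4" for i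
    using that
  proof (induction i)
    case 0
    then show ?case by (simp add: flag_four)
  next
    case (Suc i)
    then have "4 - i = Suc (4 - Suc i)" by simp
    with Suc show ?case using Bf[of "E v i" "4 - Suc i"] by (simp add: B_E)
  qed
  have DE: "DE v u i \<in> flag (4 - i)" if "i \<le> 4" for i u
    using that
  proof (induction i)
    case 0
    then show ?case by (simp add: flag_four)
  next
    case (Suc i)
    then have e: "4 - i = Suc (4 - Suc i)" by simp
    with Suc E[of i] show ?case
      using Bf[of "DE v u i" "4 - Suc i"] Df[of "E v i" "4 - Suc i"] by (simp add: flag_add)
  qed
  have br: "br v i j \<in> flag (4 - i)" if "i \<le> j" "j \<le> 4" for i j
    unfolding br_def using that
    by (intro flag_diff flag_mono[OF DE[of j]] DE) auto
  have 1: "br v 1 2 \<in> flag (Suc (Suc (Suc 0)))" "br v 1 3 \<in> flag (Suc (Suc (Suc 0)))"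
    and 2: "br v 2 3 \<in> flag (Suc (Suc 0))"
    using br[of 1 2] br[of 1 3] br[of 2 3] by (simp_all add: eval_nat_numeral)
  show ?thesis
    by (rule tor_zeroI[OF flag_zero[OF Bf[OF Bf[OF Bf[OF 1(1)]]]] flag_zero[OF Bf[OF Bf[OF Bf[OF 1(2)]]]]
          flag_zero[OF Bf[OF Bf[OF 2]]]])
qed

lemma triangular_imp_torB_zero:
  assumes c: "c \<in> S" "p \<in> fst c" "upper_triangular_in S L c" and d: "d \<in> S" "p \<in> fst d"
  shows "torB d p x y = 0"
proof -
  have "torB d p (jac c d p (jac d c p x)) (jac c d p (jac d c p y)) = jac c d p 0"
    unfolding torB_jac[OF c(1) d(1) c(2) d(2)] torB_upper_triangular[OF c] ..
  then show ?thesis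
    using jac_inverse[OF d(1) c(1) d(2) c(2)] linear_0[OF linear_jac[OF c(1) d(1) c(2) d(2)]] by simp
qed

section \<open>Integrable kernels and the construction of adapted charts\<close>

lemma ker2_derivative:
  assumes c: "c \<in> S" "p \<in> fst c" and T: "\<And>v w. torB c p v w = 0"
    and U: "open U" "snd c p \<in> U" and X: "(X has_derivative X') (at (snd c p))"
    and XU: "\<And>q. q \<in> fst c \<Longrightarrow> snd c q \<in> U \<Longrightarrow> opB c q (opB c q (X (snd c q))) = 0"
    and e: "\<And>q. q \<in> fst c \<Longrightarrow> opB c q (opB c q e) = 0"
  shows "opB c p (opB c p (X' e)) = 0"
proof -
  obtain v where v: "opB c p (opB c p (opB c p v)) \<noteq> 0"
    using nilpotent_block_opB[OF c] by (auto simp: nilpotent_block_def)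
  interpret regular_nilpotent_jet "opB c p" "opDB c p" v by (rule regular_nilpotent_jet[OF c v])
  \<comment> \<open>This is the derivative of the identity \<open>B^2 Y = 0\<close>.\<close>
  have gen: "opB c p (opB c p (Y' u)) + pd2 u (Y (snd c p)) = 0"
    if Y: "(Y has_derivative Y') (at (snd c p))"
      and z: "\<And>q. q \<in> fst c \<Longrightarrow> snd c q \<in> U \<Longrightarrow> opB c q (opB c q (Y (snd c q))) = 0" for Y Y' u
  proof -
    let ?B = "\<lambda>x. (*v) (tracefree_matrix S L c (chart_inv c x))"
    note D = tracefree_apply_has_derivative[OF c tracefree_apply_has_derivative[OF c Y]]
    have "((\<lambda>x. 0 :: real^4) has_derivative (\<lambda>u. opB c p (opB c p (Y' u) + opDB c p u (Y (snd c p)))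
        + opDB c p u (?B (snd c p) (Y (snd c p))))) (at (snd c p))"
    proof (rule has_derivative_transform_within_open[OF D])
      show "open (img c \<inter> U)" "snd c p \<in> img c \<inter> U" using open_img[OF c(1)] U c by auto
      show "?B x (?B x (Y x)) = 0" if "x \<in> img c \<inter> U" for x
        using z[OF chart_inv_in, of x] that by (simp add: chart_inv_right)
    qed
    from fun_cong[OF has_derivative_unique[OF this has_derivative_const], of u] show ?thesis
      using c by (simp add: pd2_def algebra_simps)
  qed
  \<comment> \<open>Integrability exchanges the arguments; the exchanged term vanishes because the
    constant field \<open>e\<close> lies in the kernel at every point.\<close>
  have "pd2 e (X (snd c p)) = pd2 (X (snd c p)) e"
    by (rule ker2_integrable[OF T e[OF c(2)] XU[OF c(2) U(2)]])
  moreover have "pd2 (X (snd c p)) e = 0"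
    using gen[OF has_derivative_const, of e "X (snd c p)"] e by simp
  ultimately show ?thesis using gen[OF X XU, of e] by simp
qed

lemma ker3_derivative:
  assumes c: "c \<in> S" "p \<in> fst c" and T: "\<And>v w. torB c p v w = 0"
    and U: "open U" "snd c p \<in> U" and X: "(X has_derivative X') (at (snd c p))"
    and XU: "\<And>q. q \<in> fst c \<Longrightarrow> snd c q \<in> U \<Longrightarrow> opB c q (opB c q (opB c q (X (snd c q)))) = 0"
    and e: "\<And>q. q \<in> fst c \<Longrightarrow> opB c q (opB c q (opB c q e)) = 0"
  shows "opB c p (opB c p (opB c p (X' e))) = 0"
proof -
  obtain v where v: "opB c p (opB c p (opB c p v)) \<noteq> 0"
    using nilpotent_block_opB[OF c] by (auto simp: nilpotent_block_def)
  interpret regular_nilpotent_jet "opB c p" "opDB c p" v by (rule regular_nilpotent_jet[OF c v])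
  have gen: "opB c p (opB c p (opB c p (Y' u))) + pd3 u (Y (snd c p)) = 0"
    if Y: "(Y has_derivative Y') (at (snd c p))"
      and z: "\<And>q. q \<in> fst c \<Longrightarrow> snd c q \<in> U \<Longrightarrow> opB c q (opB c q (opB c q (Y (snd c q)))) = 0" for Y Y' u
  proof -
    let ?B = "\<lambda>x. (*v) (tracefree_matrix S L c (chart_inv c x))"
    note D = tracefree_apply_has_derivative[OF c tracefree_apply_has_derivative[OF c
          tracefree_apply_has_derivative[OF c Y]]]
    have "((\<lambda>x. 0 :: real^4) has_derivative (\<lambda>u. opB c p (opB c p (opB c p (Y' u) + opDB c p u (Y (snd c p)))
        + opDB c p u (?B (snd c p) (Y (snd c p)))) + opDB c p u (?B (snd c p) (?B (snd c p) (Y (snd c p)))))) (at (snd c p))"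
    proof (rule has_derivative_transform_within_open[OF D])
      show "open (img c \<inter> U)" "snd c p \<in> img c \<inter> U" using open_img[OF c(1)] U c by auto
      show "?B x (?B x (?B x (Y x))) = 0" if "x \<in> img c \<inter> U" for x
        using z[OF chart_inv_in, of x] that by (simp add: chart_inv_right)
    qed
    from fun_cong[OF has_derivative_unique[OF this has_derivative_const], of u] show ?thesis
      using c by (simp add: pd3_def algebra_simps)
  qed
  have "pd3 e (X (snd c p)) = pd3 (X (snd c p)) e"
    by (rule ker3_integrable[OF T e[OF c(2)] XU[OF c(2) U(2)]])
  moreover have "pd3 (X (snd c p)) e = 0"
    using gen[OF has_derivative_const, of e "X (snd c p)"] e by simp
  ultimately show ?thesis using gen[OF X XU, of e] by simp
qed

text \<open>In an adapted chart the first \<open>k\<close> kernels \<open>ker B\<^sup>i\<close> are spanned by coordinate fields.\<close>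

definition adapted :: "nat \<Rightarrow> ('a, 4) chart \<Rightarrow> bool" where
  "adapted k c \<longleftrightarrow> c \<in> S \<and> (\<forall>i<k. \<forall>p\<in>fst c. (opB c p ^^ Suc i) (axis (of_nat i) 1) = 0)"

lemma linear_opB: "linear (opB c p)"
  by (rule matrix_vector_mul_linear)

lemma adapted_flag:
  assumes "adapted k c" "k \<le> 4" "p \<in> fst c" "(opB c p ^^ k) w = 0"
  shows "w \<in> flag k"
  by (rule nilpotent_block_flag[OF linear_opB nilpotent_block_opB assms(2) _ assms(4)])
    (use assms in \<open>auto simp: adapted_def\<close>)

lemma funpow_zero_mono:
  assumes "i \<le> j" "(opB c p ^^ i) v = 0"
  shows "(opB c p ^^ j) v = 0"
  using assms by (induction j rule: dec_induct) (auto simp: linear_0[OF linear_opB])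

lemma adapted_kernel:
  assumes "adapted k c" "p \<in> fst c" "i < k" "k \<le> n"
  shows "(opB c p ^^ n) (axis (of_nat i) 1) = 0"
  by (rule funpow_zero_mono[where i = "Suc i"]) (use assms in \<open>auto simp: adapted_def\<close>)

lemma funpow_opB_jac:
  assumes cd: "c \<in> S" "d \<in> S" "p \<in> fst c" "p \<in> fst d"
  shows "(opB d p ^^ n) (jac c d p v) = jac c d p ((opB c p ^^ n) v)"
  by (induction n) (auto simp: opB_jac[OF cd])

lemma smooth_opB_funpow:
  assumes c: "c \<in> S"
  shows "smooth_on (img c) (\<lambda>x. (opB c (chart_inv c x) ^^ n) v)"
proof (induction n)
  case 0
  then show ?case by (simp add: smooth_on_def Ck_on_const open_img[OF c])
next
  case (Suc n)
  then show ?case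
    using smooth_on_bounded_bilinear[OF open_img[OF c] bounded_bilinear_matrix_vector_mult smooth_tracefree[OF c]]
    by simp
qed

lemma kernel_derivative:
  assumes c: "c \<in> S" "p \<in> fst c" and T: "\<And>v w. torB c p v w = 0"
    and U: "open U" "snd c p \<in> U" and X: "(X has_derivative X') (at (snd c p))"
    and XU: "\<And>q. q \<in> fst c \<Longrightarrow> snd c q \<in> U \<Longrightarrow> (opB c q ^^ Suc k) (X (snd c q)) = 0"
    and e: "\<And>q. q \<in> fst c \<Longrightarrow> (opB c q ^^ Suc k) e = 0"
    and k: "k = 1 \<or> k = 2"
  shows "(opB c p ^^ Suc k) (X' e) = 0"
  using k
proof
  assume k: "k = 1"
  show ?thesis
    using ker2_derivative[OF c T U X] XU e by (simp add: k)
next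
  assume k: "k = 2"
  show ?thesis
    using ker3_derivative[OF c T U X] XU e by (simp add: k numeral_2_eq_2)
qed

lemma kernel_field:
  assumes ad: "adapted k c" and k: "k < 3" and p0: "p0 \<in> fst c" and T: "\<forall>p\<in>fst c. \<forall>v w. torB c p v w = 0"
  obtains U X m where "open U" "U \<subseteq> img c" "snd c p0 \<in> U" "smooth_on U X" "k \<le> m" "m < 4"
    "\<forall>x\<in>U. X x $ of_nat m = 1"
    "\<forall>p\<in>fst c. snd c p \<in> U \<longrightarrow> (opB c p ^^ Suc k) (X (snd c p)) = 0"
    "\<forall>i<k. \<forall>x\<in>U. frechet_derivative X (at x) (axis (of_nat i) 1) = 0"
proof -
  have c: "c \<in> S" using ad by (simp add: adapted_def)
  obtain v where v: "opB c p0 (opB c p0 (opB c p0 v)) \<noteq> 0"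
    using nilpotent_block_opB[OF c p0] by (auto simp: nilpotent_block_def)
  \<comment> \<open>For constant \<open>v\<close>, this field is in \<open>ker B^(k+1)\<close>
    everywhere as \<open>B^4 = 0\<close>, and not in \<open>ker B^k\<close> at \<open>p0\<close> as
    \<open>B^3 v\<close> is nonzero there.\<close>
  define F where "F x = (opB c (chart_inv c x) ^^ (3 - k)) v" for x
  have F: "smooth_on (img c) F" unfolding F_def by (rule smooth_opB_funpow[OF c])
  have lin: "linear (opB c p ^^ n)" for p n by (rule linear_funpow[OF linear_opB])
  have BF: "(opB c p ^^ n) (F (snd c p)) = (opB c p ^^ (n + (3 - k))) v" if "p \<in> fst c" for n p
    using that c by (simp add: F_def funpow_add)
  \<comment> \<open>Otherwise \<open>F\<close> at \<open>p0\<close> would be a combination of the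
    first \<open>k\<close> coordinate vectors, which \<open>B^k\<close> annihilates.\<close>
  have "\<exists>m\<ge>k. m < 4 \<and> F (snd c p0) $ of_nat m \<noteq> 0"
  proof (rule ccontr)
    assume "\<not> ?thesis"
    then have z: "F (snd c p0) $ of_nat m = 0" if "k \<le> m" "m < 4" for m using that by blast
    have "(F (snd c p0) $ r) *\<^sub>R (opB c p0 ^^ k) (axis r 1) = 0" for r
    proof -
      obtain n where n: "n < 4" "r = of_nat n" using of_nat_four_surj by blast
      show ?thesis using z[of n] adapted_kernel[OF ad p0, of n k] n by (cases "n < k") auto
    qed
    then have "(opB c p0 ^^ k) (F (snd c p0)) = 0"
      by (subst basis_expand[of "F (snd c p0)"]) (simp add: linear_sum[OF lin] linear_scale[OF lin] del: scaleR_eq_0_iff)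
    then have "(opB c p0 ^^ 3) v = 0" using BF[OF p0, of k] k by simp
    then show False using v by (simp add: eval_nat_numeral)
  qed
  then obtain m where m: "k \<le> m" "m < 4" "F (snd c p0) $ of_nat m \<noteq> 0" by blast
  define U where "U = img c \<inter> (\<lambda>x. F x $ of_nat m) -` (- {0})"
  have Fm: "smooth_on (img c) (\<lambda>x. F x $ i)" for i
    by (rule smooth_on_bounded_linear[OF open_img[OF c] bounded_linear_vec_nth F])
  have U: "open U" "U \<subseteq> img c" "snd c p0 \<in> U"
    using continuous_open_preimage[OF smooth_on_imp_continuous_on[OF Fm] open_img[OF c], of "- {0}"] m p0
    by (auto simp: U_def)
  \<comment> \<open>The subtracted vectors lie in \<open>ker B^k\<close>, so \<open>X\<close> stays
    in \<open>ker B^(k+1)\<close>; components before \<open>k\<close> become 0, and component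
    \<open>m\<close> is scaled to 1.\<close>
  define X where "X x = inverse (F x $ of_nat m) *\<^sub>R (F x - (\<Sum>i<k. (F x $ of_nat i) *\<^sub>R axis (of_nat i) 1))" for x
  have sX: "smooth_on U X"
    unfolding smooth_on_def X_def
    by (intro allI Ck_on_scaleR Ck_on_inverse Ck_on_diff Ck_on_sum Ck_on_const U(1)
        smooth_onD[OF smooth_on_subset[OF Fm U(2)]] smooth_onD[OF smooth_on_subset[OF F U(2)]])
      (simp add: U_def)
  have ax: "(axis (of_nat i) 1 :: real^4) $ of_nat n = (if i = n then 1 else 0)" if "i < 4" "n < 4" for i n
    using of_nat_four_inj[OF that] by (auto simp: axis_def)
  have Xm: "X x $ of_nat m = 1" if "x \<in> U" for x
    using that m k by (simp add: X_def U_def ax)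
  have X0: "X x $ of_nat n = 0" if "n < k" for x n
    using that k by (simp add: X_def ax if_distrib cong: if_cong sum.cong_simp)
  have BX: "(opB c p ^^ Suc k) (X (snd c p)) = 0" if p: "p \<in> fst c" for p
  proof -
    have "(opB c p ^^ 4) v = 0"
      using nilpotent_block_opB[OF c p] by (simp add: nilpotent_block_def eval_nat_numeral)
    then have "(opB c p ^^ Suc k) (F (snd c p)) = 0" using BF[OF p, of "Suc k"] k by simp
    moreover have "(opB c p ^^ Suc k) (axis (of_nat i) 1) = 0" if "i < k" for i
      by (rule adapted_kernel[OF ad p that]) simp
    ultimately show ?thesis
      unfolding X_def linear_scale[OF lin] linear_diff[OF lin] linear_sum[OF lin] by simp
  qed
  show ?thesis
  proof (rule that[OF U sX m(1,2)], goal_cases)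
    case 1
    show ?case using Xm by blast
  next
    case 2
    show ?case using BX by blast
  next
    case 3
    show ?case
    proof (intro allI impI ballI)
      fix i x assume i: "i < k" and x: "x \<in> U"
      define p where "p = chart_inv c x"
      have p: "p \<in> fst c" "snd c p = x" using x U(2) by (auto simp: p_def chart_inv_in chart_inv_right)
      let ?w = "frechet_derivative X (at x) (axis (of_nat i) 1)"
      have dX: "(X has_derivative frechet_derivative X (at x)) (at x)" by (rule smooth_on_has_derivative[OF sX x])
      have const: "?w $ l = 0" if "\<And>y. y \<in> U \<Longrightarrow> X y $ l = a" for l a
      proof -
        have "((\<lambda>y. a) has_derivative (\<lambda>u. frechet_derivative X (at x) u $ l)) (at x)"
          by (rule has_derivative_transform_within_open[OF bounded_linear.has_derivative[OF bounded_linear_vec_nth dX] U(1) x])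
            (rule that)
        from fun_cong[OF has_derivative_unique[OF this has_derivative_const]] show ?thesis .
      qed
      have "(opB c p ^^ Suc k) ?w = 0"
      proof (rule kernel_derivative[where X = X and X' = "frechet_derivative X (at x)" and U = U, OF c p(1) _ U(1)])
        show "torB c p v w = 0" for v w using T p(1) by blast
        show "snd c p \<in> U" "(X has_derivative frechet_derivative X (at x)) (at (snd c p))" using p x dX by auto
        show "(opB c q ^^ Suc k) (X (snd c q)) = 0" if "q \<in> fst c" for q by (rule BX[OF that])
        show "(opB c q ^^ Suc k) (axis (of_nat i) 1) = 0" if "q \<in> fst c" for q
          by (rule adapted_kernel[OF ad that i]) simp
        show "k = 1 \<or> k = 2" using i k by auto
      qed
      then have Bw: "opB c p ((opB c p ^^ k) ?w) = 0" by simp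
      have BXp: "opB c p ((opB c p ^^ k) (X x)) = 0" using BX[OF p(1)] p(2) by simp
      obtain v' where v': "opB c p (opB c p (opB c p v')) \<noteq> 0"
        using nilpotent_block_opB[OF c p(1)] by (auto simp: nilpotent_block_def)
      have ker: "\<exists>a. u = a *\<^sub>R opB c p (opB c p (opB c p v'))" if "opB c p u = 0" for u
        using nilpotent_block_opB[OF c p(1)] v' that by (simp add: nilpotent_block_def)
      \<comment> \<open>\<open>B^k\<close> sends both \<open>X\<close> and its derivative
        \<open>?w\<close> into the line \<open>ker B\<close>; comparing coefficients there makes
        \<open>?w\<close> a multiple of \<open>X\<close> modulo \<open>ker B^k\<close>.\<close>
      obtain a b where a: "(opB c p ^^ k) (X x) = a *\<^sub>R opB c p (opB c p (opB c p v'))"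
        and b: "(opB c p ^^ k) ?w = b *\<^sub>R opB c p (opB c p (opB c p v'))"
        using ker[OF Bw] ker[OF BXp] by blast
      have k4: "k \<le> 4" using k by simp
      have a0: "a \<noteq> 0"
      proof
        assume "a = 0"
        then have "(opB c p ^^ k) (X x) = 0" using a by simp
        from flagD[OF adapted_flag[OF ad k4 p(1) this] m(1,2)] show False using Xm[OF x] by simp
      qed
      define t where "t = b / a"
      have "(opB c p ^^ k) (?w - t *\<^sub>R X x) = 0"
        unfolding linear_diff[OF lin] linear_scale[OF lin] a b using a0 by (simp add: t_def)
      note f = flagD[OF adapted_flag[OF ad k4 p(1) this]]
      \<comment> \<open>Component \<open>m\<close> of \<open>X\<close> is constantly 1, so its
        derivative vanishes and the multiple \<open>t\<close> is 0. Then \<open>?w\<close> lies in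
        \<open>flag k\<close>, and its first \<open>k\<close> components vanish since those of
        \<open>X\<close> are constantly 0.\<close>
      have wm: "?w $ of_nat m = 0" by (rule const[OF Xm])
      then have "t = 0" using f[OF m(1,2)] Xm[OF x] by simp
      then have hi: "?w $ of_nat n = 0" if "k \<le> n" "n < 4" for n using f[OF that] by simp
      have lo: "?w $ of_nat n = 0" if "n < k" for n by (rule const[OF X0[OF that]])
      have "?w \<in> flag 0" unfolding flag_def using hi lo by (auto simp: not_le[symmetric])
      then show "?w = 0" by (rule flag_zero)
    qed
  qed
qed

text \<open>In the straightened chart, the coordinate fields with index below \<open>k\<close> are
  the old ones and the field with index \<open>k\<close> is \<open>X\<close>. As \<open>B\<close>
  commutes with Jacobi matrices, the kernel conditions carry over from the old chart.\<close>

lemma adapted_step: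
  assumes ad: "adapted k c" and k: "k < 3" and p0: "p0 \<in> fst c" and T: "\<forall>p\<in>fst c. \<forall>v w. torB c p v w = 0"
  shows "\<exists>c'. adapted (Suc k) c' \<and> p0 \<in> fst c'"
proof -
  have c: "c \<in> S" using ad by (simp add: adapted_def)
  obtain U X m where U: "open U" "U \<subseteq> img c" "snd c p0 \<in> U" and X: "smooth_on U X" and m: "k \<le> m" "m < 4"
    "\<forall>x\<in>U. X x $ of_nat m = 1"
    and BX: "\<forall>p\<in>fst c. snd c p \<in> U \<longrightarrow> (opB c p ^^ Suc k) (X (snd c p)) = 0"
    and dX: "\<forall>i<k. \<forall>x\<in>U. frechet_derivative X (at x) (axis (of_nat i) 1) = 0"
    by (rule kernel_field[OF ad k p0 T])
  define K :: "4 set" where "K = of_nat ` {..<k}"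
  have K: "of_nat n \<notin> K" if "k \<le> n" "n < 4" for n
  proof
    assume "of_nat n \<in> K"
    then obtain i where i: "i < k" "(of_nat n :: 4) = of_nat i" by (auto simp: K_def)
    then show False using of_nat_four_inj[of n i] that k by simp
  qed
  have kK: "of_nat k \<notin> K" by (rule K) (use k in auto)
  have Xm: "X (snd c p0) $ of_nat m \<noteq> 0" using m(3) U(3) by simp
  have dXK: "\<forall>l\<in>K. \<forall>x\<in>U. frechet_derivative X (at x) (axis l 1) = 0"
    using dX by (auto simp: K_def)
  obtain Z V :: "(real^4) set" and \<psi> g where Z: "open Z" "open V" "V \<subseteq> U" "snd c p0 \<in> V" "homeomorphism Z V \<psi> g"
    "smooth_on Z \<psi>" "smooth_on V g"
    and \<psi>k: "\<forall>z\<in>Z. frechet_derivative \<psi> (at z) (axis (of_nat k) 1) = X (\<psi> z)"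
    and \<psi>K: "\<forall>z\<in>Z. \<forall>l\<in>K. frechet_derivative \<psi> (at z) (axis l 1) = axis l 1"
    by (rule straighten_field[OF U(1,3) X Xm K[OF m(1,2)] kK dXK])
  define c' :: "('a, 4) chart" where "c' = ({p \<in> fst c. snd c p \<in> V}, \<lambda>p. g (snd c p))"
  note nc = new_chart[OF c Z(1,2) order_trans[OF Z(3) U(2)] Z(5-7), folded c'_def]
  have "(opB c' p ^^ Suc i) (axis (of_nat i) 1) = 0" if i: "i < Suc k" and p: "p \<in> fst c'" for i p
  proof -
    have pc: "p \<in> fst c" "snd c p \<in> U" using p Z(3) by (auto simp: c'_def)
    have z: "snd c' p \<in> Z" using nc(2) p by blast
    have "(opB c p ^^ Suc i) (jac c' c p (axis (of_nat i) 1)) = 0"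
    proof (cases "i = k")
      case True
      then show ?thesis using BX pc \<psi>k z nc(3,4)[OF p] by simp
    next
      case False
      then have "i < k" "of_nat i \<in> K" using i by (auto simp: K_def)
      then show ?thesis using ad pc(1) \<psi>K z nc(3)[OF p] by (simp add: adapted_def)
    qed
    then have "jac c' c p ((opB c' p ^^ Suc i) (axis (of_nat i) 1)) = 0"
      by (simp only: funpow_opB_jac[OF nc(1) c p pc(1)])
    then show ?thesis
      using jac_inverse[OF nc(1) c p pc(1)] linear_0[OF linear_jac[OF c nc(1) pc(1) p]] by metis
  qed
  then have "adapted (Suc k) c'" unfolding adapted_def using nc(1) by blast
  moreover have "p0 \<in> fst c'" using p0 Z(4) by (simp add: c'_def)
  ultimately show ?thesis by blast
qed

text \<open>\<open>B\<close> sends the coordinate field with index \<open>b\<close> into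
  \<open>ker B^b\<close>, which is contained in \<open>flag b\<close>, so column \<open>b\<close>
  has no entries from row \<open>b\<close> on. Entries below the diagonal occur only in columns 0,
  1, 2, which is why three adapted directions are enough.\<close>

lemma adapted_upper_triangular:
  assumes "adapted 3 c"
  shows "upper_triangular_in S L c"
  unfolding upper_triangular_in_def
proof (intro ballI allI impI)
  fix p and i j :: 4 assume p: "p \<in> fst c" and ij: "j < i"
  obtain a b where ab: "a < 4" "i = of_nat a" "b < 4" "j = of_nat b" using of_nat_four_surj by metis
  have b: "b < a" using ij ab of_nat_four_less by simp
  have "adapted b c" using assms b ab by (simp add: adapted_def)
  moreover have "(opB c p ^^ b) (opB c p (axis j 1)) = 0"
    using assms p b ab by (simp add: adapted_def funpow_swap1)
  ultimately have "opB c p (axis j 1) \<in> flag b" using adapted_flag[OF _ _ p] ab(3) by simp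
  from flagD[OF this _ ab(1)] have "tracefree_matrix S L c p $ i $ j = 0"
    using b ab(2) by (simp add: matrix_vector_mult_basis column_def)
  then show "op_matrix S L c p $ i $ j = 0"
    using ij by (simp add: op_matrix_split mat_def)
qed

lemma torB_zero_imp_triangular:
  assumes T: "\<And>c p v w. c \<in> S \<Longrightarrow> p \<in> fst c \<Longrightarrow> torB c p v w = 0" and p: "p \<in> topspace M"
  shows "\<exists>c\<in>S. p \<in> fst c \<and> upper_triangular_in S L c"
proof -
  have "\<exists>c. adapted k c \<and> p \<in> fst c" if "k \<le> 3" for k
    using that
  proof (induction k)
    case 0
    then show ?case using covered[OF p] by (auto simp: adapted_def)
  next
    case (Suc k)
    then obtain c where "adapted k c" "p \<in> fst c" by auto
    then show ?case using adapted_step[of k c p] T Suc.prems by (auto simp: adapted_def)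
  qed
  then obtain c where c: "adapted 3 c" "p \<in> fst c" by blast
  then have "c \<in> S" by (simp add: adapted_def)
  then show ?thesis using adapted_upper_triangular[OF c(1)] c(2) by blast
qed

end

theorem theorem2:
  fixes M :: "'a topology" and S :: "('a, 4) chart set" and L :: "('a, 4) opfield"
  assumes "smooth_manifold M S"
    and "smooth_operator_field M S L"
    and "\<And>p. p \<in> topspace M \<Longrightarrow> single_jordan_block S L p"
  shows "(\<forall>p\<in>topspace M. \<exists>c\<in>S. p \<in> fst c \<and> upper_triangular_in S L c) \<longleftrightarrow>
         (\<forall>c\<in>S. \<forall>p\<in>fst c. \<forall>i j k. T_comp S L c p i j k = 0)"
proof -
  interpret jordan_field M S L
    by unfold_locales (use assms in auto)
  show ?thesis
  proof
    assume tri: "\<forall>p\<in>topspace M. \<exists>c\<in>S. p \<in> fst c \<and> upper_triangular_in S L c"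
    show "\<forall>c\<in>S. \<forall>p\<in>fst c. \<forall>i j k. T_comp S L c p i j k = 0"
    proof (intro ballI)
      fix d p assume d: "d \<in> S" "p \<in> fst d"
      then obtain c where "c \<in> S" "p \<in> fst c" "upper_triangular_in S L c"
        using tri chart_subset by blast
      then show "\<forall>i j k. T_comp S L d p i j k = 0"
        unfolding T_comp_zero_iff[OF d] using triangular_imp_torB_zero d by blast
    qed
  next
    assume "\<forall>c\<in>S. \<forall>p\<in>fst c. \<forall>i j k. T_comp S L c p i j k = 0"
    then have "torB c p v w = 0" if "c \<in> S" "p \<in> fst c" for c p v w
      using T_comp_zero_iff[OF that] that by blast
    then show "\<forall>p\<in>topspace M. \<exists>c\<in>S. p \<in> fst c \<and> upper_triangular_in S L c"
      using torB_zero_imp_triangular by blast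
  qed
qed

end
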